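(* Let $r\in(2,3)$, let $c_r>0$ be the constant (depending only on $r$) used in the definition of the determining wavenumber $\Lambda_{u,r}$, and let $C_0>0$. There exists a constant $C>0$, depending only on $r$, $c_r$ and $C_0$, such that the following holds. Let $L,\nu,T>0$, let $f\in H^{-1}(\mathbb{T}^3)$ be a time-independent zero-mean force, let $\kappa_0=2\pi/L$, and let $$G:=\frac{\|f\|_{H^{-1}}}{\nu^2\kappa_0^{1/2}}$$ be the Grashof number. Let $u$ be a trajectory on the weak global attractor, i.e. a complete bounded Leray-Hopf solution of the 3D Navier-Stokes equations on $\mathbb{T}^3=[0,L]^3$ with viscosity $\nu$ and force $f$. For $t_0\in\mathbb{R}$ write $\langle g\rangle:=\frac1T\int_{t_0}^{t_0+T}g(\tau)\,d\tau$, $\Lambda:=\Lambda_{u,r}$, and let $Q=Q(\tau)$ be such that $\Lambda(\tau)=\lambda_{Q(\tau)}$. Let $d\in[0,3]$ (the intermittency dimension) be such that $$\Big\langle\sum_{q\le Q}\lambda_q^{-1+\frac6r+d(1-\frac2r)}\|u_q\|_{L^r}^2\Big\rangle\le C_0\,\lambda_0^{d(1-\frac2r)}\Big\langle\sum_{q\le Q}\lambda_q^2\|u_q\|_{L^2}^2\Big\rangle .$$ Then $$\langle\Lambda\rangle-\lambda_0\le C\,\kappa_0\Big(\frac{G^2}{\nu T\kappa_0^2}+G^2\Big)^{\frac{1}{1+d(1-\frac2r)}} .$$ In particular, if $d=0$ then $\langle\Lambda\rangle-\lambda_0\le C\big(\frac{G^2}{\nu T\kappa_0}+\kappa_0G^2\big)$,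 and if $d=3$ then $\langle\Lambda\rangle-\lambda_0\le C\kappa_0\big(\frac{G^2}{\nu T\kappa_0^2}+G^2\big)^{\frac12+\delta}$ with $\delta=\frac{3-r}{4r-6}$.
   Context: Equations: on the torus $\mathbb{T}^3=[0,L]^3$ (periodic), $u_t+(u\cdot\nabla)u-\nu\Delta u+\nabla p=f$, $\nabla\cdot u=0$, with zero-mean solutions. $\|\cdot\|_{H^{-1}}$ is the norm dual to $\|\nabla\cdot\|_{L^2}$ on zero-mean fields. Leray-Hopf solution on $[0,T]$: a function $u\in C_{\mathrm w}([0,T];L^2(\mathbb{T}^3))\cap L^2_{\rm loc}([0,T];H^1(\mathbb{T}^3))$, with $\nabla\cdot u=0$ in the sense of distributions, such that $$(u(t),\varphi(t))+\int_0^t\big[-(u,\partial_t\varphi)+\nu(\nabla u,\nabla\varphi)+(u\cdot\nabla u,\varphi)-(f,\varphi)\big]\,ds=(u(0),\varphi(0))$$ for all $t\in[0,T]$ and all $\varphi\in C^\infty([0,T]\times\mathbb{T}^3)$ with $\nabla\cdot\varphi=0$, and $$\tfrac12\|u(t)\|_{L^2}^2\le\tfrac12\|u(t_0)\|_{L^2}^2+\int_{t_0}^t\big[-\nu\|\nabla u(s)\|_{L^2}^2+(f,u)\big]\,ds$$ for almost all $t_0\in(0,T)$ and all $t\in[t_0,T]$. The same definition applies on any interval $[T_1,T_2]$ by time translation. A complete bounded Leray-Hopf solution is a function $u:\mathbb{R}\to L^2(\mathbb{T}^3)$ that is a Leray-Hopf solution on every interval $[T_1,T_2]$ and satisfies $\sup_{t\in\mathbb{R}}\|u(t)\|_{L^2}<\infty$.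 The weak global attractor is the set $\{u(0): u(\cdot)\text{ is a complete bounded Leray-Hopf solution}\}$. Littlewood-Paley projections: $\lambda_q:=2^q/L$ for integers $q$, so $\lambda_0=1/L$. Fix once and for all a nonnegative radial $\chi\in C_0^\infty(\mathbb{R}^3)$ with $\chi(\xi)=1$ for $|\xi|\le 3/4$ and $\chi(\xi)=0$ for $|\xi|\ge1$ (constants may depend on this fixed $\chi$). Let $\varphi(\xi)=\chi(\xi/2)-\chi(\xi)$, $\varphi_q(\xi)=\varphi(2^{-q}\xi)$ for $q\ge0$, $\varphi_{-1}=\chi$. For $q\ge-1$, $u_q:=\Delta_q u:=\sum_{k\in\mathbb{Z}^3}\widehat u(k)\varphi_q(k)e^{i\frac{2\pi}{L}k\cdot x}$, where $\widehat u(k)$ is the $k$th Fourier coefficient, and $u_{\le q}:=\sum_{p=-1}^q u_p$. Sums over $q\le Q$ run over $-1\le q\le Q$ (all $q\ge-1$ if $Q=\infty$). Determining wavenumber: for $r\in(2,3)$ and a constant $c_r>0$, $$\Lambda_{u,r}(t):=\min\{\lambda_q:\ q\in\mathbb{N},\ \lambda_p^{-1+\frac3r}\|u_p(t)\|_{L^r}<c_r\nu\ \ \forall p>q,\ \text{ and }\ \lambda_q^{-1}\|u_{\le q}(t)\|_{L^\infty}<c_r\nu\},$$ where $\mathbb{N}=\{0,1,2,\dots\}$ and $\min\emptyset=\infty$ (with $Q=\infty$ in that case). *)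

theory Defs
  imports "HOL-Analysis.Analysis" "HOL-Probability.Essential_Supremum" "HOL-Library.Extended_Nat"
begin

text \<open>Functions on the torus are functions on \<open>real^3\<close> of which only the values on the
  fundamental domain, up to null sets, matter. Smooth functions on the torus are smooth
  periodic functions on the whole space; since weak derivatives below are tested against these,
  \<open>H1\<close> is the space of periodic Sobolev functions.\<close>

type_synonym vfield = "real^3 \<Rightarrow> real^3"

definition torus :: "real \<Rightarrow> (real^3) measure" where
  "torus L = lebesgue_on (cbox 0 (\<chi> i. L))"

definition periodic :: "real \<Rightarrow> (real^3 \<Rightarrow> 'b) \<Rightarrow> bool" where
  "periodic L g \<longleftrightarrow> (\<forall>x i. g (x + axis i L) = g x)"

text \<open>Derivatives are taken within \<open>S\<close>; in all uses \<open>S\<close> is convex with nonempty interior, so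
  they are unique, and one-sided on the boundary.\<close>

primrec Ck_on :: "nat \<Rightarrow> 'a::real_normed_vector set \<Rightarrow> ('a \<Rightarrow> 'b::real_normed_vector) \<Rightarrow> bool" where
  "Ck_on 0 S f \<longleftrightarrow> continuous_on S f"
| "Ck_on (Suc n) S f \<longleftrightarrow> f differentiable_on S \<and>
     (\<forall>v. Ck_on n S (\<lambda>x. frechet_derivative f (at x within S) v))"

definition smooth_on :: "'a::real_normed_vector set \<Rightarrow> ('a \<Rightarrow> 'b::real_normed_vector) \<Rightarrow> bool" where
  "smooth_on S f \<longleftrightarrow> (\<forall>n. Ck_on n S f)"

definition partial_deriv :: "3 \<Rightarrow> (real^3 \<Rightarrow> 'b::real_normed_vector) \<Rightarrow> real^3 \<Rightarrow> 'b" where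
  "partial_deriv i g x = frechet_derivative g (at x) (axis i 1)"

definition in_L2 :: "real \<Rightarrow> vfield \<Rightarrow> bool" where
  "in_L2 L g \<longleftrightarrow> g \<in> borel_measurable (torus L) \<and> integrable (torus L) (\<lambda>x. (norm (g x))\<^sup>2)"

definition inner_L2 :: "real \<Rightarrow> vfield \<Rightarrow> vfield \<Rightarrow> real" where
  "inner_L2 L g h = (LINT x|torus L. g x \<bullet> h x)"

text \<open>The two norms below are real-valued and only meaningful for functions of finite norm.\<close>

definition Lp_norm :: "real \<Rightarrow> real \<Rightarrow> (real^3 \<Rightarrow> 'b::real_normed_vector) \<Rightarrow> real" where
  "Lp_norm L p g = (LINT x|torus L. norm (g x) powr p) powr (1 / p)"

definition Linf_norm :: "real \<Rightarrow> (real^3 \<Rightarrow> 'b::real_normed_vector) \<Rightarrow> real" where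
  "Linf_norm L g = real_of_ereal (esssup (torus L) (\<lambda>x. ereal (norm (g x))))"

definition zero_mean :: "real \<Rightarrow> vfield \<Rightarrow> bool" where
  "zero_mean L g \<longleftrightarrow> (LINT x|torus L. g x) = 0"

definition test_fun :: "real \<Rightarrow> (real^3 \<Rightarrow> real) \<Rightarrow> bool" where
  "test_fun L \<psi> \<longleftrightarrow> periodic L \<psi> \<and> smooth_on UNIV \<psi>"

definition div_free :: "real \<Rightarrow> vfield \<Rightarrow> bool" where
  "div_free L g \<longleftrightarrow>
     (\<forall>\<psi>. test_fun L \<psi> \<longrightarrow> (LINT x|torus L. (\<Sum>i\<in>UNIV. g x $ i * partial_deriv i \<psi> x)) = 0)"

definition has_weak_partial :: "real \<Rightarrow> 3 \<Rightarrow> vfield \<Rightarrow> vfield \<Rightarrow> bool" where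
  "has_weak_partial L i g h \<longleftrightarrow>
     (\<forall>\<psi>. test_fun L \<psi> \<longrightarrow>
        (LINT x|torus L. partial_deriv i \<psi> x *\<^sub>R g x) = - (LINT x|torus L. \<psi> x *\<^sub>R h x))"

definition in_H1 :: "real \<Rightarrow> vfield \<Rightarrow> bool" where
  "in_H1 L g \<longleftrightarrow> in_L2 L g \<and> (\<forall>i. \<exists>h. in_L2 L h \<and> has_weak_partial L i g h)"

definition weak_partial :: "real \<Rightarrow> 3 \<Rightarrow> vfield \<Rightarrow> vfield" where
  "weak_partial L i g = (SOME h. in_L2 L h \<and> has_weak_partial L i g h)"

definition grad_norm :: "real \<Rightarrow> vfield \<Rightarrow> real" where
  "grad_norm L g = sqrt (\<Sum>i\<in>UNIV. (Lp_norm L 2 (weak_partial L i g))\<^sup>2)"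

text \<open>A force is a functional on \<open>H1\<close>, with \<open>f \<phi>\<close> the duality pairing of \<open>f\<close> and \<open>\<phi>\<close>. It has zero
  mean when it annihilates constants. The boundedness condition implies that \<open>f \<phi>\<close> does not
  depend on the values of \<open>\<phi>\<close> on null sets.\<close>

definition Hm1_zero_mean :: "real \<Rightarrow> (vfield \<Rightarrow> real) \<Rightarrow> bool" where
  "Hm1_zero_mean L f \<longleftrightarrow>
     (\<forall>\<phi> \<psi> a b. in_H1 L \<phi> \<and> in_H1 L \<psi> \<longrightarrow> f (\<lambda>x. a *\<^sub>R \<phi> x + b *\<^sub>R \<psi> x) = a * f \<phi> + b * f \<psi>) \<and>
     (\<exists>K. \<forall>\<phi>. in_H1 L \<phi> \<and> zero_mean L \<phi> \<longrightarrow> \<bar>f \<phi>\<bar> \<le> K * grad_norm L \<phi>) \<and>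
     (\<forall>c. f (\<lambda>x. c) = 0)"

definition Hm1_norm :: "real \<Rightarrow> (vfield \<Rightarrow> real) \<Rightarrow> real" where
  "Hm1_norm L f = (SUP \<phi>\<in>{\<phi>. in_H1 L \<phi> \<and> zero_mean L \<phi> \<and> grad_norm L \<phi> \<le> 1}. \<bar>f \<phi>\<bar>)"

definition weakly_continuous :: "real \<Rightarrow> real set \<Rightarrow> (real \<Rightarrow> vfield) \<Rightarrow> bool" where
  "weakly_continuous L I u \<longleftrightarrow>
     (\<forall>t\<in>I. in_L2 L (u t)) \<and>
     (\<forall>\<phi>. in_L2 L \<phi> \<longrightarrow> continuous_on I (\<lambda>t. inner_L2 L (u t) \<phi>))"

text \<open>Square integrability in time with values in \<open>H1\<close>. Strong measurability need not be
  required for weakly continuous functions. Time integrals are over Lebesgue measure, so values on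
  null sets of times at which \<open>u t\<close> is not in \<open>H1\<close> do not matter.\<close>

definition L2_H1 :: "real \<Rightarrow> real set \<Rightarrow> (real \<Rightarrow> vfield) \<Rightarrow> bool" where
  "L2_H1 L I u \<longleftrightarrow>
     (AE t in lebesgue_on I. in_H1 L (u t)) \<and>
     integrable (lebesgue_on I) (\<lambda>t. (Lp_norm L 2 (u t))\<^sup>2 + (grad_norm L (u t))\<^sup>2)"

definition test_field :: "real \<Rightarrow> real \<Rightarrow> real \<Rightarrow> (real \<Rightarrow> vfield) \<Rightarrow> bool" where
  "test_field L T1 T2 \<phi> \<longleftrightarrow>
     smooth_on ({T1..T2} \<times> UNIV) (\<lambda>(t, x). \<phi> t x) \<and>
     (\<forall>t\<in>{T1..T2}. periodic L (\<phi> t) \<and> (\<forall>x. (\<Sum>i\<in>UNIV. partial_deriv i (\<phi> t) x $ i) = 0))"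

definition weak_form_integrand ::
  "real \<Rightarrow> real \<Rightarrow> (vfield \<Rightarrow> real) \<Rightarrow> vfield \<Rightarrow> vfield \<Rightarrow> vfield \<Rightarrow> real" where
  "weak_form_integrand L \<nu> f v \<phi> \<phi>t =
     - inner_L2 L v \<phi>t
     + \<nu> * (\<Sum>i\<in>UNIV. inner_L2 L (weak_partial L i v) (partial_deriv i \<phi>))
     + inner_L2 L (\<lambda>x. \<Sum>i\<in>UNIV. v x $ i *\<^sub>R weak_partial L i v x) \<phi>
     - f \<phi>"

definition Leray_Hopf ::
  "real \<Rightarrow> real \<Rightarrow> (vfield \<Rightarrow> real) \<Rightarrow> real \<Rightarrow> real \<Rightarrow> (real \<Rightarrow> vfield) \<Rightarrow> bool" where
  "Leray_Hopf L \<nu> f T1 T2 u \<longleftrightarrow>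
     weakly_continuous L {T1..T2} u \<and>
     L2_H1 L {T1..T2} u \<and>
     (\<forall>t\<in>{T1..T2}. zero_mean L (u t) \<and> div_free L (u t)) \<and>
     (\<forall>\<phi>. test_field L T1 T2 \<phi> \<longrightarrow> (\<forall>t\<in>{T1..T2}.
        inner_L2 L (u t) (\<phi> t)
        + (LINT s|lebesgue_on {T1..t}. weak_form_integrand L \<nu> f (u s) (\<phi> s)
             (\<lambda>x. vector_derivative (\<lambda>\<tau>. \<phi> \<tau> x) (at s within {T1..T2})))
        = inner_L2 L (u T1) (\<phi> T1))) \<and>
     (AE t0 in lebesgue_on {T1<..<T2}. \<forall>t\<in>{t0..T2}.
        (Lp_norm L 2 (u t))\<^sup>2 / 2 \<le> (Lp_norm L 2 (u t0))\<^sup>2 / 2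
        + (LINT s|lebesgue_on {t0..t}. - \<nu> * (grad_norm L (u s))\<^sup>2 + f (u s)))"

definition complete_bounded_Leray_Hopf ::
  "real \<Rightarrow> real \<Rightarrow> (vfield \<Rightarrow> real) \<Rightarrow> (real \<Rightarrow> vfield) \<Rightarrow> bool" where
  "complete_bounded_Leray_Hopf L \<nu> f u \<longleftrightarrow>
     (\<forall>T1 T2. T1 < T2 \<longrightarrow> Leray_Hopf L \<nu> f T1 T2 u) \<and>
     bdd_above (range (\<lambda>t. Lp_norm L 2 (u t)))"

definition Grashof :: "real \<Rightarrow> real \<Rightarrow> (vfield \<Rightarrow> real) \<Rightarrow> real" where
  "Grashof L \<nu> f = Hm1_norm L f / (\<nu>\<^sup>2 * (2 * pi / L) powr (1/2))"

definition lam :: "real \<Rightarrow> int \<Rightarrow> real" where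
  "lam L q = 2 powi q / L"

definition lp_cutoff :: "(real^3 \<Rightarrow> real) \<Rightarrow> bool" where
  "lp_cutoff X \<longleftrightarrow>
     smooth_on UNIV X \<and> (\<forall>\<xi>. 0 \<le> X \<xi>) \<and>
     (\<forall>\<xi> \<eta>. norm \<xi> = norm \<eta> \<longrightarrow> X \<xi> = X \<eta>) \<and>
     (\<forall>\<xi>. norm \<xi> \<le> 3/4 \<longrightarrow> X \<xi> = 1) \<and> (\<forall>\<xi>. norm \<xi> \<ge> 1 \<longrightarrow> X \<xi> = 0)"

definition lp_phi :: "(real^3 \<Rightarrow> real) \<Rightarrow> real^3 \<Rightarrow> real" where
  "lp_phi X \<xi> = X ((1/2) *\<^sub>R \<xi>) - X \<xi>"

definition lp_mult :: "(real^3 \<Rightarrow> real) \<Rightarrow> int \<Rightarrow> real^3 \<Rightarrow> real" where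
  "lp_mult X q \<xi> = (if q = -1 then X \<xi> else lp_phi X ((2 powi (-q)) *\<^sub>R \<xi>))"

definition freq :: "int^3 \<Rightarrow> real^3" where
  "freq k = (\<chi> i. real_of_int (k $ i))"

definition fourier_coeff :: "real \<Rightarrow> vfield \<Rightarrow> int^3 \<Rightarrow> complex^3" where
  "fourier_coeff L g k =
     (\<chi> i. (LINT x|torus L. of_real (g x $ i) * cis (- (2 * pi / L) * (freq k \<bullet> x))) / of_real (L ^ 3))"

text \<open>The sum has finitely many nonzero terms, and its values are real vectors.\<close>

definition LP :: "(real^3 \<Rightarrow> real) \<Rightarrow> real \<Rightarrow> int \<Rightarrow> vfield \<Rightarrow> real^3 \<Rightarrow> complex^3" where
  "LP X L q g x =
     (\<Sum>\<^sub>\<infinity>k. \<chi> i. fourier_coeff L g k $ i * of_real (lp_mult X q (freq k))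
                  * cis ((2 * pi / L) * (freq k \<bullet> x)))"

definition LP_upto :: "(real^3 \<Rightarrow> real) \<Rightarrow> real \<Rightarrow> int \<Rightarrow> vfield \<Rightarrow> real^3 \<Rightarrow> complex^3" where
  "LP_upto X L q g x = (\<Sum>p\<in>{-1..q}. LP X L p g x)"

definition det_index :: "(real^3 \<Rightarrow> real) \<Rightarrow> real \<Rightarrow> real \<Rightarrow> real \<Rightarrow> real \<Rightarrow> vfield \<Rightarrow> nat \<Rightarrow> bool" where
  "det_index X L \<nu> r c g q \<longleftrightarrow>
     (\<forall>p>int q. lam L p powr (-1 + 3 / r) * Lp_norm L r (LP X L p g) < c * \<nu>) \<and>
     lam L (int q) powr (-1) * Linf_norm L (LP_upto X L (int q) g) < c * \<nu>"

text \<open>The infimum of a nonempty set is attained, and the infimum of the empty set is \<open>\<infinity>\<close>.\<close>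

definition det_wavenumber :: "(real^3 \<Rightarrow> real) \<Rightarrow> real \<Rightarrow> real \<Rightarrow> real \<Rightarrow> real \<Rightarrow> vfield \<Rightarrow> ennreal" where
  "det_wavenumber X L \<nu> r c g = (INF q\<in>{q. det_index X L \<nu> r c g q}. ennreal (lam L (int q)))"

definition lam_ext :: "real \<Rightarrow> enat \<Rightarrow> ennreal" where
  "lam_ext L Q = (case Q of enat n \<Rightarrow> ennreal (lam L (int n)) | \<infinity> \<Rightarrow> \<infinity>)"

definition upto_index :: "enat \<Rightarrow> int set" where
  "upto_index Q = (case Q of enat n \<Rightarrow> {-1..int n} | \<infinity> \<Rightarrow> {-1..})"

definition time_avg :: "real \<Rightarrow> real \<Rightarrow> (real \<Rightarrow> ennreal) \<Rightarrow> ennreal" where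
  "time_avg t0 T g = (\<integral>\<^sup>+\<tau>. g \<tau> \<partial>lebesgue_on {t0..t0 + T}) / ennreal T"

end

(* Write s = d (1 - 2/r), so that 0 <= s <= 3 - 6/r < 1. If Lambda = lambda_Q with Q > 0, then one of
   the two conditions in the definition of Lambda fails at Q - 1. By Bernstein's inequality and, since
   s < 1, a geometric sum, either failure gives
     nu^2 Lambda^(1+s) <= C sum_{q <= Q} lambda_q^(-1+6/r+s) |u_q|_{L^r}^2,
   both sides being infinite if Q is. Instead of Jensen's inequality we use Lambda <= A + A^(-s) Lambda^(1+s)
   for all A > 0 and optimize A after averaging; this does not need the measurability of Lambda. The
   intermittency hypothesis bounds the average of the right-hand side by that of |grad u|^2, which the
   energy inequality, applied on windows of past times, bounds by the force.
   The energy inequality involves the Lebesgue integral of |grad u|^2 and (f,u), which carries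
   information only once these are known to be measurable in time: they are limits of functions
   of finitely many Fourier coefficients of u, which are continuous in time. This, Poincare's inequality and the
   uniqueness of weak derivatives all rest on the completeness of the characters in L^2. *)

theory Submission
  imports Defs
begin

section \<open>Characters of the torus\<close>

text \<open>The constant has to be uniform in d. Since r < 3, the distance of s from 1 is at least
  6/r - 2 > 0, so one geometric ratio serves all s. Weak derivatives are arbitrary choices and the
  force is an abstract functional on \<open>in_H1\<close>, so neither the gradient norm nor the
  pairing has a pointwise formula. Both are reached through Fourier coefficients: the gradient by
  Parseval, the pairing by evaluating the force on trigonometric partial sums whose error vanishes
  in the gradient norm. A square integrable function on the cube need not match on opposite faces.
  Uniform approximation by trigonometric polynomials is therefore available only away from the
  faces, and a bound near them must suffice. The energy inequality starts at almost every time only,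
  so windows are extended to the left by a margin containing a good starting time. The bound on the
  trajectory is not quantitative; it only makes the supremum of the energy finite, and that supremum
  is then absorbed from the right-hand side of an estimate where it carries the factor 1/2. A lower
  integral respects affine bounds with constant coefficients, hence the height A is kept fixed until
  after averaging.\<close>

definition tchar :: "real \<Rightarrow> int^3 \<Rightarrow> real^3 \<Rightarrow> complex" where
  "tchar L k x = cis ((2 * pi / L) * (freq k \<bullet> x))"

lemma freq_add [simp]: "freq (k + l) = freq k + freq l"
  and freq_minus [simp]: "freq (- k) = - freq k"
  and freq_diff [simp]: "freq (k - l) = freq k - freq l"
  and freq_zero [simp]: "freq 0 = 0"
  by (simp_all add: freq_def vec_eq_iff)

lemma freq_eq_0_iff [simp]: "freq k = 0 \<longleftrightarrow> k = 0"
  by (simp add: freq_def vec_eq_iff)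

lemma tchar_add: "tchar L (k + l) x = tchar L k x * tchar L l x"
  by (simp add: tchar_def inner_add_left algebra_simps cis_mult)

lemma tchar_minus: "tchar L (- k) x = cnj (tchar L k x)"
  by (simp add: tchar_def cis_cnj)

lemma tchar_zero [simp]: "tchar L 0 x = 1"
  by (simp add: tchar_def)

lemma norm_tchar [simp]: "norm (tchar L k x) = 1"
  by (simp add: tchar_def)

lemma tchar_diff: "tchar L (k - l) x = tchar L k x * cnj (tchar L l x)"
  by (metis tchar_add tchar_minus diff_conv_add_uminus)

lemma continuous_on_tchar [continuous_intros]:
  "continuous_on S f \<Longrightarrow> continuous_on S (\<lambda>x. tchar L k (f x))"
  unfolding tchar_def cis_conv_exp by (intro continuous_intros)

lemma space_torus [simp]: "space (torus L) = cbox 0 (\<chi> i. L)"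
  by (simp add: torus_def)

lemma finite_measure_torus: "finite_measure (torus L)"
  unfolding torus_def
  by (rule finite_measureI) (simp add: emeasure_restrict_space emeasure_lborel_cbox_eq)

lemma integral_const_torus: "L > 0 \<Longrightarrow> (LINT x|torus L. (c::'b::{banach,second_countable_topology})) = L ^ 3 *\<^sub>R c"
proof -
  assume "L > 0"
  have "measure (torus L) (space (torus L)) = L ^ 3"
    unfolding torus_def using \<open>L > 0\<close>
    by (simp add: measure_restrict_space content_cbox_if_cart interval_eq_empty_cart not_less)
  then show ?thesis by (simp only: lebesgue_integral_const)
qed

lemma borel_measurable_torus:
  "continuous_on UNIV f \<Longrightarrow> f \<in> borel_measurable (torus L)"
  unfolding torus_def
  by (intro continuous_imp_measurable_on_sets_lebesgue) (auto intro: continuous_on_subset)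

lemma integrable_torus_continuous:
  fixes f :: "real^3 \<Rightarrow> 'b::euclidean_space"
  assumes "continuous_on UNIV f"
  shows "integrable (torus L) f"
proof -
  have "f absolutely_integrable_on cbox 0 (\<chi> i. L)"
    using assms by (intro absolutely_integrable_continuous) (auto intro: continuous_on_subset)
  then show ?thesis
    by (simp add: torus_def integrable_restrict_space set_integrable_def)
qed

lemma integral_torus_eq_integral:
  fixes f :: "real^3 \<Rightarrow> 'b::euclidean_space"
  assumes "continuous_on UNIV f"
  shows "(LINT x|torus L. f x) = integral (cbox 0 (\<chi> i. L)) f"
  using integrable_torus_continuous[OF assms, of L] unfolding torus_def
  by (simp add: lebesgue_integral_eq_integral)

lemma integral_torus_lborel:
  fixes f :: "real^3 \<Rightarrow> 'b::euclidean_space"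
  assumes "continuous_on UNIV f"
  shows "(LINT x|torus L. f x) = (LINT x|lborel. indicator (cbox 0 (\<chi> i. L)) x *\<^sub>R f x)"
proof -
  have "(LINT x|torus L. f x) = (LINT x|lebesgue. indicator (cbox 0 (\<chi> i. L)) x *\<^sub>R f x)"
    by (simp add: torus_def integral_restrict_space)
  also have "\<dots> = (LINT x|lborel. indicator (cbox 0 (\<chi> i. L)) x *\<^sub>R f x)"
    using assms by (intro integral_completion)
      (simp add: borel_measurable_continuous_on_indicator continuous_on_subset)
  finally show ?thesis .
qed

text \<open>The indicator of the cube and the character both factor over the coordinates, so the
  integral is a product of one-dimensional integrals. If some \<open>k $ i\<close> is nonzero, the
  factor of that coordinate is the integral of an exponential over full periods and
  vanishes.\<close>

lemma integral_tchar:
  assumes "L > 0"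
  shows "(LINT x|torus L. tchar L k x) = (if k = 0 then of_real (L ^ 3) else 0)"
proof (cases "k = 0")
  case True
  then show ?thesis using integral_const_torus[OF assms, of "1::complex"] by (simp add: scaleR_conv_of_real del: lebesgue_integral_const)
next
  case False
  define w where "w = 2 * pi / L"
  have w: "w > 0" using assms by (simp add: w_def)
  define g where "g = (\<lambda>b::real^3. \<lambda>t::real. indicator {0..L} t *\<^sub>R cis (w * (freq k \<bullet> b) * t))"
  have gint: "integrable lborel (g b)" for b
  proof -
    have "continuous_on {0..L} (\<lambda>t. cis (w * (freq k \<bullet> b) * t))"
      unfolding cis_conv_exp by (intro continuous_intros)
    from borel_integrable_compact[OF compact_Icc this]
    show ?thesis by (simp add: g_def indicator_def of_bool_def if_distrib if_distribR cong: if_cong)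
  qed
  have eq: "indicator (cbox 0 (\<chi> i. L)) x *\<^sub>R tchar L k x = (\<Prod>b\<in>Basis. g b (x \<bullet> b))" for x :: "real^3"
  proof -
    have "(\<Prod>b\<in>Basis. g b (x \<bullet> b)) = (\<Prod>b\<in>Basis. of_real (indicator {0..L} (x \<bullet> b))) * (\<Prod>b\<in>Basis. cis (w * (freq k \<bullet> b) * (x \<bullet> b)))"
      by (simp add: g_def prod.distrib scaleR_conv_of_real)
    also have "(\<Prod>b\<in>Basis. cis (w * (freq k \<bullet> b) * (x \<bullet> b))) = cis (\<Sum>b\<in>Basis. w * (freq k \<bullet> b) * (x \<bullet> b))"
      by (simp add: cis_conv_exp exp_sum sum_distrib_left)
    also have "(\<Sum>b\<in>Basis. w * (freq k \<bullet> b) * (x \<bullet> b)) = w * (freq k \<bullet> x)"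
      by (subst (2) euclidean_inner) (simp add: sum_distrib_left mult.assoc)
    also have "(\<Prod>b\<in>Basis. of_real (indicator {0..L} (x \<bullet> b))) = (of_real (indicator (cbox 0 (\<chi> i. L)) x) :: complex)"
    proof -
      have *: "(\<chi> i. L) \<bullet> b = L" if "b \<in> Basis" for b :: "real^3"
        using that by (auto simp: Basis_vec_def inner_axis)
      have "(\<Prod>b\<in>Basis. indicator {0..L} (x \<bullet> b)) = (indicator (cbox 0 (\<chi> i. L)) x :: real)"
      proof (cases "x \<in> cbox 0 (\<chi> i. L)")
        case True
        then show ?thesis by (auto simp: mem_box * intro!: prod.neutral)
      next
        case False
        then obtain b where "b \<in> Basis" "x \<bullet> b \<notin> {0..L}" by (auto simp: mem_box *)
        then have "(\<Prod>b\<in>Basis. indicator {0..L} (x \<bullet> b)) = (0::real)"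
          by (intro prod_zero bexI[of _ b]) auto
        then show ?thesis using False by simp
      qed
      then show ?thesis by (metis of_real_prod)
    qed
    finally show ?thesis by (simp add: tchar_def w_def scaleR_conv_of_real)
  qed
  interpret product_sigma_finite "\<lambda>b::real^3. lborel :: real measure" ..
  have "(LINT x|torus L. tchar L k x) = (LINT x|lborel. (\<Prod>b\<in>Basis. g b (x \<bullet> b)))"
    by (subst integral_torus_lborel) (auto intro!: continuous_intros simp: eq)
  also have "\<dots> = (LINT x|(\<Pi>\<^sub>M b\<in>(Basis::(real^3) set). lborel). (\<Prod>b\<in>Basis. g b (x b)))"
  proof -
    have [measurable]: "g b \<in> borel_measurable borel" for b
      using gint[of b] by auto
    have *: "(\<Sum>c\<in>Basis. x c *\<^sub>R c) \<bullet> b = x b" if "b \<in> Basis" for b :: "real^3" and x :: "real^3 \<Rightarrow> real"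
      using that by simp
    show ?thesis
      by (subst lborel_eq, subst integral_distr) (auto simp: * intro!: Bochner_Integration.integral_cong prod.cong)
  qed
  also have "\<dots> = (\<Prod>b\<in>Basis. LINT t|lborel. g b t)"
    by (rule product_integral_prod) (use gint in auto)
  also have "\<dots> = 0"
  proof -
    from False obtain i where i: "k $ i \<noteq> 0" by (auto simp: vec_eq_iff)
    define m where "m = w * real_of_int (k $ i)"
    have m: "m \<noteq> 0" using i w by (simp add: m_def)
    have "(LINT t|lborel. g (axis i 1) t) = 0"
    proof -
      have fk: "freq k \<bullet> axis i 1 = real_of_int (k $ i)" by (simp add: inner_axis freq_def)
      have "(LBINT t. indicator {0..L} t *\<^sub>R cis (m * t)) = cis (m * L) / (\<i> * m) - cis (m * 0) / (\<i> * m)"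
      proof (rule integral_FTC_Icc)
        show "((\<lambda>t. cis (m * t) / (\<i> * complex_of_real m)) has_vector_derivative cis (m * t)) (at t within {0..L})" for t
        proof -
          have "((\<lambda>t. exp (\<i> * of_real m * t) / (\<i> * of_real m)) has_field_derivative exp (\<i> * of_real m * of_real t)) (at (of_real t))"
            using m by (auto intro!: derivative_eq_intros simp: field_simps)
          from has_vector_derivative_real_field[OF this]
          have "((\<lambda>t. exp (\<i> * of_real m * of_real t) / (\<i> * of_real m)) has_vector_derivative exp (\<i> * of_real m * of_real t)) (at t)"
            by simp
          then have "((\<lambda>t. exp (\<i> * of_real m * of_real t) / (\<i> * of_real m)) has_vector_derivative exp (\<i> * of_real m * of_real t)) (at t within {0..L})"
            by (rule has_vector_derivative_at_within)
          then show ?thesis by (simp add: cis_conv_exp mult.assoc)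
        qed
        show "continuous_on {0..L} (\<lambda>t. cis (m * t))"
          unfolding cis_conv_exp by (intro continuous_intros)
      qed (use assms in auto)
      also have "cis (m * L) = 1"
      proof -
        have "m * L = 2 * pi * real_of_int (k $ i)" using assms by (simp add: m_def w_def)
        then show ?thesis by (simp add: complex_eq_iff cos_int_2pin sin_int_2pin)
      qed
      finally show ?thesis by (simp add: g_def fk m_def)
    qed
    then show ?thesis by (intro prod_zero bexI[of _ "axis i 1"]) (auto simp: axis_in_Basis_iff)
  qed
  finally show ?thesis using False by simp
qed

lemma integral_tchar_cnj:
  "L > 0 \<Longrightarrow> (LINT x|torus L. tchar L k x * cnj (tchar L l x)) = (if k = l then of_real (L ^ 3) else 0)"
  using integral_tchar[of L "k - l"] by (simp add: tchar_diff)

lemma integral_trig_cnj: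
  assumes "L > 0" "finite F" "finite G"
  shows "(LINT x|torus L. (\<Sum>k\<in>F. a k * tchar L k x) * cnj (\<Sum>k\<in>G. b k * tchar L k x))
    = of_real (L ^ 3) * (\<Sum>k\<in>F \<inter> G. a k * cnj (b k))"
proof -
  have "(LINT x|torus L. (\<Sum>k\<in>F. a k * tchar L k x) * cnj (\<Sum>k\<in>G. b k * tchar L k x))
      = (LINT x|torus L. (\<Sum>k\<in>F. \<Sum>l\<in>G. (a k * cnj (b l)) * (tchar L k x * cnj (tchar L l x))))"
    by (simp add: sum_product mult_ac)
  also have "\<dots> = (\<Sum>k\<in>F. \<Sum>l\<in>G. (a k * cnj (b l)) * (LINT x|torus L. tchar L k x * cnj (tchar L l x)))"
    by (subst Bochner_Integration.integral_sum, intro integrable_torus_continuous continuous_intros,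
      intro sum.cong refl, subst Bochner_Integration.integral_sum, intro integrable_torus_continuous continuous_intros,
      intro sum.cong refl) simp
  also have "\<dots> = (\<Sum>k\<in>F. \<Sum>l\<in>G. if k = l then (a k * cnj (b k)) * of_real (L ^ 3) else 0)"
    by (intro sum.cong refl) (simp add: integral_tchar_cnj[OF assms(1)])
  also have "\<dots> = of_real (L ^ 3) * (\<Sum>k\<in>F \<inter> G. a k * cnj (b k))"
    using assms by (simp add: sum.inter_restrict sum_distrib_left mult.commute if_distrib cong: if_cong)
  finally show ?thesis .
qed

lemma integral_norm_trig:
  assumes "L > 0" "finite F"
  shows "(LINT x|torus L. (norm (\<Sum>k\<in>F. a k * tchar L k x))\<^sup>2) = L ^ 3 * (\<Sum>k\<in>F. (norm (a k))\<^sup>2)"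
proof -
  have "complex_of_real (LINT x|torus L. (norm (\<Sum>k\<in>F. a k * tchar L k x))\<^sup>2)
      = (LINT x|torus L. (\<Sum>k\<in>F. a k * tchar L k x) * cnj (\<Sum>k\<in>F. a k * tchar L k x))"
    by (simp only: integral_complex_of_real[symmetric] complex_norm_square)
  also have "\<dots> = of_real (L ^ 3 * (\<Sum>k\<in>F. (norm (a k))\<^sup>2))"
    by (subst integral_trig_cnj[OF assms assms(2)]) (simp add: complex_norm_square del: complex_cnj_mult of_real_power)
  finally show ?thesis using of_real_eq_iff by blast
qed

section \<open>Completeness of the characters\<close>

definition tpoly :: "real \<Rightarrow> (real^3 \<Rightarrow> complex) \<Rightarrow> bool" where
  "tpoly L p \<longleftrightarrow> (\<exists>F c. finite F \<and> p = (\<lambda>x. \<Sum>k\<in>F. c k * tchar L k x))"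

lemma tpoly_tchar: "tpoly L (\<lambda>x. c * tchar L k x)"
  unfolding tpoly_def by (intro exI[of _ "{k}"] exI[of _ "\<lambda>_. c"]) simp

lemma tpoly_add:
  assumes "tpoly L p" "tpoly L q"
  shows "tpoly L (\<lambda>x. p x + q x)"
proof -
  from assms obtain F c G d where p: "finite F" "p = (\<lambda>x. \<Sum>k\<in>F. c k * tchar L k x)"
    and q: "finite G" "q = (\<lambda>x. \<Sum>k\<in>G. d k * tchar L k x)"
    unfolding tpoly_def by blast
  have "(\<Sum>k\<in>F. c k * tchar L k x) = (\<Sum>k\<in>F \<union> G. (if k \<in> F then c k else 0) * tchar L k x)"
    and "(\<Sum>k\<in>G. d k * tchar L k x) = (\<Sum>k\<in>F \<union> G. (if k \<in> G then d k else 0) * tchar L k x)" for x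
    using p(1) q(1) by (auto intro!: sum.mono_neutral_cong_left)
  then have "p x + q x = (\<Sum>k\<in>F \<union> G. ((if k \<in> F then c k else 0) + (if k \<in> G then d k else 0)) * tchar L k x)" for x
    unfolding p(2) q(2) by (simp add: sum.distrib[symmetric] distrib_right)
  then show ?thesis
    unfolding tpoly_def using p(1) q(1) by (intro exI[of _ "F \<union> G"] exI conjI) auto
qed

lemma tpoly_sum: "finite F \<Longrightarrow> (\<And>k. k \<in> F \<Longrightarrow> tpoly L (p k)) \<Longrightarrow> tpoly L (\<lambda>x. \<Sum>k\<in>F. p k x)"
proof (induction rule: finite_induct)
  case empty
  then show ?case using tpoly_tchar[of L 0 0] by simp
qed (auto intro: tpoly_add)

lemma tpoly_mult:
  assumes "tpoly L p" "tpoly L q"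
  shows "tpoly L (\<lambda>x. p x * q x)"
proof -
  from assms obtain F c G d where p: "finite F" "p = (\<lambda>x. \<Sum>k\<in>F. c k * tchar L k x)"
    and q: "finite G" "q = (\<lambda>x. \<Sum>k\<in>G. d k * tchar L k x)"
    unfolding tpoly_def by blast
  have "p x * q x = (\<Sum>k\<in>F. \<Sum>l\<in>G. (c k * d l) * tchar L (k + l) x)" for x
    unfolding p(2) q(2) by (simp add: sum_product tchar_add mult_ac)
  moreover have "tpoly L (\<lambda>x. \<Sum>k\<in>F. \<Sum>l\<in>G. (c k * d l) * tchar L (k + l) x)"
    by (intro tpoly_sum p q tpoly_tchar)
  ultimately show ?thesis by presburger
qed

lemma tpoly_continuous: "tpoly L p \<Longrightarrow> continuous_on S p"
  unfolding tpoly_def by (auto intro!: continuous_intros)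

lemma tpoly_const: "tpoly L (\<lambda>x. c)"
  using tpoly_tchar[of L c 0] by simp

text \<open>The torus as a product of three circles. It turns periodicity into a compact set on
  which the Stone-Weierstrass theorem applies.\<close>

definition circle_map :: "real \<Rightarrow> real^3 \<Rightarrow> complex^3" where
  "circle_map L x = (\<chi> i. cis ((2 * pi / L) * x $ i))"

lemma continuous_on_circle_map: "continuous_on S (circle_map L)"
  unfolding circle_map_def cis_conv_exp by (intro continuous_intros)

text \<open>Points with the same image differ by multiples of L in each coordinate. On the whole
  cube opposite faces would be identified; the margin \<delta> makes all differences smaller than
  L.\<close>

lemma inj_on_circle_map:
  assumes "L > 0" "\<delta> > 0"
  shows "inj_on (circle_map L) (cbox (\<chi> i. \<delta>) (\<chi> i. L - \<delta>))"
proof (rule inj_onI)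
  fix x y :: "real^3"
  assume x: "x \<in> cbox (\<chi> i. \<delta>) (\<chi> i. L - \<delta>)" and y: "y \<in> cbox (\<chi> i. \<delta>) (\<chi> i. L - \<delta>)"
    and eq: "circle_map L x = circle_map L y"
  have "x $ i = y $ i" for i
  proof -
    have "cis ((2 * pi / L) * x $ i) = cis ((2 * pi / L) * y $ i)"
      using eq by (simp add: circle_map_def vec_eq_iff)
    then obtain n :: int where n: "(2 * pi / L) * x $ i = (2 * pi / L) * y $ i + 2 * pi * n"
      by (metis cis.simps sin_cos_eq_iff)
    then have "L / (2 * pi) * ((2 * pi / L) * x $ i) = L / (2 * pi) * ((2 * pi / L) * y $ i + 2 * pi * n)"
      by (rule arg_cong)
    then have "x $ i - y $ i = L * n"
      using assms by (simp add: distrib_left)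
    moreover have "\<bar>x $ i - y $ i\<bar> < L"
    proof -
      have "\<delta> \<le> x $ i" "x $ i \<le> L - \<delta>" "\<delta> \<le> y $ i" "y $ i \<le> L - \<delta>"
        using x y by (auto simp: mem_box_cart)
      then show ?thesis using assms by linarith
    qed
    ultimately have "L * \<bar>real_of_int n\<bar> < L * 1" using assms by (simp add: abs_mult)
    then have "n = 0" using assms by (simp add: mult_less_cancel_left_pos)
    then show ?thesis using \<open>x $ i - y $ i = L * n\<close> by simp
  qed
  then show "x = y" by (simp add: vec_eq_iff)
qed

text \<open>Real and imaginary parts of \<open>z\<close> are combinations of \<open>z\<close> and
  its conjugate, here the characters of \<open>axis i 1\<close> and of its negative. These functions
  separate the points of the torus.\<close>

lemma tpoly_Re_Im_circle_map:
  shows "tpoly L (\<lambda>x. of_real (Re (circle_map L x $ i)))" "tpoly L (\<lambda>x. of_real (Im (circle_map L x $ i)))"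
proof -
  have *: "tchar L (axis i 1) x = circle_map L x $ i" for x
  proof -
    have "freq (axis i 1) = axis i 1" by (auto simp: freq_def axis_def vec_eq_iff)
    then show ?thesis by (simp add: tchar_def circle_map_def inner_axis')
  qed
  have "complex_of_real (Re z) = (1/2) * z + (1/2) * cnj z" "complex_of_real (Im z) = (-\<i>/2) * z + (\<i>/2) * cnj z" for z
    by (auto simp: complex_eq_iff)
  then show "tpoly L (\<lambda>x. of_real (Re (circle_map L x $ i)))" "tpoly L (\<lambda>x. of_real (Im (circle_map L x $ i)))"
    unfolding *[symmetric] by (simp_all only: tchar_minus[symmetric]) (intro tpoly_add tpoly_tchar)+
qed

text \<open>As \<open>h\<close> need not be periodic, only its restriction to a smaller cube is
  carried over to the product of circles. Tietze's theorem extends it with the same bound M, and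
  Stone-Weierstrass approximates the extension. The bound M + e outside the smaller cube is what
  dominated convergence needs later.\<close>

lemma tpoly_approx_inside:
  fixes h :: "real^3 \<Rightarrow> real"
  assumes "L > 0" "\<delta> > 0" "e > 0" and h: "continuous_on UNIV h" and M: "M \<ge> 0" "\<And>x. \<bar>h x\<bar> \<le> M"
  obtains p where "tpoly L p" "\<And>x. norm (p x) \<le> M + e"
    "\<And>x. x \<in> cbox (\<chi> i. \<delta>) (\<chi> i. L - \<delta>) \<Longrightarrow> norm (of_real (h x) - p x) \<le> e"
proof -
  define S where "S = cbox (\<chi> i. \<delta>) (\<chi> i::3. L - \<delta>)"
  obtain E' where E': "homeomorphism S (circle_map L ` S) (circle_map L) E'"
    using homeomorphism_compact[OF _ continuous_on_circle_map refl inj_on_circle_map[OF assms(1,2)]]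
    unfolding S_def by auto
  have cE: "continuous_on (circle_map L ` S) E'" and E'x: "\<And>x. x \<in> S \<Longrightarrow> E' (circle_map L x) = x"
    using E' by (auto simp: homeomorphism_def)
  have 1: "continuous_on (circle_map L ` S) (h \<circ> E')"
    by (intro continuous_on_compose cE continuous_on_subset[OF h]) auto
  have "compact (circle_map L ` S)"
    unfolding S_def by (intro compact_continuous_image continuous_on_circle_map compact_cbox)
  then have 2: "closedin (top_of_set UNIV) (circle_map L ` S)"
    by (simp add: compact_imp_closed)
  obtain G where G: "continuous_on UNIV G" "\<And>z. z \<in> circle_map L ` S \<Longrightarrow> G z = (h \<circ> E') z" "\<And>z. norm (G z) \<le> M"
    using Tietze[OF 1 2 M(1)] M(2) by (metis UNIV_I comp_apply real_norm_def)
  \<comment> \<open>Reducing each coordinate modulo L shows that the whole range is already attained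
    on a compact cube.\<close>
  have per: "circle_map L ` UNIV = circle_map L ` cbox 0 (\<chi> i. L)"
  proof -
    have "circle_map L x \<in> circle_map L ` cbox 0 (\<chi> i. L)" for x
    proof -
      define y where "y = (\<chi> i. L * frac (x $ i / L))"
      have "circle_map L x = circle_map L y"
      proof -
        have "cis (2 * pi * x $ i / L) = cis (2 * pi * y $ i / L)" for i
        proof -
          have "2 * pi * x $ i / L = 2 * pi * (x $ i / L)" by simp
          also have "x $ i / L = y $ i / L + of_int \<lfloor>x $ i / L\<rfloor>"
            using assms(1) by (simp add: y_def frac_def)
          finally have "2 * pi * x $ i / L = 2 * pi * y $ i / L + 2 * pi * of_int \<lfloor>x $ i / L\<rfloor>"
            by (simp add: distrib_left)
          then have "sin (2 * pi * x $ i / L) = sin (2 * pi * y $ i / L) \<and> cos (2 * pi * x $ i / L) = cos (2 * pi * y $ i / L)"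
            using sin_cos_eq_iff by blast
          then show ?thesis by (simp add: complex_eq_iff)
        qed
        then show ?thesis by (simp add: circle_map_def vec_eq_iff)
      qed
      moreover have "y \<in> cbox 0 (\<chi> i. L)"
        using assms(1) by (auto simp: mem_box_cart y_def mult_left_le frac_lt_1 less_imp_le)
      ultimately show ?thesis by blast
    qed
    then show ?thesis by blast
  qed
  \<comment> \<open>The real algebra for Stone-Weierstrass: functions on the product of circles
    whose pullback is a trigonometric polynomial.\<close>
  define P where "P g \<longleftrightarrow> continuous_on (range (circle_map L)) g \<and> tpoly L (\<lambda>x. of_real (g (circle_map L x)))" for g
  have "\<exists>g. P g \<and> (\<forall>z\<in>range (circle_map L). \<bar>G z - g z\<bar> < e)"
  proof (rule Stone_Weierstrass_HOL)
    show "compact (range (circle_map L))"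
      unfolding per by (intro compact_continuous_image continuous_on_circle_map compact_cbox)
    show "P (\<lambda>x. c)" for c by (simp add: P_def tpoly_const)
    show "P f \<and> P g \<Longrightarrow> P (\<lambda>x. f x + g x)" for f g
      by (auto simp: P_def intro!: continuous_intros tpoly_add)
    show "P f \<and> P g \<Longrightarrow> P (\<lambda>x. f x * g x)" for f g
      by (auto simp: P_def intro!: continuous_intros tpoly_mult)
    show "\<exists>f. P f \<and> f z \<noteq> f w" if "z \<in> range (circle_map L) \<and> w \<in> range (circle_map L) \<and> z \<noteq> w" for z w
    proof -
      from that obtain i where "z $ i \<noteq> w $ i" by (auto simp: vec_eq_iff)
      then have "Re (z $ i) \<noteq> Re (w $ i) \<or> Im (z $ i) \<noteq> Im (w $ i)" by (auto simp: complex_eq_iff)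
      moreover have "P (\<lambda>z. Re (z $ i))" "P (\<lambda>z. Im (z $ i))"
        unfolding P_def by (auto intro!: continuous_intros tpoly_Re_Im_circle_map)
      ultimately show ?thesis by blast
    qed
    show "continuous_on (range (circle_map L)) G" using G(1) continuous_on_subset by blast
  qed (use assms in \<open>auto simp: P_def\<close>)
  then obtain g where g: "P g" "\<And>x. \<bar>G (circle_map L x) - g (circle_map L x)\<bar> < e" by auto
  show thesis
  proof
    show "tpoly L (\<lambda>x. of_real (g (circle_map L x)))" using g by (simp add: P_def)
    show "norm (complex_of_real (g (circle_map L x))) \<le> M + e" for x
      using g(2)[of x] G(3)[of "circle_map L x"] by auto
    show "norm (of_real (h x) - complex_of_real (g (circle_map L x))) \<le> e" if "x \<in> cbox (\<chi> i. \<delta>) (\<chi> i. L - \<delta>)" for x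
    proof -
      have "G (circle_map L x) = h x" using that G(2) E'x S_def by simp
      then show ?thesis using g(2)[of x] by (metis less_imp_le norm_of_real of_real_diff)
    qed
  qed
qed

section \<open>Density of trigonometric polynomials in mean square\<close>

definition sq_int :: "real \<Rightarrow> (real^3 \<Rightarrow> real) \<Rightarrow> bool" where
  "sq_int L g \<longleftrightarrow> g \<in> borel_measurable (torus L) \<and> integrable (torus L) (\<lambda>x. (g x)\<^sup>2)"

lemma sq_int_mult:
  assumes "sq_int L f" "sq_int L g"
  shows "integrable (torus L) (\<lambda>x. f x * g x)"
proof (rule Bochner_Integration.integrable_bound)
  show "integrable (torus L) (\<lambda>x. (f x)\<^sup>2 + (g x)\<^sup>2)" using assms by (auto simp: sq_int_def)
  show "(\<lambda>x. f x * g x) \<in> borel_measurable (torus L)" using assms by (auto simp: sq_int_def)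
  have "\<bar>a * b\<bar> \<le> a\<^sup>2 + b\<^sup>2" for a b :: real
  proof -
    have "0 \<le> (\<bar>a\<bar> - \<bar>b\<bar>)\<^sup>2" by simp
    then have "2 * \<bar>a * b\<bar> \<le> a\<^sup>2 + b\<^sup>2" by (simp add: power2_diff abs_mult)
    then show ?thesis using abs_ge_zero[of "a*b"] by linarith
  qed
  then show "AE x in torus L. norm (f x * g x) \<le> norm ((f x)\<^sup>2 + (g x)\<^sup>2)" by auto
qed

lemma sq_int_bounded: "f \<in> borel_measurable (torus L) \<Longrightarrow> (\<And>x. \<bar>f x\<bar> \<le> M) \<Longrightarrow> sq_int L f"
  unfolding sq_int_def
proof (intro conjI finite_measure.integrable_const_bound[OF finite_measure_torus, where B = "M\<^sup>2"])
  assume "\<And>x. \<bar>f x\<bar> \<le> M"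
  then have "(f x)\<^sup>2 \<le> M\<^sup>2" for x by (metis abs_ge_zero power2_abs power_mono)
  then show "AE x in torus L. norm ((f x)\<^sup>2) \<le> M\<^sup>2" by simp
qed auto

lemma sq_int_const: "sq_int L (\<lambda>x. c)"
  by (rule sq_int_bounded[where M = "\<bar>c\<bar>"]) auto

lemma sq_int_integrable: "sq_int L g \<Longrightarrow> integrable (torus L) g"
  using sq_int_mult[OF _ sq_int_const[of L 1]] by simp

lemma sq_int_add: "sq_int L f \<Longrightarrow> sq_int L g \<Longrightarrow> sq_int L (\<lambda>x. f x + g x)"
  using sq_int_mult[of L f g] by (auto simp: sq_int_def power2_sum mult.assoc)

lemma sq_int_cmult: "sq_int L f \<Longrightarrow> sq_int L (\<lambda>x. c * f x)"
  by (auto simp: sq_int_def power_mult_distrib)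

lemma sq_int_diff: "sq_int L f \<Longrightarrow> sq_int L g \<Longrightarrow> sq_int L (\<lambda>x. f x - g x)"
  using sq_int_add[of L f "\<lambda>x. -1 * g x"] sq_int_cmult[of L g "-1"] by simp

lemma sq_int_continuous: "continuous_on UNIV f \<Longrightarrow> sq_int L f"
  unfolding sq_int_def
  by (intro conjI borel_measurable_torus integrable_torus_continuous continuous_intros)

definition trig_approx :: "real \<Rightarrow> (real^3 \<Rightarrow> real) \<Rightarrow> bool" where
  "trig_approx L g \<longleftrightarrow> (\<forall>\<epsilon>>0. \<exists>p. tpoly L p \<and> (LINT x|torus L. (norm (of_real (g x) - p x))\<^sup>2) < \<epsilon>)"

lemma integrable_norm_diff_tpoly:
  assumes "sq_int L g" "tpoly L p"
  shows "integrable (torus L) (\<lambda>x. (norm (of_real (g x) - p x))\<^sup>2)"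
proof -
  have "(norm (of_real (g x) - p x))\<^sup>2 = (g x - Re (p x))\<^sup>2 + (Im (p x))\<^sup>2" for x
    by (simp add: cmod_power2)
  moreover have "sq_int L (\<lambda>x. Re (p x))" "sq_int L (\<lambda>x. Im (p x))"
    by (intro sq_int_continuous continuous_intros tpoly_continuous[OF assms(2)])+
  ultimately show ?thesis using sq_int_diff[OF assms(1), of "\<lambda>x. Re (p x)"] by (auto simp: sq_int_def)
qed

text \<open>By (a + b)^2 <= 2 a^2 + 2 b^2, functions approximable in mean square form a closed set.
  Continuous, bounded and general functions can thus be treated one after another.\<close>

lemma trig_approx_closed:
  assumes g: "sq_int L g"
    and h: "\<And>\<epsilon>. \<epsilon> > 0 \<Longrightarrow> \<exists>h. sq_int L h \<and> trig_approx L h \<and> (LINT x|torus L. (g x - h x)\<^sup>2) < \<epsilon>"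
  shows "trig_approx L g"
  unfolding trig_approx_def
proof (intro allI impI)
  fix \<epsilon> :: real assume e: "\<epsilon> > 0"
  obtain h where h: "sq_int L h" "trig_approx L h" "(LINT x|torus L. (g x - h x)\<^sup>2) < \<epsilon> / 4"
    using h[of "\<epsilon>/4"] e by auto
  obtain p where p: "tpoly L p" "(LINT x|torus L. (norm (of_real (h x) - p x))\<^sup>2) < \<epsilon> / 4"
    using h(2) e unfolding trig_approx_def by (meson divide_pos_pos zero_less_numeral)
  have int: "integrable (torus L) (\<lambda>x. (g x - h x)\<^sup>2)" using sq_int_diff[OF g h(1)] by (simp add: sq_int_def)
  have "(LINT x|torus L. (norm (of_real (g x) - p x))\<^sup>2) \<le> (LINT x|torus L. 2 * (g x - h x)\<^sup>2 + 2 * (norm (of_real (h x) - p x))\<^sup>2)"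
  proof (intro integral_mono integrable_norm_diff_tpoly g p Bochner_Integration.integrable_add integrable_mult_right int h)
    fix x
    have "norm (of_real (g x) - p x) = norm (of_real (g x - h x) + (of_real (h x) - p x))" by simp
    also have "\<dots> \<le> \<bar>g x - h x\<bar> + norm (of_real (h x) - p x)"
      by (metis norm_of_real norm_triangle_ineq)
    finally have "(norm (of_real (g x) - p x))\<^sup>2 \<le> (\<bar>g x - h x\<bar> + norm (of_real (h x) - p x))\<^sup>2"
      by (intro power_mono) auto
    also have "\<dots> \<le> 2 * (g x - h x)\<^sup>2 + 2 * (norm (of_real (h x) - p x))\<^sup>2"
      using sum_squares_bound[of "\<bar>g x - h x\<bar>" "norm (of_real (h x) - p x)"] by (simp add: power2_sum)
    finally show "(norm (of_real (g x) - p x))\<^sup>2 \<le> 2 * (g x - h x)\<^sup>2 + 2 * (norm (of_real (h x) - p x))\<^sup>2" .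
  qed
  also have "\<dots> = 2 * (LINT x|torus L. (g x - h x)\<^sup>2) + 2 * (LINT x|torus L. (norm (of_real (h x) - p x))\<^sup>2)"
    by (subst Bochner_Integration.integral_add, intro integrable_mult_right int,
      intro integrable_mult_right integrable_norm_diff_tpoly h p) (simp_all)
  also have "\<dots> < \<epsilon>" using h p e by linarith
  finally show "\<exists>p. tpoly L p \<and> (LINT x|torus L. (norm (of_real (g x) - p x))\<^sup>2) < \<epsilon>" using p by blast
qed

lemma AE_torus_interior: "AE x in torus L. x \<in> box 0 (\<chi> i. L)"
proof -
  have "cbox 0 (\<chi> i. L) - box 0 (\<chi> i::3. L) \<in> null_sets lebesgue"
    using negligible_frontier_interval negligible_iff_null_sets by blast
  from AE_not_in[OF this] show ?thesis
    unfolding torus_def by (auto simp: AE_restrict_space_iff)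
qed

text \<open>The cubes with margin 1/(n+1) exhaust the open cube, whose boundary is a null set, so
  the approximants converge almost everywhere; their uniform bound permits dominated
  convergence.\<close>

lemma trig_approx_continuous:
  fixes h :: "real^3 \<Rightarrow> real"
  assumes "L > 0" and h: "continuous_on UNIV h" and M: "\<And>x. \<bar>h x\<bar> \<le> M"
  shows "trig_approx L h"
proof -
  have M0: "M \<ge> 0" using M[of 0] by linarith
  have "\<exists>p. tpoly L p \<and> (\<forall>x. norm (p x) \<le> M + 1 / Suc n) \<and>
    (\<forall>x\<in>cbox (\<chi> i. 1 / Suc n) (\<chi> i. L - 1 / Suc n). norm (of_real (h x) - p x) \<le> 1 / Suc n)" for n
    by (rule tpoly_approx_inside[OF assms(1) _ _ h M0 M, of "1 / Suc n" "1 / Suc n"]) auto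
  then obtain p where p: "\<And>n. tpoly L (p n)" "\<And>n x. norm (p n x) \<le> M + 1 / Suc n"
    "\<And>n x. x \<in> cbox (\<chi> i. 1 / Suc n) (\<chi> i. L - 1 / Suc n) \<Longrightarrow> norm (of_real (h x) - p n x) \<le> 1 / Suc n"
    by metis
  have "(\<lambda>n. LINT x|torus L. (norm (of_real (h x) - p n x))\<^sup>2) \<longlonglongrightarrow> (LINT x|torus L. 0)"
  proof (rule integral_dominated_convergence[where w = "\<lambda>x. (2 * M + 1)\<^sup>2"])
    show "AE x in torus L. (\<lambda>n. (norm (of_real (h x) - p n x))\<^sup>2) \<longlonglongrightarrow> 0"
      using AE_torus_interior
    proof eventually_elim
      case (elim x)
      have pos: "x $ i > 0" "x $ i < L" for i using elim by (auto simp: mem_box_cart)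
      have "\<forall>\<^sub>F n in sequentially. \<forall>i. 1 / Suc n \<le> x $ i \<and> x $ i \<le> L - 1 / Suc n"
      proof (intro eventually_all_finite eventually_conj)
        fix i
        have l: "(\<lambda>n. 1 / real (Suc n)) \<longlonglongrightarrow> 0" by (rule LIMSEQ_Suc[OF lim_1_over_n])
        have "\<forall>\<^sub>F n in sequentially. 1 / Suc n < x $ i" using order_tendstoD(2)[OF l] pos by auto
        then show "\<forall>\<^sub>F n in sequentially. 1 / Suc n \<le> x $ i" by eventually_elim simp
        have "\<forall>\<^sub>F n in sequentially. 1 / Suc n < L - x $ i" using order_tendstoD(2)[OF l, of "L - x $ i"] pos[of i] by auto
        then show "\<forall>\<^sub>F n in sequentially. x $ i \<le> L - 1 / Suc n" by eventually_elim simp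
      qed
      then have "\<forall>\<^sub>F n in sequentially. norm (norm (of_real (h x) - p n x)) \<le> 1 / Suc n"
        by eventually_elim (use p(3) in \<open>simp add: mem_box_cart\<close>)
      then have "(\<lambda>n. norm (of_real (h x) - p n x)) \<longlonglongrightarrow> 0"
        by (rule Lim_null_comparison) (rule LIMSEQ_Suc[OF lim_1_over_n])
      from tendsto_power[OF this, of 2] show ?case by simp
    qed
    show "AE x in torus L. norm ((norm (of_real (h x) - p n x))\<^sup>2) \<le> (2 * M + 1)\<^sup>2" for n
    proof (intro AE_I2)
      fix x
      have "norm (of_real (h x) - p n x) \<le> \<bar>h x\<bar> + norm (p n x)"
        by (metis norm_of_real norm_triangle_ineq4)
      also have "\<dots> \<le> 2 * M + 1"
      proof -
        have "1 / real (Suc n) \<le> 1" by simp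
        then show ?thesis using M[of x] p(2)[of n x] by linarith
      qed
      finally show "norm ((norm (of_real (h x) - p n x))\<^sup>2) \<le> (2 * M + 1)\<^sup>2" by (simp add: power_mono)
    qed
    show "integrable (torus L) (\<lambda>x. (2 * M + 1)\<^sup>2)" by (intro integrable_torus_continuous continuous_intros)
    show "(\<lambda>x. (norm (of_real (h x) - p i x))\<^sup>2) \<in> borel_measurable (torus L)" for i
      by (intro borel_measurable_torus continuous_intros h tpoly_continuous[OF p(1)])
  qed auto
  then have lim: "(\<lambda>n. LINT x|torus L. (norm (of_real (h x) - p n x))\<^sup>2) \<longlonglongrightarrow> 0" by simp
  show ?thesis unfolding trig_approx_def
  proof (intro allI impI)
    fix \<epsilon> :: real assume "\<epsilon> > 0"
    from eventually_happens[OF order_tendstoD(2)[OF lim this]]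
    show "\<exists>p. tpoly L p \<and> (LINT x|torus L. (norm (of_real (h x) - p x))\<^sup>2) < \<epsilon>" using p(1) by auto
  qed
qed

lemma abs_clamp_le: "n \<ge> 0 \<Longrightarrow> \<bar>max (- n) (min n y)\<bar> \<le> (n::real)"
  by linarith

text \<open>Lebesgue measurability provides continuous functions converging almost everywhere.
  Clamping them to [-M, M] leaves the limit unchanged, because |g| <= M, and supplies the dominating
  constant.\<close>

lemma trig_approx_bounded:
  fixes g :: "real^3 \<Rightarrow> real"
  assumes "L > 0" and g: "g \<in> borel_measurable (torus L)" and M: "\<And>x. \<bar>g x\<bar> \<le> M"
  shows "trig_approx L g"
proof (rule trig_approx_closed)
  have M0: "M \<ge> 0" using M[of 0] by linarith
  show "sq_int L g" by (rule sq_int_bounded[OF g M])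
  fix \<epsilon> :: real assume e: "\<epsilon> > 0"
  have "g measurable_on cbox 0 (\<chi> i. L)"
    using g unfolding torus_def by (simp add: measurable_on_iff_borel_measurable)
  then obtain N h where N: "negligible N" and h: "\<And>n. continuous_on UNIV (h n)"
    and lim: "\<And>x. x \<notin> N \<Longrightarrow> (\<lambda>n. h n x) \<longlonglongrightarrow> (if x \<in> cbox 0 (\<chi> i. L) then g x else 0)"
    unfolding measurable_on_def by blast
  define h' where "h' = (\<lambda>n x. max (- M) (min M (h n x)))"
  have h'c: "continuous_on UNIV (h' n)" for n
    unfolding h'_def by (intro continuous_intros h)
  have h'b: "\<bar>h' n x\<bar> \<le> M" for n x
    unfolding h'_def by (rule abs_clamp_le[OF M0])
  have "(\<lambda>n. LINT x|torus L. (g x - h' n x)\<^sup>2) \<longlonglongrightarrow> (LINT x|torus L. 0)"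
  proof (rule integral_dominated_convergence[where w = "\<lambda>x. (2 * M)\<^sup>2"])
    have "AE x in lebesgue. x \<notin> N" using N by (simp add: negligible_iff_null_sets AE_not_in)
    then have "AE x in torus L. x \<notin> N \<and> x \<in> cbox 0 (\<chi> i. L)"
      unfolding torus_def by (auto simp: AE_restrict_space_iff)
    then show "AE x in torus L. (\<lambda>n. (g x - h' n x)\<^sup>2) \<longlonglongrightarrow> 0"
    proof eventually_elim
      case (elim x)
      then have "(\<lambda>n. h n x) \<longlonglongrightarrow> g x" using lim[of x] by auto
      then have "(\<lambda>n. h' n x) \<longlonglongrightarrow> max (- M) (min M (g x))"
        unfolding h'_def by (intro tendsto_intros)
      moreover have "max (- M) (min M (g x)) = g x" using M[of x] by linarith
      ultimately have "(\<lambda>n. h' n x) \<longlonglongrightarrow> g x" by simp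
      then have "(\<lambda>n. (g x - h' n x)\<^sup>2) \<longlonglongrightarrow> (g x - g x)\<^sup>2" by (intro tendsto_intros)
      then show ?case by simp
    qed
    show "AE x in torus L. norm ((g x - h' n x)\<^sup>2) \<le> (2 * M)\<^sup>2" for n
    proof (intro AE_I2)
      fix x
      have "\<bar>g x - h' n x\<bar> \<le> \<bar>2 * M\<bar>" using M[of x] h'b[of n x] by linarith
      then show "norm ((g x - h' n x)\<^sup>2) \<le> (2 * M)\<^sup>2" by (simp add: abs_le_square_iff)
    qed
    show "integrable (torus L) (\<lambda>x. (2 * M)\<^sup>2)" by (intro integrable_torus_continuous continuous_intros)
    show "(\<lambda>x. (g x - h' i x)\<^sup>2) \<in> borel_measurable (torus L)" for i
      using g borel_measurable_torus[OF h'c[of i], of L] by measurable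
  qed auto
  then have lim: "(\<lambda>n. LINT x|torus L. (g x - h' n x)\<^sup>2) \<longlonglongrightarrow> 0" by simp
  from eventually_happens[OF order_tendstoD(2)[OF lim e]]
  obtain n where "(LINT x|torus L. (g x - h' n x)\<^sup>2) < \<epsilon>" by auto
  then show "\<exists>h. sq_int L h \<and> trig_approx L h \<and> (LINT x|torus L. (g x - h x)\<^sup>2) < \<epsilon>"
    using sq_int_continuous[OF h'c] trig_approx_continuous[OF assms(1) h'c h'b] by blast
qed

text \<open>Cutting the values of \<open>g\<close> off at height n gives bounded functions, and the
  squared error is dominated by the square of \<open>g\<close>.\<close>

lemma trig_approx_sq_int:
  fixes g :: "real^3 \<Rightarrow> real"
  assumes "L > 0" and g: "sq_int L g"
  shows "trig_approx L g"
proof (rule trig_approx_closed[OF g])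
  fix \<epsilon> :: real assume e: "\<epsilon> > 0"
  define h where "h = (\<lambda>n::nat. \<lambda>x. max (- real n) (min (real n) (g x)))"
  have [measurable]: "g \<in> borel_measurable (torus L)" using g by (simp add: sq_int_def)
  have hb: "\<bar>h n x\<bar> \<le> real n" for n x
    unfolding h_def by (rule abs_clamp_le) simp
  have hm [measurable]: "h n \<in> borel_measurable (torus L)" for n
    unfolding h_def by measurable
  have "(\<lambda>n. LINT x|torus L. (g x - h n x)\<^sup>2) \<longlonglongrightarrow> (LINT x|torus L. 0)"
  proof (rule integral_dominated_convergence[where w = "\<lambda>x. (g x)\<^sup>2"])
    show "AE x in torus L. (\<lambda>n. (g x - h n x)\<^sup>2) \<longlonglongrightarrow> 0"
    proof (intro AE_I2)
      fix x
      obtain m :: nat where m: "\<bar>g x\<bar> \<le> real m" using real_arch_simple by blast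
      have "\<forall>\<^sub>F n in sequentially. (g x - h n x)\<^sup>2 = 0"
        using eventually_ge_at_top[of m]
      proof eventually_elim
        case (elim n)
        then have "\<bar>g x\<bar> \<le> real n" using m by linarith
        then have "h n x = g x" unfolding h_def by linarith
        then show ?case by simp
      qed
      then show "(\<lambda>n. (g x - h n x)\<^sup>2) \<longlonglongrightarrow> 0" by (rule tendsto_eventually)
    qed
    show "AE x in torus L. norm ((g x - h n x)\<^sup>2) \<le> (g x)\<^sup>2" for n
    proof (intro AE_I2)
      fix x
      have "\<bar>g x - h n x\<bar> \<le> \<bar>g x\<bar>" unfolding h_def by linarith
      then show "norm ((g x - h n x)\<^sup>2) \<le> (g x)\<^sup>2" by (simp add: abs_le_square_iff)
    qed
    show "integrable (torus L) (\<lambda>x. (g x)\<^sup>2)" using g by (simp add: sq_int_def)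
  qed auto
  then have lim: "(\<lambda>n. LINT x|torus L. (g x - h n x)\<^sup>2) \<longlonglongrightarrow> 0" by simp
  from eventually_happens[OF order_tendstoD(2)[OF lim e]]
  obtain n where "(LINT x|torus L. (g x - h n x)\<^sup>2) < \<epsilon>" by auto
  then show "\<exists>h. sq_int L h \<and> trig_approx L h \<and> (LINT x|torus L. (g x - h x)\<^sup>2) < \<epsilon>"
    using sq_int_bounded[OF hm hb] trig_approx_bounded[OF assms(1) hm hb] by blast
qed

section \<open>Fourier coefficients, Bessel's inequality and Parseval's identity\<close>

definition fcoef :: "real \<Rightarrow> (real^3 \<Rightarrow> real) \<Rightarrow> int^3 \<Rightarrow> complex" where
  "fcoef L g k = (LINT x|torus L. of_real (g x) * cnj (tchar L k x)) / of_real (L ^ 3)"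

lemma integrable_fcoef:
  assumes "integrable (torus L) g" "continuous_on UNIV p"
  shows "integrable (torus L) (\<lambda>x. complex_of_real (g x) * p x)"
proof -
  have "bounded (p ` cbox 0 (\<chi> i. L))"
    by (intro compact_imp_bounded compact_continuous_image continuous_on_subset[OF assms(2)] compact_cbox) auto
  then obtain B where B: "\<And>x. x \<in> cbox 0 (\<chi> i. L) \<Longrightarrow> norm (p x) \<le> B" unfolding bounded_iff by auto
  have [measurable]: "g \<in> borel_measurable (torus L)" "p \<in> borel_measurable (torus L)"
    using assms borel_measurable_torus by auto
  show ?thesis
  proof (rule Bochner_Integration.integrable_bound)
    show "integrable (torus L) (\<lambda>x. B * g x)" using assms by simp
    show "AE x in torus L. norm (complex_of_real (g x) * p x) \<le> norm (B * g x)"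
    proof (intro AE_I2)
      fix x assume "x \<in> space (torus L)"
      then have "norm (p x) \<le> \<bar>B\<bar>" using B[of x] by (auto simp del: mem_box)
      then have "norm (p x) * \<bar>g x\<bar> \<le> \<bar>B\<bar> * \<bar>g x\<bar>" by (intro mult_right_mono) auto
      then show "norm (complex_of_real (g x) * p x) \<le> norm (B * g x)"
        by (simp add: norm_mult abs_mult mult.commute)
    qed
  qed measurable
qed

text \<open>Orthogonality and completion of the square in the coefficients. Taking \<open>a\<close>
  to be the Fourier coefficients gives Bessel's inequality; arbitrary \<open>a\<close> shows that no
  trigonometric polynomial with the same frequencies approximates better.\<close>

lemma integral_norm_diff_trig:
  assumes "L > 0" "sq_int L g" "finite F"
  shows "(LINT x|torus L. (norm (of_real (g x) - (\<Sum>k\<in>F. a k * tchar L k x)))\<^sup>2)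
    = (LINT x|torus L. (g x)\<^sup>2) - L ^ 3 * (\<Sum>k\<in>F. (norm (fcoef L g k))\<^sup>2) + L ^ 3 * (\<Sum>k\<in>F. (norm (a k - fcoef L g k))\<^sup>2)"
proof -
  define p where "p x = (\<Sum>k\<in>F. a k * tchar L k x)" for x
  have pc: "continuous_on UNIV p" unfolding p_def by (intro continuous_intros)
  have gi: "integrable (torus L) g" by (rule sq_int_integrable[OF assms(2)])
  have ig: "integrable (torus L) (\<lambda>x. (g x)\<^sup>2)" using assms(2) by (simp add: sq_int_def)
  have ip: "integrable (torus L) (\<lambda>x. (norm (p x))\<^sup>2)"
    by (intro integrable_torus_continuous continuous_intros pc)
  have igp: "integrable (torus L) (\<lambda>x. complex_of_real (g x) * cnj (p x))"
    by (intro integrable_fcoef gi continuous_intros pc)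
  have ire: "integrable (torus L) (\<lambda>x. Re (of_real (g x) * cnj (p x)))"
    using igp by (rule integrable_Re)
  have "(LINT x|torus L. of_real (g x) * cnj (p x)) = (LINT x|torus L. (\<Sum>k\<in>F. cnj (a k) * (of_real (g x) * cnj (tchar L k x))))"
    by (simp add: p_def sum_distrib_left mult_ac)
  also have "\<dots> = (\<Sum>k\<in>F. cnj (a k) * (LINT x|torus L. of_real (g x) * cnj (tchar L k x)))"
    by (subst Bochner_Integration.integral_sum, intro integrable_mult_right integrable_fcoef gi continuous_intros) simp
  also have "\<dots> = of_real (L ^ 3) * (\<Sum>k\<in>F. cnj (a k) * fcoef L g k)"
    using assms(1) by (simp add: fcoef_def sum_distrib_left)
  finally have cross: "(LINT x|torus L. of_real (g x) * cnj (p x)) = of_real (L ^ 3) * (\<Sum>k\<in>F. cnj (a k) * fcoef L g k)" .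
  have crossR: "(LINT x|torus L. Re (of_real (g x) * cnj (p x))) = L ^ 3 * (\<Sum>k\<in>F. Re (cnj (a k) * fcoef L g k))"
  proof -
    have "(LINT x|torus L. Re (of_real (g x) * cnj (p x))) = Re (LINT x|torus L. of_real (g x) * cnj (p x))"
      using igp by (rule integral_Re)
    then show ?thesis unfolding cross by (simp del: of_real_power)
  qed
  have "(LINT x|torus L. (norm (of_real (g x) - p x))\<^sup>2) = (LINT x|torus L. ((g x)\<^sup>2 - 2 * Re (of_real (g x) * cnj (p x))) + (norm (p x))\<^sup>2)"
    by (intro Bochner_Integration.integral_cong refl) (simp only: cmod_power2; simp add: power2_eq_square algebra_simps)
  also have "\<dots> = (LINT x|torus L. (g x)\<^sup>2) - 2 * (LINT x|torus L. Re (of_real (g x) * cnj (p x))) + (LINT x|torus L. (norm (p x))\<^sup>2)"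
    by (subst Bochner_Integration.integral_add, intro Bochner_Integration.integrable_diff ig integrable_mult_right ire, rule ip,
      subst Bochner_Integration.integral_diff, rule ig, intro integrable_mult_right ire) simp
  also have "\<dots> = (LINT x|torus L. (g x)\<^sup>2) - L ^ 3 * (\<Sum>k\<in>F. (norm (fcoef L g k))\<^sup>2) + L ^ 3 * (\<Sum>k\<in>F. (norm (a k - fcoef L g k))\<^sup>2)"
  proof -
    have "(norm (a k - fcoef L g k))\<^sup>2 = (norm (a k))\<^sup>2 - 2 * Re (cnj (a k) * fcoef L g k) + (norm (fcoef L g k))\<^sup>2" for k
      by (simp only: cmod_power2; simp add: power2_eq_square algebra_simps)
    then have "(\<Sum>k\<in>F. (norm (a k - fcoef L g k))\<^sup>2)
      = (\<Sum>k\<in>F. (norm (a k))\<^sup>2) - 2 * (\<Sum>k\<in>F. Re (cnj (a k) * fcoef L g k)) + (\<Sum>k\<in>F. (norm (fcoef L g k))\<^sup>2)"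
      by (simp only: sum.distrib sum_subtractf sum_distrib_left)
    moreover have "(LINT x|torus L. (norm (p x))\<^sup>2) = L ^ 3 * (\<Sum>k\<in>F. (norm (a k))\<^sup>2)"
      unfolding p_def by (rule integral_norm_trig[OF assms(1,3)])
    ultimately show ?thesis unfolding crossR by (simp only: ring_distribs)
  qed
  finally show ?thesis unfolding p_def .
qed

lemma Bessel:
  assumes "L > 0" "sq_int L g" "finite F"
  shows "L ^ 3 * (\<Sum>k\<in>F. (norm (fcoef L g k))\<^sup>2) \<le> (LINT x|torus L. (g x)\<^sup>2)"
proof -
  have "0 \<le> (LINT x|torus L. (norm (of_real (g x) - (\<Sum>k\<in>F. fcoef L g k * tchar L k x)))\<^sup>2)" by simp
  then show ?thesis unfolding integral_norm_diff_trig[OF assms] by simp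
qed

text \<open>Cubes of frequencies are symmetric under negation, contain an explicit number of points,
  and differences of members of \<open>fbox n\<close> lie in \<open>fbox (2 * n)\<close>. All three
  properties are used.\<close>

definition fbox :: "nat \<Rightarrow> (int^3) set" where
  "fbox n = {k. \<forall>i. \<bar>k $ i\<bar> \<le> int n}"

lemma finite_fbox [simp]: "finite (fbox n)"
proof -
  have "fbox n \<subseteq> (\<lambda>f. vec_lambda f) ` (PiE UNIV (\<lambda>_. {- int n..int n}))"
  proof
    fix k :: "int^3" assume "k \<in> fbox n"
    then have "vec_nth k \<in> PiE UNIV (\<lambda>_. {- int n..int n})" by (auto simp: fbox_def abs_le_iff minus_le_iff)
    then show "k \<in> (\<lambda>f. vec_lambda f) ` (PiE UNIV (\<lambda>_. {- int n..int n}))"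
      by (intro image_eqI[of _ _ "vec_nth k"]) auto
  qed
  then show ?thesis by (rule finite_subset) (intro finite_imageI finite_PiE; simp)
qed

lemma fbox_mono: "m \<le> n \<Longrightarrow> fbox m \<subseteq> fbox n"
proof
  fix k assume "m \<le> n" "k \<in> fbox m"
  then have "\<bar>k $ i\<bar> \<le> int n" for i unfolding fbox_def by (metis (mono_tags) mem_Collect_eq of_nat_le_iff order_trans)
  then show "k \<in> fbox n" by (simp add: fbox_def)
qed

lemma finite_subset_fbox: "finite F \<Longrightarrow> \<exists>n. F \<subseteq> fbox n"
proof (induction rule: finite_induct)
  case (insert k F)
  then obtain n where n: "F \<subseteq> fbox n" by auto
  define m where "m = n + (\<Sum>i\<in>UNIV. nat \<bar>k $ i\<bar>)"
  have "nat \<bar>k $ i\<bar> \<le> (\<Sum>i\<in>UNIV. nat \<bar>k $ i\<bar>)" for i by (rule member_le_sum) auto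
  then have "nat \<bar>k $ i\<bar> \<le> m" for i unfolding m_def by (rule trans_le_add2)
  then have "\<bar>k $ i\<bar> \<le> int m" for i by (simp add: nat_le_iff)
  then have "k \<in> fbox m" by (simp add: fbox_def)
  moreover have "F \<subseteq> fbox m" using n fbox_mono[of n m] by (auto simp: m_def)
  ultimately show ?case by (intro exI[of _ m]) simp
qed simp

text \<open>An approximation with error below e has its frequencies in some finite F, so the Fourier
  coefficients on F already account for all but e of the integral. Enlarging F only increases the
  sum, and Bessel's inequality caps it.\<close>

theorem Parseval:
  assumes "L > 0" "sq_int L g"
  shows "(\<lambda>n. L ^ 3 * (\<Sum>k\<in>fbox n. (norm (fcoef L g k))\<^sup>2)) \<longlonglongrightarrow> (LINT x|torus L. (g x)\<^sup>2)"
proof (rule LIMSEQ_I)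
  fix e :: real assume e: "e > 0"
  obtain p where "tpoly L p" and pe: "(LINT x|torus L. (norm (of_real (g x) - p x))\<^sup>2) < e"
    using trig_approx_sq_int[OF assms] e unfolding trig_approx_def by blast
  then obtain F a where F: "finite F" "p = (\<lambda>x. \<Sum>k\<in>F. a k * tchar L k x)" unfolding tpoly_def by blast
  obtain N where N: "F \<subseteq> fbox N" using finite_subset_fbox[OF F(1)] by blast
  have "norm (L ^ 3 * (\<Sum>k\<in>fbox n. (norm (fcoef L g k))\<^sup>2) - (LINT x|torus L. (g x)\<^sup>2)) < e" if "n \<ge> N" for n
  proof -
    have "(LINT x|torus L. (g x)\<^sup>2) - L ^ 3 * (\<Sum>k\<in>F. (norm (fcoef L g k))\<^sup>2) < e"
    proof -
      have "0 \<le> L ^ 3 * (\<Sum>k\<in>F. (norm (a k - fcoef L g k))\<^sup>2)" using assms by (intro mult_nonneg_nonneg sum_nonneg) auto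
      then show ?thesis using pe integral_norm_diff_trig[OF assms F(1), of a] unfolding F(2) by linarith
    qed
    moreover have "L ^ 3 * (\<Sum>k\<in>F. (norm (fcoef L g k))\<^sup>2) \<le> L ^ 3 * (\<Sum>k\<in>fbox n. (norm (fcoef L g k))\<^sup>2)"
      using assms N fbox_mono[OF that] by (intro mult_left_mono sum_mono2) auto
    moreover note Bessel[OF assms finite_fbox[of n]]
    ultimately show ?thesis unfolding real_norm_def by linarith
  qed
  then show "\<exists>no. \<forall>n\<ge>no. norm (L ^ 3 * (\<Sum>k\<in>fbox n. (norm (fcoef L g k))\<^sup>2) - (LINT x|torus L. (g x)\<^sup>2)) < e" by blast
qed

section \<open>Bernstein's inequality\<close>

lemma card_fbox: "card (fbox n) = (2 * n + 1) ^ 3"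
proof -
  have "bij_betw vec_lambda (PiE UNIV (\<lambda>_::3. {- int n..int n})) (fbox n)"
  proof (rule bij_betwI[where g = vec_nth])
    show "vec_lambda \<in> (PiE UNIV (\<lambda>_::3. {- int n..int n})) \<rightarrow> fbox n"
      by (auto simp: fbox_def abs_le_iff PiE_def Pi_def minus_le_iff)
    show "vec_nth \<in> fbox n \<rightarrow> (PiE UNIV (\<lambda>_::3. {- int n..int n}))"
      by (auto simp: fbox_def abs_le_iff minus_le_iff)
  qed (auto simp: vec_eq_iff)
  from bij_betw_same_card[OF this] show ?thesis
    by (simp add: card_PiE nat_add_distrib nat_mult_distrib)
qed

definition dirichlet :: "real \<Rightarrow> nat \<Rightarrow> real^3 \<Rightarrow> real^3 \<Rightarrow> complex" where
  "dirichlet L n x y = (\<Sum>k\<in>fbox n. cnj (tchar L k x) * tchar L k y)"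

lemma norm_dirichlet_le: "norm (dirichlet L n x y) \<le> card (fbox n)"
proof -
  have "norm (dirichlet L n x y) \<le> (\<Sum>k\<in>fbox n. norm (cnj (tchar L k x) * tchar L k y))"
    unfolding dirichlet_def by (rule norm_sum)
  then show ?thesis by (simp add: norm_mult)
qed

lemma integral_norm_dirichlet:
  "L > 0 \<Longrightarrow> (LINT y|torus L. (norm (dirichlet L n x y))\<^sup>2) = L ^ 3 * card (fbox n)"
  unfolding dirichlet_def by (subst integral_norm_trig) auto

lemma continuous_on_dirichlet [continuous_intros]:
  "continuous_on S (dirichlet L n x)"
  unfolding dirichlet_def by (intro continuous_intros)

text \<open>For m and l in \<open>fbox n\<close> exactly one k in \<open>fbox (2 * n)\<close>
  satisfies k + l = m. Each frequency of \<open>p\<close> is therefore reproduced once for every l,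
  which gives the factor \<open>card (fbox n)\<close>.\<close>

lemma reproducing:
  assumes "L > 0" and p: "\<And>x. p x = (\<Sum>k\<in>fbox n. a k * tchar L k x)"
  shows "(LINT y|torus L. p y * cnj (dirichlet L (2 * n) x y * dirichlet L n x y))
    = of_real (L ^ 3 * card (fbox n)) * p x"
proof -
  have conv: "dirichlet L (2 * n) x y * dirichlet L n x y
      = (\<Sum>l\<in>fbox n. \<Sum>k\<in>fbox (2 * n). cnj (tchar L (k + l) x) * tchar L (k + l) y)" for y
    unfolding dirichlet_def sum_product by (subst sum.swap) (simp add: tchar_add mult_ac)
  have "(LINT y|torus L. p y * cnj (dirichlet L (2 * n) x y * dirichlet L n x y))
    = (LINT y|torus L. (\<Sum>l\<in>fbox n. \<Sum>k\<in>fbox (2 * n). \<Sum>m\<in>fbox n.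
        (a m * tchar L (k + l) x) * (tchar L m y * cnj (tchar L (k + l) y))))"
    unfolding conv p by (simp add: sum_distrib_left sum_distrib_right mult_ac)
  also have "\<dots> = (\<Sum>l\<in>fbox n. \<Sum>k\<in>fbox (2 * n). \<Sum>m\<in>fbox n.
        (a m * tchar L (k + l) x) * (LINT y|torus L. tchar L m y * cnj (tchar L (k + l) y)))"
    by (subst Bochner_Integration.integral_sum, intro integrable_torus_continuous continuous_intros,
      intro sum.cong refl, subst Bochner_Integration.integral_sum, intro integrable_torus_continuous continuous_intros,
      intro sum.cong refl, subst Bochner_Integration.integral_sum, intro integrable_torus_continuous continuous_intros,
      intro sum.cong refl) simp
  also have "\<dots> = (\<Sum>l\<in>fbox n. \<Sum>m\<in>fbox n. \<Sum>k\<in>fbox (2 * n).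
        if k = m - l then of_real (L ^ 3) * (a m * tchar L m x) else 0)"
    by (rule sum.cong[OF refl], subst sum.swap, intro sum.cong refl) (auto simp: integral_tchar_cnj[OF assms(1)])
  also have "\<dots> = (\<Sum>l\<in>fbox n. \<Sum>m\<in>fbox n. of_real (L ^ 3) * (a m * tchar L m x))"
  proof (intro sum.cong refl)
    fix l m assume "l \<in> fbox n" "m \<in> fbox n"
    then have lm: "\<bar>l $ i\<bar> \<le> int n" "\<bar>m $ i\<bar> \<le> int n" for i by (auto simp: fbox_def)
    have "\<bar>m $ i - l $ i\<bar> \<le> 2 * int n" for i using lm[of i] by linarith
    then have "m - l \<in> fbox (2 * n)" by (simp add: fbox_def)
    then show "(\<Sum>k\<in>fbox (2 * n). if k = m - l then of_real (L ^ 3) * (a m * tchar L m x) else 0) = of_real (L ^ 3) * (a m * tchar L m x)"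
      by simp
  qed
  also have "\<dots> = of_real (L ^ 3 * card (fbox n)) * p x"
    unfolding p by (simp add: sum_distrib_left mult_ac)
  finally show ?thesis .
qed

text \<open>Where v exceeds A, the factor (v/A)^(r-1) is at least 1. It is used for the values of a
  field in Bernstein's inequality, and with exponent 1 + s for the wavenumber itself.\<close>

lemma le_cutoff_powr:
  fixes v A r :: real
  assumes "A > 0" "v \<ge> 0" "r \<ge> 1"
  shows "v \<le> A + A powr (1 - r) * v powr r"
proof (cases "v \<le> A")
  case False
  then have "v > 0" "A \<le> v" using assms by auto
  have "A powr (r - 1) \<le> v powr (r - 1)" using assms \<open>A \<le> v\<close> by (intro powr_mono2) auto
  then have "v * A powr (r - 1) \<le> v * v powr (r - 1)" using \<open>v > 0\<close> by simp
  also have "v * v powr (r - 1) = v powr r" using powr_mult_base[of v "r - 1"] \<open>v > 0\<close> by simp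
  finally have "v \<le> v powr r * A powr (- (r - 1))" using assms by (simp add: powr_minus pos_le_divide_eq divide_inverse[symmetric] del: minus_diff_eq)
  then show ?thesis using assms by (simp add: mult.commute)
qed (simp add: add_increasing2)

text \<open>The product of two Dirichlet kernels, suitably normalized, reproduces low frequencies and is
  bounded in \<open>L\<^sup>1\<close> and in \<open>L\<^sup>\<infinity>\<close> with the same constants as a rescaled Schwartz function. Splitting
  the values of \<open>u\<close> at the height \<open>A\<close> replaces Hoelder's inequality.\<close>

lemma Bernstein:
  fixes u :: "real^3 \<Rightarrow> complex^3"
  assumes "L > 0" "r \<ge> 1" "n \<ge> 1" and u: "\<And>x i. u x $ i = (\<Sum>k\<in>fbox n. a i k * tchar L k x)"
  shows "norm (u x) \<le> 390 * (real n / L) powr (3 / r) * Lp_norm L r u"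
proof -
  define I where "I = (LINT y|torus L. norm (u y) powr r)"
  define K where "K y = norm (dirichlet L (2 * n) x y) * norm (dirichlet L n x y)" for y
  define c where "c = real (card (fbox n))"
  define B where "B = real (card (fbox (2 * n)))"
  have c: "c > 0" "c = (2 * real n + 1) ^ 3" by (simp_all add: c_def card_fbox add.commute)
  have B: "B = (4 * real n + 1) ^ 3" by (simp add: B_def card_fbox add.commute)
  \<comment> \<open>The ratio 8 of the two cardinalities controls the mean of the kernel through 2ab
    <= a^2 + b^2; the bound 125 n^3, where n >= 1 enters, controls its supremum.\<close>
  have BC: "B \<le> 8 * c" "B \<le> 125 * real n ^ 3"
  proof -
    have "B \<le> (2 * (2 * real n + 1)) ^ 3" unfolding B by (intro power_mono) auto
    then show "B \<le> 8 * c" unfolding c(2) power_mult_distrib by simp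
    have "B \<le> (5 * real n) ^ 3" unfolding B using assms(3) by (intro power_mono) auto
    then show "B \<le> 125 * real n ^ 3" unfolding power_mult_distrib by simp
  qed
  have uc: "continuous_on UNIV u"
  proof -
    have "u = (\<lambda>x. \<chi> i. \<Sum>k\<in>fbox n. a i k * tchar L k x)" using u by (auto simp: vec_eq_iff)
    moreover have "continuous_on UNIV \<dots>" by (intro continuous_intros)
    ultimately show ?thesis by simp
  qed
  have Kc: "continuous_on UNIV K" unfolding K_def by (intro continuous_intros)
  have urc: "continuous_on UNIV (\<lambda>y. norm (u y) powr r)"
    using assms by (intro continuous_on_powr'[OF continuous_on_norm[OF uc] continuous_on_const]) auto
  have I0: "I \<ge> 0" unfolding I_def by simp
  have K1: "(LINT y|torus L. K y) \<le> 5 * L ^ 3 * c"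
  proof -
    have "(LINT y|torus L. K y) \<le> (LINT y|torus L. ((norm (dirichlet L (2 * n) x y))\<^sup>2 + (norm (dirichlet L n x y))\<^sup>2) / 2)"
    proof (intro integral_mono integrable_torus_continuous Kc continuous_intros)
      fix y
      show "K y \<le> ((norm (dirichlet L (2 * n) x y))\<^sup>2 + (norm (dirichlet L n x y))\<^sup>2) / 2"
        unfolding K_def using sum_squares_bound[of "norm (dirichlet L (2 * n) x y)" "norm (dirichlet L n x y)"] by simp
    qed auto
    also have "\<dots> = L ^ 3 * (B + c) / 2"
      by (simp, subst Bochner_Integration.integral_add, intro integrable_torus_continuous continuous_intros,
        intro integrable_torus_continuous continuous_intros)
        (simp add: integral_norm_dirichlet[OF assms(1)] B_def c_def algebra_simps)
    also have "\<dots> \<le> L ^ 3 * (10 * c) / 2" using BC(1) c(1) assms(1) by (intro divide_right_mono mult_left_mono) auto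
    finally show ?thesis by (simp add: mult_ac)
  qed
  have K2: "K y \<le> 125 * real n ^ 3 * c" for y
    unfolding K_def c_def
    by (rule order_trans[OF mult_mono[OF norm_dirichlet_le norm_dirichlet_le]]) (use BC(2) in \<open>auto simp: B_def intro!: mult_right_mono\<close>)
  have K0: "K y \<ge> 0" for y by (simp add: K_def)
  \<comment> \<open>The constant A is paired with the mean of \<open>K\<close>, and the excess, a
    multiple of |u|^r, with the maximum of \<open>K\<close>.\<close>
  have key: "norm (u x $ i) \<le> 5 * A + 125 * A powr (1 - r) * (real n / L) ^ 3 * I" if A: "A > 0" for A i
  proof -
    have "L ^ 3 * c * norm (u x $ i) = norm (LINT y|torus L. u y $ i * cnj (dirichlet L (2 * n) x y * dirichlet L n x y))"
      by (subst reproducing[OF assms(1) u]) (use assms(1) in \<open>simp add: norm_mult norm_power c_def\<close>)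
    also have "\<dots> \<le> (LINT y|torus L. norm (u y $ i * cnj (dirichlet L (2 * n) x y * dirichlet L n x y)))"
      by (rule integral_norm_bound)
    also have "\<dots> \<le> (LINT y|torus L. A * K y + A powr (1 - r) * (125 * real n ^ 3 * c) * norm (u y) powr r)"
    proof (intro integral_mono integrable_torus_continuous continuous_on_add continuous_on_mult continuous_on_norm continuous_on_const continuous_on_cnj continuous_on_dirichlet continuous_on_component Kc urc uc)
      fix y
      have "norm (u y $ i * cnj (dirichlet L (2 * n) x y * dirichlet L n x y)) = norm (u y $ i) * K y"
        by (simp add: norm_mult K_def)
      also have "\<dots> \<le> norm (u y) * K y" by (intro mult_right_mono K0 Finite_Cartesian_Product.norm_nth_le)
      also have "\<dots> \<le> (A + A powr (1 - r) * norm (u y) powr r) * K y"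
        using le_cutoff_powr[OF A norm_ge_zero assms(2)] K0 by (rule mult_right_mono)
      also have "\<dots> = A * K y + (A powr (1 - r) * norm (u y) powr r) * K y" by (rule distrib_right)
      also have "\<dots> \<le> A * K y + (A powr (1 - r) * norm (u y) powr r) * (125 * real n ^ 3 * c)"
        by (intro add_left_mono mult_left_mono K2) auto
      finally show "norm (u y $ i * cnj (dirichlet L (2 * n) x y * dirichlet L n x y)) \<le> A * K y + A powr (1 - r) * (125 * real n ^ 3 * c) * norm (u y) powr r"
        by (simp add: mult_ac)
    qed
    also have "\<dots> = A * (LINT y|torus L. K y) + A powr (1 - r) * (125 * real n ^ 3 * c) * I"
      unfolding I_def
      by (subst Bochner_Integration.integral_add, intro integrable_torus_continuous continuous_intros Kc,
        intro integrable_torus_continuous continuous_on_mult continuous_on_const urc) simp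
    also have "\<dots> \<le> A * (5 * L ^ 3 * c) + A powr (1 - r) * (125 * real n ^ 3 * c) * I"
      using A K1 by (intro add_right_mono mult_left_mono) auto
    also have "\<dots> = L ^ 3 * c * (5 * A + 125 * A powr (1 - r) * (real n / L) ^ 3 * I)"
      using assms(1) by (simp add: power_divide) (simp add: algebra_simps)
    finally show ?thesis using assms(1) c(1) by (simp add: mult_le_cancel_left_pos)
  qed
  \<comment> \<open>This height satisfies A^r = (n/L)^3 \<open>I\<close>, which makes the second
    term of \<open>key\<close> equal to 125 A. Hence 130 = 5 + 125, and summing over three
    components gives 390.\<close>
  define A where "A = (real n / L) powr (3 / r) * Lp_norm L r u"
  have comp: "norm (u x $ i) \<le> 130 * A" for i
  \<comment> \<open>If \<open>I\<close> vanishes the chosen height is zero and \<open>key\<close>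
    does not apply to it; letting the height tend to zero gives the claim.\<close>
  proof (cases "I = 0")
    case True
    have "norm (u x $ i) \<le> 0 + e" if "e > 0" for e
      using key[of "e / 5" i] that True by simp
    then have "norm (u x $ i) \<le> 0" by (rule field_le_epsilon)
    then show ?thesis using True by (simp add: A_def Lp_norm_def I_def)
  next
    case False
    then have I: "I > 0" using I0 by simp
    have A0: "A > 0" using I assms by (simp add: A_def Lp_norm_def I_def[symmetric])
    have "A powr r = (real n / L) ^ 3 * I"
      using assms I by (simp add: A_def Lp_norm_def I_def[symmetric] powr_mult powr_powr powr_numeral)
    moreover have "A powr (1 - r) * A powr r = A" using A0 by (simp add: powr_add[symmetric])
    ultimately have "A powr (1 - r) * (real n / L) ^ 3 * I = A" by (simp add: mult.assoc)
    then show ?thesis using key[OF A0, of i] by simp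
  qed
  have "norm (u x) \<le> (\<Sum>i\<in>UNIV. norm (u x $ i))" unfolding norm_vec_def by (rule L2_set_le_sum) auto
  also have "\<dots> \<le> (\<Sum>i\<in>(UNIV::3 set). 130 * A)" by (intro sum_mono comp)
  also have "\<dots> = 390 * A" by simp
  finally show ?thesis by (simp add: A_def)
qed

section \<open>Trigonometric test functions and integration by parts\<close>

text \<open>Test functions are real, so characters are replaced by this two-parameter family. A
  directional derivative maps (a, b) to a multiple of (b, -a), so the family is closed under
  differentiation and smoothness follows by induction.\<close>

definition trig :: "real \<Rightarrow> real \<Rightarrow> real^3 \<Rightarrow> real^3 \<Rightarrow> real" where
  "trig a b \<theta> x = a * cos (\<theta> \<bullet> x) + b * sin (\<theta> \<bullet> x)"

lemma has_derivative_trig: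
  "(trig a b \<theta> has_derivative (\<lambda>v. (\<theta> \<bullet> v) * trig b (- a) \<theta> x)) (at x)"
  unfolding trig_def [abs_def] by (auto intro!: derivative_eq_intros simp: algebra_simps)

lemma frechet_derivative_trig: "frechet_derivative (trig a b \<theta>) (at x) v = (\<theta> \<bullet> v) * trig b (- a) \<theta> x"
  using frechet_derivative_at[OF has_derivative_trig[of a b \<theta> x]] by metis

lemma partial_deriv_trig: "partial_deriv i (trig a b \<theta>) x = \<theta> $ i * trig b (- a) \<theta> x"
  by (simp add: partial_deriv_def frechet_derivative_trig inner_axis)

lemma continuous_on_trig [continuous_intros]: "continuous_on S (trig a b \<theta>)"
  unfolding trig_def [abs_def] by (intro continuous_intros)

lemma Ck_on_trig: "Ck_on n UNIV (trig a b \<theta>)"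
proof (induction n arbitrary: a b)
  case (Suc n)
  have "(\<lambda>x. frechet_derivative (trig a b \<theta>) (at x) v) = trig ((\<theta> \<bullet> v) * b) ((\<theta> \<bullet> v) * (- a)) \<theta>" for v
    unfolding frechet_derivative_trig by (auto simp: trig_def algebra_simps)
  moreover have "trig a b \<theta> differentiable_on UNIV"
    using has_derivative_trig unfolding differentiable_on_def differentiable_def by blast
  ultimately show ?case using Suc by (simp del: frechet_derivative_trig)
qed (simp add: continuous_on_trig)

lemma periodic_trig: "L > 0 \<Longrightarrow> periodic L (trig a b ((2 * pi / L) *\<^sub>R freq k))"
proof -
  assume L: "L > 0"
  have *: "cos (t + 2 * pi * of_int n) = cos t" "sin (t + 2 * pi * of_int n) = sin t" for t and n :: int
    using sin_cos_eq_iff[of "t + 2 * pi * of_int n" t] by auto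
  have "((2 * pi / L) *\<^sub>R freq k) \<bullet> (x + axis i L) = ((2 * pi / L) *\<^sub>R freq k) \<bullet> x + 2 * pi * of_int (k $ i)" for x i
    using L by (simp add: inner_add_right inner_axis freq_def)
  then show ?thesis unfolding periodic_def trig_def by (simp only: *) simp
qed

lemma test_fun_trig: "L > 0 \<Longrightarrow> test_fun L (trig a b ((2 * pi / L) *\<^sub>R freq k))"
  by (simp add: test_fun_def periodic_trig smooth_on_def Ck_on_trig)

text \<open>The cube enlarged by t in direction i is cut at L and at t. The slab beyond L is the
  slab before t moved by one period, so what remains after removing either has the same
  integral.\<close>

lemma integral_periodic_shift:
  fixes F :: "real^3 \<Rightarrow> real"
  assumes "L > 0" and F: "continuous_on UNIV F" "periodic L F" and t: "0 \<le> t" "t \<le> L"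
  shows "integral (cbox 0 (\<chi> j. L)) (\<lambda>x. F (x + axis i t)) = integral (cbox 0 (\<chi> j. L)) F"
proof -
  define B where "B = cbox 0 ((\<chi> j. L) + axis i t)"
  have int: "F integrable_on cbox a b" for a b
    by (intro integrable_continuous continuous_on_subset[OF F(1)]) auto
  have Bas: "axis i (1::real) \<in> Basis" by (simp add: axis_in_Basis_iff)
  have e: "x \<bullet> axis i (1::real) = x $ i" for x :: "real^3" by (simp add: inner_axis)
  have split: "integral B F = integral (B \<inter> {x. x \<bullet> axis i 1 \<le> c}) F + integral (B \<inter> {x. x \<bullet> axis i 1 \<ge> c}) F" for c
    unfolding B_def by (rule integral_split[OF int Bas])
  have "integral B F = integral (cbox 0 (\<chi> j. L)) F + integral (cbox (axis i L) ((\<chi> j. L) + axis i t)) F"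
  proof -
    have "B \<inter> {x. x \<bullet> axis i 1 \<le> L} = cbox 0 (\<chi> j. L)"
      unfolding B_def e using t assms(1) exhaust_3[of i] by (auto simp: mem_box_cart forall_3 axis_def)
    moreover have "B \<inter> {x. x \<bullet> axis i 1 \<ge> L} = cbox (axis i L) ((\<chi> j. L) + axis i t)"
      unfolding B_def e using t assms(1) exhaust_3[of i] by (auto simp: mem_box_cart forall_3 axis_def)
    ultimately show ?thesis using split[of L] by simp
  qed
  moreover have "integral B F = integral (cbox 0 (\<chi> j. if j = i then t else L)) F + integral (cbox (axis i t) ((\<chi> j. L) + axis i t)) F"
  proof -
    have "B \<inter> {x. x \<bullet> axis i 1 \<le> t} = cbox 0 (\<chi> j. if j = i then t else L)"
      unfolding B_def e using t assms(1) exhaust_3[of i] by (auto simp: mem_box_cart forall_3 axis_def)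
    moreover have "B \<inter> {x. x \<bullet> axis i 1 \<ge> t} = cbox (axis i t) ((\<chi> j. L) + axis i t)"
      unfolding B_def e using t assms(1) exhaust_3[of i] by (auto simp: mem_box_cart forall_3 axis_def)
    ultimately show ?thesis using split[of t] by simp
  qed
  moreover have "integral (cbox (axis i L) ((\<chi> j. L) + axis i t)) F = integral (cbox 0 (\<chi> j. if j = i then t else L)) F"
  proof -
    have "F \<circ> (+) (axis i L) = F" using F(2) by (auto simp: periodic_def add.commute)
    moreover have "(\<chi> j. if j = i then t else L) + axis i L = (\<chi> j. L) + axis i t"
      by (auto simp: vec_eq_iff axis_def)
    ultimately show ?thesis
      using integral_shift_cbox_plus[of 0 "\<chi> j. if j = i then t else L" F "axis i L"] by simp
  qed
  moreover have "integral (cbox 0 (\<chi> j. L)) (\<lambda>x. F (x + axis i t)) = integral (cbox (axis i t) ((\<chi> j. L) + axis i t)) F"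
    using integral_shift_cbox_plus[of 0 "\<chi> j. L" F "axis i t"] by (simp add: o_def add.commute)
  ultimately show ?thesis by simp
qed

text \<open>The integral of the translate of \<open>F\<close> by t in direction i is constant for t
  in [0, L]; differentiating under the integral sign at t = 0, from the right, gives the claim.
  Applied to a product it becomes integration by parts.\<close>

lemma integral_partial_periodic:
  fixes F :: "real^3 \<Rightarrow> real"
  assumes "L > 0" and F: "continuous_on UNIV F" "periodic L F"
    and D: "\<And>x. (F has_derivative D x) (at x)" and cD: "continuous_on UNIV (\<lambda>x. D x (axis i 1))"
  shows "(LINT x|torus L. D x (axis i 1)) = 0"
proof -
  define I where "I t = integral (cbox 0 (\<chi> j. L)) (\<lambda>x. F (x + axis i t))" for t
  have ax: "axis i t = t *\<^sub>R axis i (1::real)" for t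
    by (simp add: vec_eq_iff axis_def)
  have "(I has_field_derivative integral (cbox 0 (\<chi> j. L)) (\<lambda>x. D (x + axis i 0) (axis i 1))) (at 0 within {0..L})"
    unfolding I_def
  proof (rule leibniz_rule_field_derivative)
    fix t x
    have "((\<lambda>t. x + t *\<^sub>R axis i (1::real)) has_derivative (\<lambda>h. h *\<^sub>R axis i (1::real))) (at t within {0..L})"
      by (auto intro!: derivative_eq_intros)
    moreover have "(F has_derivative D (x + t *\<^sub>R axis i (1::real))) (at (x + t *\<^sub>R axis i (1::real)) within (\<lambda>t. x + t *\<^sub>R axis i (1::real)) ` {0..L})"
      by (rule has_derivative_at_withinI[OF D])
    ultimately have "(F \<circ> (\<lambda>t. x + t *\<^sub>R axis i (1::real)) has_derivative D (x + t *\<^sub>R axis i (1::real)) \<circ> (\<lambda>h. h *\<^sub>R axis i (1::real))) (at t within {0..L})"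
      by (rule diff_chain_within)
    moreover have "D (x + t *\<^sub>R axis i (1::real)) \<circ> (\<lambda>h. h *\<^sub>R axis i (1::real)) = (*) (D (x + t *\<^sub>R axis i (1::real)) (axis i 1))"
      using has_derivative_bounded_linear[OF D, THEN bounded_linear.linear, THEN linear_scale] by (auto simp: fun_eq_iff)
    ultimately show "((\<lambda>t. F (x + axis i t)) has_field_derivative D (x + axis i t) (axis i 1)) (at t within {0..L})"
      unfolding has_field_derivative_def by (simp only: ax[symmetric] o_def)
  next
    show "continuous_on ({0..L} \<times> cbox 0 (\<chi> j. L)) (\<lambda>(t, x). D (x + axis i t) (axis i 1))"
    proof -
      have "continuous_on ({0..L} \<times> cbox 0 (\<chi> j. L)) (\<lambda>z. D (snd z + fst z *\<^sub>R axis i (1::real)) (axis i 1))"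
        by (rule continuous_on_compose2[OF cD]) (auto intro!: continuous_intros)
      then show ?thesis by (simp only: ax[symmetric] case_prod_unfold)
    qed
    show "(\<lambda>x. F (x + axis i t)) integrable_on cbox 0 (\<chi> j. L)" for t
      by (intro integrable_continuous continuous_on_compose2[OF F(1)] continuous_intros) auto
  qed (use assms in auto)
  moreover have "(I has_field_derivative 0) (at 0 within {0..L})"
  proof -
    have "I t = integral (cbox 0 (\<chi> j. L)) F" if "t \<in> {0..L}" for t
      unfolding I_def using integral_periodic_shift[OF assms(1) F] that by auto
    then have "(I has_derivative (\<lambda>_. 0)) (at 0 within {0..L})"
      using assms(1) by (intro has_derivative_transform[OF _ _ has_derivative_const]) auto
    moreover have "(\<lambda>_. 0) = (*) (0::real)" by auto
    ultimately show ?thesis by (simp only: has_field_derivative_def)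
  qed
  ultimately have "integral (cbox 0 (\<chi> j. L)) (\<lambda>x. D (x + axis i 0) (axis i 1)) = 0"
    unfolding has_real_derivative_iff_has_vector_derivative
    by (rule vector_derivative_unique_within_closed_interval[of 0 L 0 I, unfolded cbox_interval, rotated 2]) (use assms(1) in auto)
  moreover have "axis i (0::real) = 0" by (simp add: vec_eq_iff axis_def)
  ultimately show ?thesis by (simp add: integral_torus_eq_integral[OF cD])
qed

lemma test_fun_has_derivative: "test_fun L \<psi> \<Longrightarrow> (\<psi> has_derivative frechet_derivative \<psi> (at x)) (at x)"
  unfolding test_fun_def smooth_on_def
  by (auto simp: frechet_derivative_works[symmetric] differentiable_on_def dest!: spec[of _ "Suc 0"])

lemma test_fun_continuous: "test_fun L \<psi> \<Longrightarrow> continuous_on S \<psi>"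
  unfolding test_fun_def smooth_on_def
  by (auto dest!: spec[of _ 0] intro: continuous_on_subset)

lemma test_fun_continuous_partial: "test_fun L \<psi> \<Longrightarrow> continuous_on S (partial_deriv i \<psi>)"
  unfolding test_fun_def smooth_on_def partial_deriv_def [abs_def]
  using continuous_on_subset[of UNIV "\<lambda>x. frechet_derivative \<psi> (at x) (axis i 1)" S]
  by (auto dest!: spec[of _ "Suc 0"])

lemma integral_by_parts_trig:
  assumes "L > 0" "test_fun L \<psi>" "\<theta> = (2 * pi / L) *\<^sub>R freq k"
  shows "(LINT x|torus L. partial_deriv i \<psi> x * trig a b \<theta> x) = - (LINT x|torus L. \<psi> x * (\<theta> $ i * trig b (- a) \<theta> x))"
proof -
  have c: "continuous_on UNIV (\<lambda>x. partial_deriv i \<psi> x * trig a b \<theta> x)"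
    "continuous_on UNIV (\<lambda>x. \<psi> x * (\<theta> $ i * trig b (- a) \<theta> x))"
    by (intro continuous_intros test_fun_continuous_partial[OF assms(2)] test_fun_continuous[OF assms(2)])+
  define D where "D x v = \<psi> x * ((\<theta> \<bullet> v) * trig b (- a) \<theta> x) + frechet_derivative \<psi> (at x) v * trig a b \<theta> x" for x v
  have Dx: "D x (axis i 1) = \<psi> x * (\<theta> $ i * trig b (- a) \<theta> x) + partial_deriv i \<psi> x * trig a b \<theta> x" for x
    by (simp add: D_def partial_deriv_def inner_axis)
  have "(LINT x|torus L. D x (axis i 1)) = 0"
  proof (rule integral_partial_periodic[OF assms(1), of "\<lambda>x. \<psi> x * trig a b \<theta> x"])
    show "((\<lambda>x. \<psi> x * trig a b \<theta> x) has_derivative D x) (at x)" for x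
      unfolding D_def [abs_def] by (rule has_derivative_mult[OF test_fun_has_derivative[OF assms(2)] has_derivative_trig])
    show "continuous_on UNIV (\<lambda>x. \<psi> x * trig a b \<theta> x)"
      by (intro continuous_intros test_fun_continuous[OF assms(2)])
    show "periodic L (\<lambda>x. \<psi> x * trig a b \<theta> x)"
      using periodic_trig[OF assms(1), of a b k] assms(2,3) by (auto simp: periodic_def test_fun_def)
    show "continuous_on UNIV (\<lambda>x. D x (axis i 1))"
      unfolding Dx by (intro continuous_on_add c)
  qed
  then show ?thesis unfolding Dx
    using Bochner_Integration.integral_add[OF integrable_torus_continuous[OF c(2)] integrable_torus_continuous[OF c(1)], of L]
    by linarith
qed

section \<open>Fourier description of the Sobolev space\<close>

lemma fourier_coeff_eq: "fourier_coeff L g k $ j = fcoef L (\<lambda>x. g x $ j) k"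
  by (simp add: fourier_coeff_def fcoef_def tchar_def cis_cnj)

lemma fcoef_uminus: "fcoef L g (- k) = cnj (fcoef L g k)"
proof -
  have "(LINT x|torus L. of_real (g x) * cnj (tchar L (- k) x)) = (LINT x|torus L. cnj (of_real (g x) * cnj (tchar L k x)))"
    by (simp add: tchar_minus)
  also have "\<dots> = cnj (LINT x|torus L. of_real (g x) * cnj (tchar L k x))" by (rule Bochner_Integration.integral_cnj)
  finally show ?thesis by (simp add: fcoef_def)
qed

abbreviation kvec :: "real \<Rightarrow> int^3 \<Rightarrow> real^3" where
  "kvec L k \<equiv> (2 * pi / L) *\<^sub>R freq k"

lemma tchar_eq_trig: "tchar L k x = of_real (trig 1 0 (kvec L k) x) + \<i> * of_real (trig 0 1 (kvec L k) x)"
  by (simp add: tchar_def trig_def complex_eq_iff)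

lemma fcoef_eq_trig:
  assumes "integrable (torus L) g"
  shows "fcoef L g k = (of_real (LINT x|torus L. g x * trig 1 0 (kvec L k) x)
     - \<i> * of_real (LINT x|torus L. g x * trig 0 1 (kvec L k) x)) / of_real (L ^ 3)"
proof -
  have i: "integrable (torus L) (\<lambda>x. g x * trig a b (kvec L k) x)" for a b
  proof -
    have "integrable (torus L) (\<lambda>x. Re (complex_of_real (g x) * of_real (trig a b (kvec L k) x)))"
      by (intro integrable_Re integrable_fcoef assms continuous_intros)
    then show ?thesis by simp
  qed
  have "(LINT x|torus L. of_real (g x) * cnj (tchar L k x)) =
    (LINT x|torus L. complex_of_real (g x * trig 1 0 (kvec L k) x) - \<i> * complex_of_real (g x * trig 0 1 (kvec L k) x))"
    by (simp add: tchar_eq_trig algebra_simps)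
  also have "\<dots> = of_real (LINT x|torus L. g x * trig 1 0 (kvec L k) x) - \<i> * of_real (LINT x|torus L. g x * trig 0 1 (kvec L k) x)"
    by (subst Bochner_Integration.integral_diff, intro integrable_of_real i, intro integrable_mult_right integrable_of_real i)
      (simp only: integral_complex_of_real integral_mult_right_zero)
  finally show ?thesis by (simp add: fcoef_def)
qed

lemma in_L2_iff: "in_L2 L g \<longleftrightarrow> (\<forall>j. sq_int L (\<lambda>x. g x $ j))"
proof
  assume g: "in_L2 L g"
  then have gm: "g \<in> borel_measurable (torus L)" and gi: "integrable (torus L) (\<lambda>x. (norm (g x))\<^sup>2)" by (auto simp: in_L2_def)
  show "\<forall>j. sq_int L (\<lambda>x. g x $ j)"
  proof
    fix j
    have m: "(\<lambda>x. g x $ j) \<in> borel_measurable (torus L)"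
      by (rule borel_measurable_continuous_on[OF _ gm, of "\<lambda>v. v $ j"]) (intro continuous_intros)
    have "integrable (torus L) (\<lambda>x. (g x $ j)\<^sup>2)"
    proof (rule Bochner_Integration.integrable_bound[OF gi])
      show "AE x in torus L. norm ((g x $ j)\<^sup>2) \<le> norm ((norm (g x))\<^sup>2)"
      proof (intro AE_I2)
        fix x have "\<bar>g x $ j\<bar> \<le> norm (g x)" by (rule component_le_norm_cart)
        from power_mono[OF this abs_ge_zero, of 2]
        show "norm ((g x $ j)\<^sup>2) \<le> norm ((norm (g x))\<^sup>2)" by simp
      qed
    qed (use m in measurable)
    then show "sq_int L (\<lambda>x. g x $ j)" using m by (simp add: sq_int_def)
  qed
next
  assume "\<forall>j. sq_int L (\<lambda>x. g x $ j)"
  then have m: "\<And>j. (\<lambda>x. g x $ j) \<in> borel_measurable (torus L)" and i: "\<And>j. integrable (torus L) (\<lambda>x. (g x $ j)\<^sup>2)"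
    by (auto simp: sq_int_def)
  have "(\<lambda>x. \<Sum>j\<in>UNIV. (g x $ j) *\<^sub>R axis j (1::real)) \<in> borel_measurable (torus L)"
    using m by measurable
  moreover have "(\<Sum>j\<in>UNIV. (g x $ j) *\<^sub>R axis j (1::real)) = g x" for x
    by (simp add: vec_eq_iff axis_def if_distrib cong: if_cong)
  ultimately have "g \<in> borel_measurable (torus L)" by simp
  moreover have "(norm (g x))\<^sup>2 = (\<Sum>j\<in>UNIV. (g x $ j)\<^sup>2)" for x
    by (simp add: norm_vec_def L2_set_def sum_nonneg)
  ultimately show "in_L2 L g" using i by (simp add: in_L2_def)
qed

lemma Lp_norm_2: "(Lp_norm L 2 g)\<^sup>2 = (LINT x|torus L. (norm (g x))\<^sup>2)"
proof -
  have "norm (g x) powr 2 = (norm (g x))\<^sup>2" for x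
    by (cases "norm (g x) = 0") (auto simp: powr_numeral)
  then have *: "Lp_norm L 2 g = sqrt (LINT x|torus L. (norm (g x))\<^sup>2)"
    by (simp add: Lp_norm_def powr_half_sqrt)
  show ?thesis unfolding * by simp
qed

lemma Lp_norm_2_components:
  assumes "in_L2 L g"
  shows "(Lp_norm L 2 g)\<^sup>2 = (\<Sum>j\<in>UNIV. LINT x|torus L. (g x $ j)\<^sup>2)"
proof -
  have "(norm (g x))\<^sup>2 = (\<Sum>j\<in>UNIV. (g x $ j)\<^sup>2)" for x
    by (simp add: norm_vec_def L2_set_def sum_nonneg)
  then show ?thesis using assms unfolding Lp_norm_2 in_L2_iff sq_int_def
    by (simp add: Bochner_Integration.integral_sum)
qed

definition coef_sq :: "real \<Rightarrow> vfield \<Rightarrow> int^3 \<Rightarrow> real" where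
  "coef_sq L g k = (\<Sum>j\<in>UNIV. (norm (fcoef L (\<lambda>x. g x $ j) k))\<^sup>2)"

lemma coef_sq_nonneg: "coef_sq L g k \<ge> 0"
  unfolding coef_sq_def by (rule sum_nonneg) simp

lemma Parseval_field:
  assumes "L > 0" "in_L2 L g"
  shows "(\<lambda>n. L ^ 3 * (\<Sum>k\<in>fbox n. coef_sq L g k)) \<longlonglongrightarrow> (Lp_norm L 2 g)\<^sup>2"
proof -
  have "(\<lambda>n. \<Sum>j\<in>UNIV. L ^ 3 * (\<Sum>k\<in>fbox n. (norm (fcoef L (\<lambda>x. g x $ j) k))\<^sup>2)) \<longlonglongrightarrow> (Lp_norm L 2 g)\<^sup>2"
    unfolding Lp_norm_2_components[OF assms(2)]
    by (intro tendsto_sum Parseval assms(1)) (use assms(2) in \<open>auto simp: in_L2_iff\<close>)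
  moreover have "(\<Sum>j\<in>UNIV. L ^ 3 * (\<Sum>k\<in>fbox n. (norm (fcoef L (\<lambda>x. g x $ j) k))\<^sup>2)) = L ^ 3 * (\<Sum>k\<in>fbox n. coef_sq L g k)" for n
    unfolding coef_sq_def by (subst sum.swap) (simp add: sum_distrib_left)
  ultimately show ?thesis by simp
qed

lemma integrable_continuous_scaleR:
  fixes \<psi> :: "real^3 \<Rightarrow> real"
  assumes "continuous_on UNIV \<psi>" "in_L2 L g"
  shows "integrable (torus L) (\<lambda>x. \<psi> x *\<^sub>R g x)"
proof -
  have "integrable (torus L) (\<lambda>x. \<Sum>j\<in>UNIV. (\<psi> x * g x $ j) *\<^sub>R axis j (1::real))"
    using assms(2)
    by (intro Bochner_Integration.integrable_sum integrable_scaleR_left sq_int_mult[OF sq_int_continuous[OF assms(1)]])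
      (auto simp: in_L2_iff)
  moreover have "(\<Sum>j\<in>UNIV. (\<psi> x * g x $ j) *\<^sub>R axis j (1::real)) = \<psi> x *\<^sub>R g x" for x
    by (simp add: vec_eq_iff axis_def if_distrib cong: if_cong)
  ultimately show ?thesis by simp
qed

lemma integral_vec_nth:
  "integrable M f \<Longrightarrow> (LINT x|M. f x) $ j = (LINT x|M. f x $ (j::'n::finite) :: real)"
  using integral_bounded_linear[OF bounded_linear_vec_nth, of M f j] by simp

text \<open>Testing against cosines and sines fixes every Fourier coefficient of a weak derivative.
  Whatever is expressed through coefficients is thus independent of the choice made in
  \<open>weak_partial\<close>.\<close>

lemma fcoef_weak_partial:
  assumes L: "L > 0" and g: "in_L2 L g" and h: "in_L2 L h" and w: "has_weak_partial L i g h"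
  shows "fcoef L (\<lambda>x. h x $ j) k = \<i> * of_real (kvec L k $ i) * fcoef L (\<lambda>x. g x $ j) k"
proof -
  let ?\<theta> = "kvec L k"
  have gi: "integrable (torus L) (\<lambda>x. g x $ j)" and hi: "integrable (torus L) (\<lambda>x. h x $ j)"
    using g h by (auto simp: in_L2_iff intro: sq_int_integrable)
  have *: "(LINT x|torus L. h x $ j * trig a b ?\<theta> x) = - ?\<theta> $ i * (LINT x|torus L. g x $ j * trig b (- a) ?\<theta> x)" for a b
  proof -
    have t: "test_fun L (trig a b ?\<theta>)" by (rule test_fun_trig[OF L])
    have "(LINT x|torus L. partial_deriv i (trig a b ?\<theta>) x *\<^sub>R g x) $ j = - (LINT x|torus L. trig a b ?\<theta> x *\<^sub>R h x) $ j"
      using w t unfolding has_weak_partial_def by simp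
    also have "(LINT x|torus L. partial_deriv i (trig a b ?\<theta>) x *\<^sub>R g x) $ j = (LINT x|torus L. partial_deriv i (trig a b ?\<theta>) x * g x $ j)"
      by (subst integral_vec_nth) (auto intro!: integrable_continuous_scaleR g test_fun_continuous_partial[OF t])
    also have "(LINT x|torus L. trig a b ?\<theta> x *\<^sub>R h x) $ j = (LINT x|torus L. trig a b ?\<theta> x * h x $ j)"
      by (subst integral_vec_nth) (auto intro!: integrable_continuous_scaleR h continuous_intros)
    also have "(LINT x|torus L. partial_deriv i (trig a b ?\<theta>) x * g x $ j) = (LINT x|torus L. ?\<theta> $ i * (g x $ j * trig b (- a) ?\<theta> x))"
      unfolding partial_deriv_trig by (simp add: mult_ac)
    finally show ?thesis by (simp add: mult_ac)
  qed
  have neg: "trig 0 (- 1) ?\<theta> x = - trig 0 1 ?\<theta> x" for x by (simp add: trig_def)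
  have c: "(LINT x|torus L. h x $ j * trig 1 0 ?\<theta> x) = ?\<theta> $ i * (LINT x|torus L. g x $ j * trig 0 1 ?\<theta> x)"
    unfolding *[of 1 0] by (simp add: neg)
  have s: "(LINT x|torus L. h x $ j * trig 0 1 ?\<theta> x) = - ?\<theta> $ i * (LINT x|torus L. g x $ j * trig 1 0 ?\<theta> x)"
    unfolding *[of 0 1] by simp
  show ?thesis
    unfolding fcoef_eq_trig[OF gi] fcoef_eq_trig[OF hi] c s
    by (simp add: complex_eq_iff) 
qed

lemma weak_partial:
  assumes "in_H1 L g"
  shows "in_L2 L (weak_partial L i g)" "has_weak_partial L i g (weak_partial L i g)"
proof -
  have "\<exists>h. in_L2 L h \<and> has_weak_partial L i g h" using assms unfolding in_H1_def by blast
  from someI_ex[OF this] show "in_L2 L (weak_partial L i g)" "has_weak_partial L i g (weak_partial L i g)"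
    unfolding weak_partial_def by (rule conjunct1, rule conjunct2)
qed

lemma norm_kvec_sq: "(norm (kvec L k))\<^sup>2 = (\<Sum>i\<in>UNIV. (kvec L k $ i)\<^sup>2)"
  by (simp add: norm_vec_def L2_set_def sum_nonneg del: vector_scaleR_component norm_scaleR)

text \<open>The squared gradient norm of the modes in \<open>fbox n\<close>. As a finite sum of
  squared coefficients it is continuous in time along a weakly continuous trajectory.\<close>

definition grad_trunc :: "real \<Rightarrow> vfield \<Rightarrow> nat \<Rightarrow> real" where
  "grad_trunc L g n = L ^ 3 * (\<Sum>k\<in>fbox n. (norm (kvec L k))\<^sup>2 * coef_sq L g k)"

lemma grad_trunc_tendsto:
  assumes "L > 0" "in_H1 L g"
  shows "grad_trunc L g \<longlonglongrightarrow> (grad_norm L g)\<^sup>2"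
proof -
  have g: "in_L2 L g" using assms by (simp add: in_H1_def)
  note wp = weak_partial[OF assms(2)]
  have "(\<lambda>n. \<Sum>i\<in>UNIV. L ^ 3 * (\<Sum>k\<in>fbox n. coef_sq L (weak_partial L i g) k)) \<longlonglongrightarrow> (\<Sum>i\<in>UNIV. (Lp_norm L 2 (weak_partial L i g))\<^sup>2)"
    by (intro tendsto_sum Parseval_field assms wp)
  moreover have "(grad_norm L g)\<^sup>2 = (\<Sum>i\<in>UNIV. (Lp_norm L 2 (weak_partial L i g))\<^sup>2)"
    by (simp add: grad_norm_def sum_nonneg)
  moreover have "(\<Sum>i\<in>UNIV. L ^ 3 * (\<Sum>k\<in>fbox n. coef_sq L (weak_partial L i g) k)) = grad_trunc L g n" for n
  proof -
    have c: "coef_sq L (weak_partial L i g) k = (kvec L k $ i)\<^sup>2 * coef_sq L g k" for i k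
      unfolding coef_sq_def fcoef_weak_partial[OF assms(1) g wp]
      by (simp add: norm_mult power_mult_distrib sum_distrib_left del: vector_scaleR_component)
    show ?thesis
      unfolding c grad_trunc_def norm_kvec_sq sum_distrib_right sum_distrib_left by (rule sum.swap)
  qed
  ultimately show ?thesis by simp
qed

lemma grad_trunc_le: "L > 0 \<Longrightarrow> in_H1 L g \<Longrightarrow> grad_trunc L g n \<le> (grad_norm L g)\<^sup>2"
proof (rule incseq_le[OF _ grad_trunc_tendsto])
  assume "L > 0"
  then show "incseq (grad_trunc L g)"
    unfolding grad_trunc_def incseq_def
    by (auto intro!: mult_left_mono sum_mono2 mult_nonneg_nonneg coef_sq_nonneg dest: fbox_mono)
qed

lemma freq_norm_ge_1: "k \<noteq> 0 \<Longrightarrow> 1 \<le> norm (freq k)"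
proof -
  assume "k \<noteq> 0"
  then obtain i where "k $ i \<noteq> 0" by (auto simp: vec_eq_iff)
  then have "1 \<le> \<bar>freq k $ i\<bar>" by (simp add: freq_def)
  also have "\<dots> \<le> norm (freq k)" by (rule component_le_norm_cart)
  finally show ?thesis .
qed

lemma zero_mean_iff:
  assumes "L > 0" "in_L2 L g"
  shows "zero_mean L g \<longleftrightarrow> (\<forall>j. fcoef L (\<lambda>x. g x $ j) 0 = 0)"
proof -
  have "integrable (torus L) g" using integrable_continuous_scaleR[OF continuous_on_const assms(2), of 1] by simp
  then have "fcoef L (\<lambda>x. g x $ j) 0 = of_real ((LINT x|torus L. g x) $ j) / of_real (L ^ 3)" for j
    by (simp add: fcoef_def integral_vec_nth)
  then show ?thesis using assms(1) by (auto simp: zero_mean_def vec_eq_iff)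
qed

text \<open>Zero mean removes the mode k = 0, and every other integer frequency has norm at least 1;
  the comparison of finite sums passes to the limit.\<close>

lemma Poincare:
  assumes "L > 0" "in_H1 L g" "zero_mean L g"
  shows "(2 * pi / L)\<^sup>2 * (Lp_norm L 2 g)\<^sup>2 \<le> (grad_norm L g)\<^sup>2"
proof -
  have g: "in_L2 L g" using assms by (simp add: in_H1_def)
  have "(\<lambda>n. (2 * pi / L)\<^sup>2 * (L ^ 3 * (\<Sum>k\<in>fbox n. coef_sq L g k))) \<longlonglongrightarrow> (2 * pi / L)\<^sup>2 * (Lp_norm L 2 g)\<^sup>2"
    by (intro tendsto_mult_left Parseval_field assms g)
  then show ?thesis
  proof (rule LIMSEQ_le[OF _ grad_trunc_tendsto[OF assms(1,2)]], intro exI allI impI)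
    fix n
    have "(2 * pi / L)\<^sup>2 * coef_sq L g k \<le> (norm (kvec L k))\<^sup>2 * coef_sq L g k" for k
    proof (cases "k = 0")
      case True
      then show ?thesis using assms zero_mean_iff[OF assms(1) g] by (simp add: coef_sq_def)
    next
      case False
      then have "1 \<le> (norm (freq k))\<^sup>2" using freq_norm_ge_1[of k] by simp
      then have "(2 * pi / L)\<^sup>2 * 1 \<le> (2 * pi / L)\<^sup>2 * (norm (freq k))\<^sup>2" by (rule mult_left_mono) simp
      then show ?thesis by (intro mult_right_mono coef_sq_nonneg) (simp add: power_mult_distrib power_divide)
    qed
    then have "L ^ 3 * (\<Sum>k\<in>fbox n. (2 * pi / L)\<^sup>2 * coef_sq L g k) \<le> grad_trunc L g n"
      unfolding grad_trunc_def using assms(1) by (intro mult_left_mono sum_mono) auto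
    then show "(2 * pi / L)\<^sup>2 * (L ^ 3 * (\<Sum>k\<in>fbox n. coef_sq L g k)) \<le> grad_trunc L g n"
      by (simp add: sum_distrib_left mult_ac)
  qed
qed

section \<open>Fourier truncation of fields and of their pairing with the force\<close>

lemma in_L2_lincomb: "in_L2 L g \<Longrightarrow> in_L2 L h \<Longrightarrow> in_L2 L (\<lambda>x. a *\<^sub>R g x + b *\<^sub>R h x)"
  by (simp add: in_L2_iff sq_int_add sq_int_cmult)

lemma has_weak_partial_lincomb:
  assumes "in_L2 L g" "in_L2 L g'" "in_L2 L h" "in_L2 L h'" "has_weak_partial L i g g'" "has_weak_partial L i h h'"
  shows "has_weak_partial L i (\<lambda>x. a *\<^sub>R g x + b *\<^sub>R h x) (\<lambda>x. a *\<^sub>R g' x + b *\<^sub>R h' x)"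
  unfolding has_weak_partial_def
proof (intro allI impI)
  fix \<psi> assume t: "test_fun L \<psi>"
  have lin: "(LINT x|torus L. q x *\<^sub>R (a *\<^sub>R u x + b *\<^sub>R v x)) = a *\<^sub>R (LINT x|torus L. q x *\<^sub>R u x) + b *\<^sub>R (LINT x|torus L. q x *\<^sub>R v x)"
    if "in_L2 L u" "in_L2 L v" "continuous_on UNIV q" for q :: "real^3 \<Rightarrow> real" and u v
  proof -
    have "(LINT x|torus L. q x *\<^sub>R (a *\<^sub>R u x + b *\<^sub>R v x)) = (LINT x|torus L. a *\<^sub>R (q x *\<^sub>R u x) + b *\<^sub>R (q x *\<^sub>R v x))"
      by (simp add: algebra_simps)
    also have "\<dots> = a *\<^sub>R (LINT x|torus L. q x *\<^sub>R u x) + b *\<^sub>R (LINT x|torus L. q x *\<^sub>R v x)"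
      by (subst Bochner_Integration.integral_add, (intro integrable_scaleR_right integrable_continuous_scaleR that)+)
        (simp only: integral_scaleR_right)
    finally show ?thesis .
  qed
  show "(LINT x|torus L. partial_deriv i \<psi> x *\<^sub>R (a *\<^sub>R g x + b *\<^sub>R h x)) = - (LINT x|torus L. \<psi> x *\<^sub>R (a *\<^sub>R g' x + b *\<^sub>R h' x))"
    using assms(5,6) t unfolding has_weak_partial_def
    by (simp add: lin assms test_fun_continuous[OF t] test_fun_continuous_partial[OF t])
qed

lemma in_H1_lincomb: "in_H1 L g \<Longrightarrow> in_H1 L h \<Longrightarrow> in_H1 L (\<lambda>x. a *\<^sub>R g x + b *\<^sub>R h x)"
  unfolding in_H1_def using in_L2_lincomb has_weak_partial_lincomb by meson

lemma in_L2_continuous: "continuous_on UNIV g \<Longrightarrow> in_L2 L g"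
  by (auto simp: in_L2_iff intro!: sq_int_continuous continuous_intros)

definition trig_field :: "real \<Rightarrow> real \<Rightarrow> real^3 \<Rightarrow> 3 \<Rightarrow> vfield" where
  "trig_field a b \<theta> j = (\<lambda>x. trig a b \<theta> x *\<^sub>R axis j 1)"

lemma continuous_on_trig_field: "continuous_on S (trig_field a b \<theta> j)"
  unfolding trig_field_def by (intro continuous_intros)

lemma in_H1_trig_field:
  assumes "L > 0"
  shows "in_H1 L (trig_field a b (kvec L k) j)"
  unfolding in_H1_def
proof (intro conjI allI)
  fix i
  let ?\<theta> = "kvec L k"
  have "has_weak_partial L i (trig_field a b ?\<theta> j) (\<lambda>x. ?\<theta> $ i *\<^sub>R trig_field b (- a) ?\<theta> j x)"
    unfolding has_weak_partial_def
  proof (intro allI impI)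
    fix \<psi> assume t: "test_fun L \<psi>"
    have c: "continuous_on UNIV (\<lambda>x. partial_deriv i \<psi> x * trig a b ?\<theta> x)" "continuous_on UNIV (\<lambda>x. \<psi> x * (?\<theta> $ i * trig b (- a) ?\<theta> x))"
      by (intro continuous_intros test_fun_continuous[OF t] test_fun_continuous_partial[OF t])+
    have "(LINT x|torus L. partial_deriv i \<psi> x *\<^sub>R trig_field a b ?\<theta> j x) = (LINT x|torus L. (partial_deriv i \<psi> x * trig a b ?\<theta> x) *\<^sub>R axis j 1)"
      by (simp add: trig_field_def)
    also have "\<dots> = (LINT x|torus L. partial_deriv i \<psi> x * trig a b ?\<theta> x) *\<^sub>R axis j 1"
      using integrable_torus_continuous[OF c(1)] by (intro integral_scaleR_left) auto
    also have "\<dots> = - ((LINT x|torus L. \<psi> x * (?\<theta> $ i * trig b (- a) ?\<theta> x)) *\<^sub>R axis j 1)"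
      unfolding integral_by_parts_trig[OF assms t refl] by simp
    also have "(LINT x|torus L. \<psi> x * (?\<theta> $ i * trig b (- a) ?\<theta> x)) *\<^sub>R axis j 1 = (LINT x|torus L. (\<psi> x * (?\<theta> $ i * trig b (- a) ?\<theta> x)) *\<^sub>R axis j (1::real))"
      using integrable_torus_continuous[OF c(2)] by (intro integral_scaleR_left[symmetric]) auto
    finally show "(LINT x|torus L. partial_deriv i \<psi> x *\<^sub>R trig_field a b ?\<theta> j x) = - (LINT x|torus L. \<psi> x *\<^sub>R (?\<theta> $ i *\<^sub>R trig_field b (- a) ?\<theta> j x))"
      by (simp add: trig_field_def mult_ac)
  qed
  moreover have "in_L2 L (\<lambda>x. ?\<theta> $ i *\<^sub>R trig_field b (- a) ?\<theta> j x)"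
    by (intro in_L2_continuous continuous_intros continuous_on_trig_field)
  ultimately show "\<exists>h. in_L2 L h \<and> has_weak_partial L i (trig_field a b ?\<theta> j) h" by blast
qed (rule in_L2_continuous[OF continuous_on_trig_field])

text \<open>The real part of the partial Fourier sum, written as a combination of fields in
  \<open>in_H1\<close> to which the force can be applied term by term: Re (c e^(i\<theta>)) = Re c
  cos \<theta> - Im c sin \<theta>.\<close>

definition trunc :: "real \<Rightarrow> vfield \<Rightarrow> (int^3) set \<Rightarrow> vfield" where
  "trunc L g F = (\<lambda>x. \<Sum>(k, j)\<in>F \<times> UNIV.
     trig_field (Re (fcoef L (\<lambda>x. g x $ j) k)) (- Im (fcoef L (\<lambda>x. g x $ j) k)) (kvec L k) j x)"

lemma in_H1_sum: "finite A \<Longrightarrow> L > 0 \<Longrightarrow> (\<And>z. z \<in> A \<Longrightarrow> in_H1 L (\<phi> z)) \<Longrightarrow> in_H1 L (\<lambda>x. \<Sum>z\<in>A. \<phi> z x)"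
proof (induction rule: finite_induct)
  case empty
  show ?case using in_H1_trig_field[of L 0 0 0 undefined] empty by (simp add: trig_field_def trig_def)
next
  case (insert z A)
  then show ?case using in_H1_lincomb[of L "\<phi> z" "\<lambda>x. \<Sum>z\<in>A. \<phi> z x" 1 1] by simp
qed

lemma in_H1_trunc: "L > 0 \<Longrightarrow> finite F \<Longrightarrow> in_H1 L (trunc L g F)"
  unfolding trunc_def by (intro in_H1_sum) (auto intro: in_H1_trig_field)

lemma trunc_nth:
  "trunc L g F x $ j = Re (\<Sum>k\<in>F. fcoef L (\<lambda>x. g x $ j) k * tchar L k x)"
proof -
  have "trunc L g F x $ j = (\<Sum>k\<in>F. \<Sum>j'\<in>UNIV. if j' = j then trig (Re (fcoef L (\<lambda>x. g x $ j') k)) (- Im (fcoef L (\<lambda>x. g x $ j') k)) (kvec L k) x else 0)"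
    unfolding trunc_def trig_field_def by (simp add: sum.cartesian_product[symmetric] axis_def if_distrib eq_commute cong: if_cong)
  also have "\<dots> = (\<Sum>k\<in>F. Re (fcoef L (\<lambda>x. g x $ j) k * tchar L k x))"
    by (simp add: trig_def tchar_def)
  finally show ?thesis by simp
qed

text \<open>Taking the real part in \<open>trunc\<close> loses nothing: \<open>fbox n\<close> is
  symmetric under negation and the coefficients of a real function at k and -k are conjugate, so the
  partial sum is real.\<close>

lemma fcoef_trunc:
  assumes "L > 0"
  shows "fcoef L (\<lambda>x. trunc L g (fbox n) x $ j) k = (if k \<in> fbox n then fcoef L (\<lambda>x. g x $ j) k else 0)"
proof -
  define c where "c = fcoef L (\<lambda>x. g x $ j)"
  define p where "p x = (\<Sum>k\<in>fbox n. c k * tchar L k x)" for x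
  have "cnj (p x) = p x" for x
  proof -
    have "cnj (p x) = (\<Sum>k\<in>fbox n. c (- k) * tchar L (- k) x)"
      unfolding p_def c_def by (simp add: tchar_minus fcoef_uminus)
    also have "\<dots> = p x"
      unfolding p_def by (rule sum.reindex_bij_witness[of _ uminus uminus]) (auto simp: fbox_def)
    finally show ?thesis .
  qed
  then have p: "of_real (trunc L g (fbox n) x $ j) = p x" for x
    unfolding trunc_nth p_def c_def by (metis (no_types, lifting) complex_is_Real_iff Reals_cnj_iff of_real_Re)
  have "(LINT x|torus L. p x * cnj (tchar L k x)) = of_real (L ^ 3) * (\<Sum>k\<in>fbox n \<inter> {k}. c k * cnj 1)"
    unfolding p_def using integral_trig_cnj[OF assms, of "fbox n" "{k}" c "\<lambda>_. 1"] by simp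
  also have "\<dots> = of_real (L ^ 3) * (if k \<in> fbox n then c k else 0)" by simp
  finally show ?thesis using assms unfolding fcoef_def[of L "\<lambda>x. trunc L g (fbox n) x $ j"] p by (simp add: c_def)
qed

text \<open>The difference is written with the factors 1 and -1 so that it has the shape in which
  linearity of the force and of \<open>in_H1\<close> is stated.\<close>

lemma fcoef_diff_trunc:
  assumes "L > 0" "in_L2 L g"
  shows "fcoef L (\<lambda>x. (1 *\<^sub>R g x + (-1) *\<^sub>R trunc L g (fbox n) x) $ j) k = (if k \<in> fbox n then 0 else fcoef L (\<lambda>x. g x $ j) k)"
proof -
  have t: "in_L2 L (trunc L g (fbox n))" using in_H1_trunc[OF assms(1)] by (simp add: in_H1_def)
  have i: "integrable (torus L) (\<lambda>x. complex_of_real (h x $ j) * cnj (tchar L k x))" if "in_L2 L h" for h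
    using that by (intro integrable_fcoef sq_int_integrable continuous_intros) (auto simp: in_L2_iff)
  have "fcoef L (\<lambda>x. (1 *\<^sub>R g x + (-1) *\<^sub>R trunc L g (fbox n) x) $ j) k = fcoef L (\<lambda>x. g x $ j) k - fcoef L (\<lambda>x. trunc L g (fbox n) x $ j) k"
    using Bochner_Integration.integral_diff[OF i[OF assms(2)] i[OF t]]
    by (simp add: fcoef_def left_diff_distrib diff_divide_distrib)
  then show ?thesis by (simp add: fcoef_trunc[OF assms(1)])
qed

text \<open>Subtracting the truncation deletes the modes in \<open>fbox n\<close> and keeps the
  others. For m >= n the truncated gradients therefore differ by exactly
  \<open>grad_trunc L g n\<close>, and m tends to infinity.\<close>

lemma grad_norm_diff_trunc:
  assumes "L > 0" "in_H1 L g"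
  shows "(grad_norm L (\<lambda>x. 1 *\<^sub>R g x + (-1) *\<^sub>R trunc L g (fbox n) x))\<^sup>2 = (grad_norm L g)\<^sup>2 - grad_trunc L g n"
proof -
  define h where "h = (\<lambda>x. 1 *\<^sub>R g x + (-1) *\<^sub>R trunc L g (fbox n) x)"
  have g: "in_L2 L g" using assms by (simp add: in_H1_def)
  have h: "in_H1 L h" unfolding h_def by (intro in_H1_lincomb assms in_H1_trunc) simp
  have "\<forall>\<^sub>F m in sequentially. grad_trunc L h m = grad_trunc L g m - grad_trunc L g n"
    using eventually_ge_at_top[of n]
  proof eventually_elim
    case (elim m)
    have cs: "coef_sq L h k = (if k \<in> fbox n then 0 else coef_sq L g k)" for k
      unfolding coef_sq_def h_def fcoef_diff_trunc[OF assms(1) g] by simp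
    have "(\<Sum>k\<in>fbox m. (norm (kvec L k))\<^sup>2 * coef_sq L h k) = (\<Sum>k\<in>fbox m - fbox n. (norm (kvec L k))\<^sup>2 * coef_sq L g k)"
      by (rule sum.mono_neutral_cong_right) (auto simp: cs)
    also have "\<dots> = (\<Sum>k\<in>fbox m. (norm (kvec L k))\<^sup>2 * coef_sq L g k) - (\<Sum>k\<in>fbox n. (norm (kvec L k))\<^sup>2 * coef_sq L g k)"
      by (rule sum_diff) (use fbox_mono[OF elim] in auto)
    finally show ?case by (simp add: grad_trunc_def right_diff_distrib)
  qed
  moreover have "(\<lambda>m. grad_trunc L g m - grad_trunc L g n) \<longlonglongrightarrow> (grad_norm L g)\<^sup>2 - grad_trunc L g n"
    by (intro tendsto_intros grad_trunc_tendsto assms)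
  ultimately have "grad_trunc L h \<longlonglongrightarrow> (grad_norm L g)\<^sup>2 - grad_trunc L g n"
    by (simp add: tendsto_cong)
  then show ?thesis using grad_trunc_tendsto[OF assms(1) h] LIMSEQ_unique unfolding h_def by blast
qed

lemma Hm1_sum:
  assumes f: "Hm1_zero_mean L f" and L: "L > 0"
  shows "finite A \<Longrightarrow> (\<And>z. z \<in> A \<Longrightarrow> in_H1 L (\<phi> z)) \<Longrightarrow> f (\<lambda>x. \<Sum>z\<in>A. \<phi> z x) = (\<Sum>z\<in>A. f (\<phi> z))"
proof (induction rule: finite_induct)
  case empty
  then show ?case using f by (simp add: Hm1_zero_mean_def)
next
  case (insert z A)
  have lin: "in_H1 L \<phi> \<Longrightarrow> in_H1 L \<psi> \<Longrightarrow> f (\<lambda>x. a *\<^sub>R \<phi> x + b *\<^sub>R \<psi> x) = a * f \<phi> + b * f \<psi>" for \<phi> \<psi> a b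
    using f by (simp add: Hm1_zero_mean_def)
  have "f (\<lambda>x. 1 *\<^sub>R \<phi> z x + 1 *\<^sub>R (\<Sum>z\<in>A. \<phi> z x)) = 1 * f (\<phi> z) + 1 * f (\<lambda>x. \<Sum>z\<in>A. \<phi> z x)"
    using insert by (intro lin in_H1_sum L) auto
  then show ?case using insert by simp
qed

text \<open>A finite linear combination of Fourier coefficients with weights depending only on the
  force, hence continuous in time along the trajectory.\<close>

definition force_trunc :: "real \<Rightarrow> (vfield \<Rightarrow> real) \<Rightarrow> vfield \<Rightarrow> nat \<Rightarrow> real" where
  "force_trunc L f g n = (\<Sum>(k, j)\<in>fbox n \<times> UNIV.
     Re (fcoef L (\<lambda>x. g x $ j) k) * f (trig_field 1 0 (kvec L k) j)
     - Im (fcoef L (\<lambda>x. g x $ j) k) * f (trig_field 0 1 (kvec L k) j))"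

lemma Hm1_trunc:
  assumes f: "Hm1_zero_mean L f" and L: "L > 0"
  shows "f (trunc L g (fbox n)) = force_trunc L f g n"
proof -
  have lin: "in_H1 L \<phi> \<Longrightarrow> in_H1 L \<psi> \<Longrightarrow> f (\<lambda>x. a *\<^sub>R \<phi> x + b *\<^sub>R \<psi> x) = a * f \<phi> + b * f \<psi>" for \<phi> \<psi> a b
    using f by (simp add: Hm1_zero_mean_def)
  have e: "trig_field a b \<theta> j = (\<lambda>x. a *\<^sub>R trig_field 1 0 \<theta> j x + b *\<^sub>R trig_field 0 1 \<theta> j x)" for a b \<theta> j
    by (auto simp: trig_field_def trig_def scaleR_add_left[symmetric])
  have b: "f (trig_field a b (kvec L k) j) = a * f (trig_field 1 0 (kvec L k) j) + b * f (trig_field 0 1 (kvec L k) j)" for a b k j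
    by (subst e) (intro lin in_H1_trig_field L)
  show ?thesis
    unfolding trunc_def force_trunc_def case_prod_unfold
    by (subst Hm1_sum[OF f L], simp, intro in_H1_trig_field L, intro sum.cong refl, subst b, simp)
qed

text \<open>The force is bounded by the gradient norm only on fields of zero mean. The truncation
  error always is such a field, since 0 lies in \<open>fbox n\<close>, and its gradient norm tends
  to zero.\<close>

lemma force_trunc_tendsto:
  assumes f: "Hm1_zero_mean L f" and L: "L > 0" and g: "in_H1 L g"
  shows "force_trunc L f g \<longlonglongrightarrow> f g"
proof -
  obtain K where K: "\<And>\<phi>. in_H1 L \<phi> \<Longrightarrow> zero_mean L \<phi> \<Longrightarrow> \<bar>f \<phi>\<bar> \<le> K * grad_norm L \<phi>"
    using f unfolding Hm1_zero_mean_def by blast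
  have g2: "in_L2 L g" using g by (simp add: in_H1_def)
  let ?h = "\<lambda>n x. 1 *\<^sub>R g x + (-1) *\<^sub>R trunc L g (fbox n) x"
  have h: "in_H1 L (?h n)" for n by (intro in_H1_lincomb g in_H1_trunc L) simp
  have zm: "zero_mean L (?h n)" for n
  proof -
    have "in_L2 L (?h n)" using h by (simp add: in_H1_def)
    moreover have "(0::int^3) \<in> fbox n" by (simp add: fbox_def)
    ultimately show ?thesis using fcoef_diff_trunc[OF L g2] by (simp add: zero_mean_iff[OF L])
  qed
  have "(\<lambda>n. sqrt ((grad_norm L g)\<^sup>2 - grad_trunc L g n)) \<longlonglongrightarrow> sqrt ((grad_norm L g)\<^sup>2 - (grad_norm L g)\<^sup>2)"
    by (intro tendsto_intros grad_trunc_tendsto L g)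
  moreover have "grad_norm L (?h n) = sqrt ((grad_norm L g)\<^sup>2 - grad_trunc L g n)" for n
  proof -
    have "grad_norm L (?h n) \<ge> 0" by (simp add: grad_norm_def sum_nonneg)
    then show ?thesis unfolding grad_norm_diff_trunc[OF L g, symmetric] by simp
  qed
  ultimately have "(\<lambda>n. grad_norm L (?h n)) \<longlonglongrightarrow> 0" by simp
  then have "(\<lambda>n. K * grad_norm L (?h n)) \<longlonglongrightarrow> K * 0" by (rule tendsto_mult_left)
  then have "(\<lambda>n. K * grad_norm L (?h n)) \<longlonglongrightarrow> 0" by simp
  moreover have "f (?h n) = f g - force_trunc L f g n" for n
  proof -
    have "f (?h n) = 1 * f g + (-1) * f (trunc L g (fbox n))"
      using f g in_H1_trunc[OF L finite_fbox] unfolding Hm1_zero_mean_def by blast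
    then show ?thesis by (simp add: Hm1_trunc[OF f L])
  qed
  ultimately have "(\<lambda>n. f g - force_trunc L f g n) \<longlonglongrightarrow> 0"
    using K[OF h zm] by (intro Lim_null_comparison[of "\<lambda>n. f g - force_trunc L f g n"]) (auto intro!: always_eventually)
  from tendsto_diff[OF tendsto_const[of "f g"] this] show ?thesis by simp
qed

lemma grad_norm_nonneg: "grad_norm L g \<ge> 0"
  by (simp add: grad_norm_def sum_nonneg)

text \<open>The weak derivatives chosen for a field and for its multiple are not related by
  definition, so homogeneity is read off the Fourier coefficients.\<close>

lemma grad_norm_scaleR:
  assumes "L > 0" "in_H1 L g"
  shows "grad_norm L (\<lambda>x. a *\<^sub>R g x) = \<bar>a\<bar> * grad_norm L g"
proof -
  have h: "in_H1 L (\<lambda>x. a *\<^sub>R g x)" using in_H1_lincomb[OF assms(2,2), of a 0] by simp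
  have "fcoef L (\<lambda>x. a * g x $ j) k = of_real a * fcoef L (\<lambda>x. g x $ j) k" for j k
    by (simp add: fcoef_def mult.assoc)
  then have "coef_sq L (\<lambda>x. a *\<^sub>R g x) k = a\<^sup>2 * coef_sq L g k" for k
    unfolding coef_sq_def by (simp add: norm_mult power_mult_distrib sum_distrib_left)
  then have "grad_trunc L (\<lambda>x. a *\<^sub>R g x) = (\<lambda>n. a\<^sup>2 * grad_trunc L g n)"
    unfolding grad_trunc_def by (simp add: sum_distrib_left mult_ac fun_eq_iff)
  moreover have "(\<lambda>n. a\<^sup>2 * grad_trunc L g n) \<longlonglongrightarrow> a\<^sup>2 * (grad_norm L g)\<^sup>2"
    by (intro tendsto_intros grad_trunc_tendsto assms)
  ultimately have "(grad_norm L (\<lambda>x. a *\<^sub>R g x))\<^sup>2 = (\<bar>a\<bar> * grad_norm L g)\<^sup>2"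
    using LIMSEQ_unique[OF grad_trunc_tendsto[OF assms(1) h], of "a\<^sup>2 * (grad_norm L g)\<^sup>2"]
    by (simp add: power_mult_distrib)
  then show ?thesis by (simp add: power2_eq_iff_nonneg grad_norm_nonneg)
qed

lemma Hm1_norm_bound:
  assumes f: "Hm1_zero_mean L f" and L: "L > 0" and g: "in_H1 L g" "zero_mean L g"
  shows "\<bar>f g\<bar> \<le> Hm1_norm L f * grad_norm L g"
proof -
  obtain K where K: "\<And>\<phi>. in_H1 L \<phi> \<Longrightarrow> zero_mean L \<phi> \<Longrightarrow> \<bar>f \<phi>\<bar> \<le> K * grad_norm L \<phi>"
    using f unfolding Hm1_zero_mean_def by blast
  show ?thesis
  \<comment> \<open>A field with zero gradient norm cannot be normalized; there the bound with the
    constant \<open>K\<close> already gives zero.\<close>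
  proof (cases "grad_norm L g = 0")
    case True
    then show ?thesis using K[OF g] by simp
  next
    case False
    define a where "a = inverse (grad_norm L g)"
    have a: "a > 0" "a * grad_norm L g = 1" using False grad_norm_nonneg[of L g] by (auto simp: a_def)
    let ?h = "\<lambda>x. a *\<^sub>R g x"
    have h: "in_H1 L ?h" using in_H1_lincomb[OF g(1) g(1), of a 0] by simp
    have zm: "zero_mean L ?h" using g(2) by (simp add: zero_mean_def)
    have "f (\<lambda>x. a *\<^sub>R g x + 0 *\<^sub>R g x) = a * f g + 0 * f g" using f g(1) unfolding Hm1_zero_mean_def by blast
    then have fh: "f ?h = a * f g" by simp
    have "\<bar>f ?h\<bar> \<le> Hm1_norm L f" unfolding Hm1_norm_def
    proof (rule cSUP_upper)
      show "?h \<in> {\<phi>. in_H1 L \<phi> \<and> zero_mean L \<phi> \<and> grad_norm L \<phi> \<le> 1}"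
        using h zm a by (simp add: grad_norm_scaleR[OF L g(1)])
      show "bdd_above ((\<lambda>\<phi>. \<bar>f \<phi>\<bar>) ` {\<phi>. in_H1 L \<phi> \<and> zero_mean L \<phi> \<and> grad_norm L \<phi> \<le> 1})"
      proof (intro bdd_aboveI2[where M = "\<bar>K\<bar>"])
        fix \<phi> assume "\<phi> \<in> {\<phi>. in_H1 L \<phi> \<and> zero_mean L \<phi> \<and> grad_norm L \<phi> \<le> 1}"
        then have p: "in_H1 L \<phi>" "zero_mean L \<phi>" "grad_norm L \<phi> \<le> 1" by auto
        have "K * grad_norm L \<phi> \<le> \<bar>K\<bar> * 1"
          by (rule mult_mono) (use p grad_norm_nonneg in auto)
        then show "\<bar>f \<phi>\<bar> \<le> \<bar>K\<bar>" using K[OF p(1,2)] by simp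
      qed
    qed
    then have "a * \<bar>f g\<bar> \<le> Hm1_norm L f" using a by (simp add: fh abs_mult)
    then have "grad_norm L g * (a * \<bar>f g\<bar>) \<le> grad_norm L g * Hm1_norm L f"
      by (rule mult_left_mono[OF _ grad_norm_nonneg])
    moreover have "grad_norm L g * (a * \<bar>f g\<bar>) = \<bar>f g\<bar>"
      using a(2) by (simp add: mult.assoc[symmetric] mult.commute[of _ a])
    ultimately show ?thesis by (simp only: mult.commute)
  qed
qed

section \<open>Energy estimates on the attractor\<close>

lemma AE_lebesgue_ex:
  fixes a b :: real
  assumes "AE s in lebesgue. P s" "a < b"
  shows "\<exists>s. a < s \<and> s < b \<and> P s"
proof (rule ccontr)
  assume "\<not> ?thesis"
  then have "AE s in lebesgue. s \<notin> {a<..<b}" using assms(1) by (auto elim!: eventually_mono)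
  then have "{a<..<b} \<in> null_sets lebesgue" by (simp add: completion.null_sets_iff_AE)
  then have "emeasure lebesgue {a<..<b} = 0" by (rule null_setsD1)
  then show False using assms(2) by simp
qed

text \<open>The pointwise \<open>lim\<close> is measurable, and by completeness of Lebesgue measure
  so is every function agreeing with it almost everywhere.\<close>

lemma borel_measurable_lebesgue_lim:
  fixes f :: "nat \<Rightarrow> real \<Rightarrow> real"
  assumes "\<And>n. continuous_on UNIV (f n)" "AE s in lebesgue. (\<lambda>n. f n s) \<longlonglongrightarrow> g s"
  shows "g \<in> borel_measurable lebesgue"
proof (rule borel_measurable_AE)
  have "f n \<in> borel_measurable lebesgue" for n
    using continuous_imp_measurable_on_sets_lebesgue[OF assms(1), of n] by simp
  then show "(\<lambda>s. lim (\<lambda>n. f n s)) \<in> borel_measurable lebesgue" by (rule borel_measurable_lim_metric)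
  show "AE s in lebesgue. lim (\<lambda>n. f n s) = g s"
    using assms(2) by eventually_elim (rule limI)
qed

lemma integral_lebesgue_on_const: "a \<le> b \<Longrightarrow> (LINT s|lebesgue_on {a..b}. c) = (b - a) * (c::real)"
  by (simp add: measure_restrict_space)

lemma AE_lebesgue_on_iff:
  "S \<in> sets lebesgue \<Longrightarrow> (AE x in lebesgue_on S. P x) \<longleftrightarrow> (AE x in lebesgue. x \<in> S \<longrightarrow> P x)"
  by (simp add: AE_restrict_space_iff)

lemma AE_lebesgue_onI:
  assumes "AE x in lebesgue. P x" "S \<in> sets lebesgue"
  shows "AE x in lebesgue_on S. P x"
  unfolding AE_lebesgue_on_iff[OF assms(2)] by (rule eventually_mono[OF assms(1)]) simp

lemma integrable_lebesgue_on_iff: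
  fixes g :: "'a::euclidean_space \<Rightarrow> real"
  shows "S \<in> sets lebesgue \<Longrightarrow> integrable (lebesgue_on S) g \<longleftrightarrow> set_integrable lebesgue S g"
  by (simp add: set_integrable_def integrable_restrict_space)

lemma integrable_const_Icc: "integrable (lebesgue_on {a..b::real}) (\<lambda>_. c::real)"
  by (intro finite_measure.integrable_const finite_measureI)
    (simp add: emeasure_restrict_space emeasure_lborel_Icc_eq)

locale attractor_trajectory =
  fixes L \<nu> :: real and f :: "vfield \<Rightarrow> real" and u :: "real \<Rightarrow> vfield"
  assumes L: "L > 0" and \<nu>: "\<nu> > 0" and f: "Hm1_zero_mean L f"
    and u: "complete_bounded_Leray_Hopf L \<nu> f u"
begin

definition \<kappa> :: real where "\<kappa> = 2 * pi / L"
definition F :: real where "F = Hm1_norm L f"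
definition energy :: "real \<Rightarrow> real" where "energy t = (Lp_norm L 2 (u t))\<^sup>2"
definition dissip :: "real \<Rightarrow> real" where "dissip t = (grad_norm L (u t))\<^sup>2"

lemma \<kappa>_pos: "\<kappa> > 0" using L by (simp add: \<kappa>_def)

lemma Leray_Hopf: "a < b \<Longrightarrow> Leray_Hopf L \<nu> f a b u"
  using u by (simp add: complete_bounded_Leray_Hopf_def)

lemma in_L2: "in_L2 L (u t)"
proof -
  have "weakly_continuous L {t - 1..t + 1} u"
    using Leray_Hopf[of "t - 1" "t + 1"] unfolding Leray_Hopf_def by linarith
  then show ?thesis unfolding weakly_continuous_def by simp
qed

lemma zero_mean: "zero_mean L (u t)"
proof -
  have "\<forall>s\<in>{t - 1..t + 1}. zero_mean L (u s) \<and> div_free L (u s)"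
    using Leray_Hopf[of "t - 1" "t + 1"] unfolding Leray_Hopf_def by linarith
  then show ?thesis by simp
qed

lemma continuous_inner:
  assumes "in_L2 L \<phi>"
  shows "continuous_on UNIV (\<lambda>t. inner_L2 L (u t) \<phi>)"
proof (rule continuous_at_imp_continuous_on, rule ballI)
  fix t :: real
  have "continuous_on {t - 1..t + 1} (\<lambda>t. inner_L2 L (u t) \<phi>)"
  proof -
    have "weakly_continuous L {t - 1..t + 1} u"
      using Leray_Hopf[of "t - 1" "t + 1"] unfolding Leray_Hopf_def by linarith
    then show ?thesis using assms unfolding weakly_continuous_def by blast
  qed
  then show "isCont (\<lambda>t. inner_L2 L (u t) \<phi>) t"
    by (rule continuous_on_interior) simp
qed

lemma AE_in_H1: "AE t in lebesgue. in_H1 L (u t)"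
proof -
  have "AE t in lebesgue. t \<in> {- real (Suc n)..real (Suc n)} \<longrightarrow> in_H1 L (u t)" for n
  proof -
    have "L2_H1 L {- real (Suc n)..real (Suc n)} u"
      using Leray_Hopf[of "- real (Suc n)" "real (Suc n)"] by (simp add: Leray_Hopf_def)
    then have "AE t in lebesgue_on {- real (Suc n)..real (Suc n)}. in_H1 L (u t)"
      by (simp only: L2_H1_def)
    then show ?thesis by (subst AE_lebesgue_on_iff[symmetric]) auto
  qed
  then have "AE t in lebesgue. \<forall>n. t \<in> {- real (Suc n)..real (Suc n)} \<longrightarrow> in_H1 L (u t)"
    unfolding AE_all_countable by blast
  then show ?thesis
  proof eventually_elim
    case (elim t)
    obtain n where "\<bar>t\<bar> \<le> real n" using real_arch_simple by blast
    then have "t \<in> {- real (Suc n)..real (Suc n)}" by auto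
    then show ?case using elim by blast
  qed
qed

text \<open>Real and imaginary parts of a coefficient are inner products with trigonometric fields,
  which is what weak continuity controls.\<close>

lemma continuous_fcoef:
  "continuous_on UNIV (\<lambda>t. fcoef L (\<lambda>x. u t x $ j) k)"
proof -
  have "(LINT x|torus L. u t x $ j * trig a b (kvec L k) x) = inner_L2 L (u t) (trig_field a b (kvec L k) j)" for a b t
    by (simp add: inner_L2_def trig_field_def inner_axis mult.commute)
  moreover have "integrable (torus L) (\<lambda>x. u t x $ j)" for t
    using in_L2[of t] by (auto simp: in_L2_iff intro: sq_int_integrable)
  ultimately have "(\<lambda>t. fcoef L (\<lambda>x. u t x $ j) k) = (\<lambda>t. (of_real (inner_L2 L (u t) (trig_field 1 0 (kvec L k) j))
     - \<i> * of_real (inner_L2 L (u t) (trig_field 0 1 (kvec L k) j))) / of_real (L ^ 3))"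
    by (simp add: fcoef_eq_trig)
  moreover have "continuous_on UNIV \<dots>"
    using L by (intro continuous_intros continuous_inner in_L2_continuous continuous_on_trig_field) auto
  ultimately show ?thesis by (simp only:)
qed

lemma measurable_dissip: "dissip \<in> borel_measurable lebesgue"
proof (rule borel_measurable_lebesgue_lim)
  show "continuous_on UNIV (\<lambda>t. grad_trunc L (u t) n)" for n
    unfolding grad_trunc_def coef_sq_def by (intro continuous_intros continuous_fcoef)
  show "AE t in lebesgue. (\<lambda>n. grad_trunc L (u t) n) \<longlonglongrightarrow> dissip t"
    using AE_in_H1 by eventually_elim (use grad_trunc_tendsto L in \<open>simp add: dissip_def\<close>)
qed

lemma measurable_force: "(\<lambda>t. f (u t)) \<in> borel_measurable lebesgue"
proof (rule borel_measurable_lebesgue_lim)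
  show "continuous_on UNIV (\<lambda>t. force_trunc L f (u t) n)" for n
    unfolding force_trunc_def case_prod_unfold by (intro continuous_intros continuous_fcoef)
  show "AE t in lebesgue. (\<lambda>n. force_trunc L f (u t) n) \<longlonglongrightarrow> f (u t)"
    using AE_in_H1 by eventually_elim (use force_trunc_tendsto[OF f L] in simp)
qed

lemma measurable_on_dissip: "S \<in> sets lebesgue \<Longrightarrow> dissip \<in> borel_measurable (lebesgue_on S)"
  and measurable_on_force: "S \<in> sets lebesgue \<Longrightarrow> (\<lambda>t. f (u t)) \<in> borel_measurable (lebesgue_on S)"
  by (rule measurable_restrict_space1, rule measurable_dissip) (rule measurable_restrict_space1, rule measurable_force)

lemma dissip_nonneg: "dissip t \<ge> 0" and energy_nonneg: "energy t \<ge> 0"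
  by (simp_all add: dissip_def energy_def)

text \<open>The definition provides integrability of the sum of energy and dissipation only.
  Measurability of the dissipation allows it to be separated by domination.\<close>

lemma integrable_dissip: "integrable (lebesgue_on {a..b}) dissip"
proof -
  \<comment> \<open>The solution property is available on intervals with a < b, so a possibly empty
    or degenerate interval is enlarged.\<close>
  have "integrable (lebesgue_on {a..max b (a + 1)}) dissip"
  proof (rule Bochner_Integration.integrable_bound)
    show "integrable (lebesgue_on {a..max b (a + 1)}) (\<lambda>t. (Lp_norm L 2 (u t))\<^sup>2 + (grad_norm L (u t))\<^sup>2)"
      using Leray_Hopf[of a "max b (a + 1)"] by (simp add: Leray_Hopf_def L2_H1_def)
    show "dissip \<in> borel_measurable (lebesgue_on {a..max b (a + 1)})" by (rule measurable_on_dissip) simp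
    show "AE t in lebesgue_on {a..max b (a + 1)}. norm (dissip t) \<le> norm ((Lp_norm L 2 (u t))\<^sup>2 + (grad_norm L (u t))\<^sup>2)"
      by (intro AE_I2) (simp add: dissip_def)
  qed
  then have "set_integrable lebesgue {a..max b (a + 1)} dissip"
    by (subst (asm) integrable_lebesgue_on_iff) simp_all
  then have "set_integrable lebesgue {a..b} dissip"
    by (rule set_integrable_subset) auto
  then show ?thesis by (subst integrable_lebesgue_on_iff) simp_all
qed

text \<open>Young's inequality for |f(u)| <= F |grad u|. In the first bound half of the viscous term
  survives; the second, cruder one makes the force integrable in time.\<close>

lemma AE_force_le: "AE t in lebesgue. - \<nu> * dissip t + f (u t) \<le> - (\<nu> / 2) * dissip t + F\<^sup>2 / (2 * \<nu>)
    \<and> \<bar>f (u t)\<bar> \<le> dissip t + F\<^sup>2"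
  using AE_in_H1
proof eventually_elim
  case (elim t)
  define g where "g = grad_norm L (u t)"
  have b: "\<bar>f (u t)\<bar> \<le> F * g"
    unfolding F_def g_def by (rule Hm1_norm_bound[OF f L elim zero_mean])
  have "0 \<le> (\<nu> * g - F)\<^sup>2 / (2 * \<nu>)" using \<nu> by simp
  also have "\<dots> = \<nu> / 2 * g\<^sup>2 + F\<^sup>2 / (2 * \<nu>) - F * g"
    using \<nu> by (simp add: power2_eq_square field_simps)
  finally have 1: "F * g \<le> \<nu> / 2 * g\<^sup>2 + F\<^sup>2 / (2 * \<nu>)" by simp
  have 2: "F * g \<le> g\<^sup>2 + F\<^sup>2"
    using sum_squares_bound[of F g] zero_le_power2[of F] zero_le_power2[of g] by linarith
  show ?case using b 1 2 unfolding dissip_def g_def[symmetric] by auto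
qed

lemma integrable_force: "integrable (lebesgue_on {a..b}) (\<lambda>t. f (u t))"
proof (rule Bochner_Integration.integrable_bound)
  show "integrable (lebesgue_on {a..b}) (\<lambda>t. dissip t + F\<^sup>2)"
    by (intro Bochner_Integration.integrable_add integrable_dissip integrable_const_Icc)
  show "AE t in lebesgue_on {a..b}. norm (f (u t)) \<le> norm (dissip t + F\<^sup>2)"
    by (rule AE_lebesgue_onI[OF eventually_mono[OF AE_force_le]]) (use dissip_nonneg in \<open>simp_all add: add_nonneg_nonneg\<close>)
  show "(\<lambda>t. f (u t)) \<in> borel_measurable (lebesgue_on {a..b})" by (rule measurable_on_force) simp
qed

lemma energy_ineq:
  assumes "a < b"
  shows "AE s in lebesgue. s \<in> {a<..<b} \<longrightarrow> (\<forall>t\<in>{s..b}. energy t + \<nu> * (LINT \<tau>|lebesgue_on {s..t}. dissip \<tau>) \<le> energy s + F\<^sup>2 / \<nu> * (t - s))"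
proof -
  have "AE s in lebesgue_on {a<..<b}. \<forall>t\<in>{s..b}. energy t / 2 \<le> energy s / 2 + (LINT \<tau>|lebesgue_on {s..t}. - \<nu> * dissip \<tau> + f (u \<tau>))"
    using Leray_Hopf[OF assms] by (simp add: Leray_Hopf_def energy_def dissip_def)
  then have "AE s in lebesgue. s \<in> {a<..<b} \<longrightarrow> (\<forall>t\<in>{s..b}. energy t / 2 \<le> energy s / 2 + (LINT \<tau>|lebesgue_on {s..t}. - \<nu> * dissip \<tau> + f (u \<tau>)))"
    by (simp add: AE_lebesgue_on_iff)
  then show ?thesis
  proof eventually_elim
    case (elim s)
    show ?case
    proof (intro impI ballI)
      fix t assume st: "s \<in> {a<..<b}" "t \<in> {s..b}"
      have "(LINT \<tau>|lebesgue_on {s..t}. - \<nu> * dissip \<tau> + f (u \<tau>)) \<le> (LINT \<tau>|lebesgue_on {s..t}. - (\<nu> / 2) * dissip \<tau> + F\<^sup>2 / (2 * \<nu>))"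
      proof (rule integral_mono_AE)
        show "AE \<tau> in lebesgue_on {s..t}. - \<nu> * dissip \<tau> + f (u \<tau>) \<le> - (\<nu> / 2) * dissip \<tau> + F\<^sup>2 / (2 * \<nu>)"
          by (rule AE_lebesgue_onI[OF eventually_mono[OF AE_force_le]]) auto
      qed (intro Bochner_Integration.integrable_add integrable_mult_right integrable_dissip integrable_force integrable_const_Icc)+
      also have "\<dots> = - (\<nu> / 2) * (LINT \<tau>|lebesgue_on {s..t}. dissip \<tau>) + (t - s) * (F\<^sup>2 / (2 * \<nu>))"
      proof -
        have "(LINT \<tau>|lebesgue_on {s..t}. - (\<nu> / 2) * dissip \<tau> + F\<^sup>2 / (2 * \<nu>))
          = (LINT \<tau>|lebesgue_on {s..t}. - (\<nu> / 2) * dissip \<tau>) + (LINT \<tau>|lebesgue_on {s..t}. F\<^sup>2 / (2 * \<nu>))"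
          by (intro Bochner_Integration.integral_add integrable_mult_right integrable_dissip integrable_const_Icc)
        moreover have "(LINT \<tau>|lebesgue_on {s..t}. F\<^sup>2 / (2 * \<nu>)) = (t - s) * (F\<^sup>2 / (2 * \<nu>))"
          using st by (intro integral_lebesgue_on_const) auto
        ultimately show ?thesis by (simp only: integral_mult_right_zero)
      qed
      finally have le: "(LINT \<tau>|lebesgue_on {s..t}. - \<nu> * dissip \<tau> + f (u \<tau>)) \<le> - (\<nu> / 2) * (LINT \<tau>|lebesgue_on {s..t}. dissip \<tau>) + (t - s) * (F\<^sup>2 / (2 * \<nu>))" .
      have "energy t / 2 \<le> energy s / 2 + (LINT \<tau>|lebesgue_on {s..t}. - \<nu> * dissip \<tau> + f (u \<tau>))"
        using elim st by blast
      then have half: "energy t / 2 \<le> energy s / 2 + (- (\<nu> / 2) * (LINT \<tau>|lebesgue_on {s..t}. dissip \<tau>) + (t - s) * (F\<^sup>2 / (2 * \<nu>)))"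
        using le by linarith
      have halve: "e / 2 \<le> e' / 2 + (- (\<nu> / 2) * I + b) \<Longrightarrow> b = B / 2 \<Longrightarrow> e + \<nu> * I \<le> e' + B" for e e' I b B
        by linarith
      have "(t - s) * (F\<^sup>2 / (2 * \<nu>)) = F\<^sup>2 / \<nu> * (t - s) / 2" by (simp add: mult.commute)
      with half show "energy t + \<nu> * (LINT \<tau>|lebesgue_on {s..t}. dissip \<tau>) \<le> energy s + F\<^sup>2 / \<nu> * (t - s)"
        by (rule halve)
    qed
  qed
qed

lemma nn_dissip: "(\<integral>\<^sup>+\<tau>. ennreal (dissip \<tau>) \<partial>lebesgue_on {a..b}) = ennreal (LINT \<tau>|lebesgue_on {a..b}. dissip \<tau>)"
  by (rule nn_integral_eq_integral[OF integrable_dissip]) (intro AE_I2 dissip_nonneg)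

definition E where "E = Sup (range energy)"

lemma energy_le_E: "energy t \<le> E"
proof -
  have "bdd_above (range (\<lambda>t. Lp_norm L 2 (u t)))" using u by (simp add: complete_bounded_Leray_Hopf_def)
  then obtain M where M: "\<And>t. Lp_norm L 2 (u t) \<le> M" by (auto simp: bdd_above_def)
  have "energy t \<le> M\<^sup>2" for t
    unfolding energy_def by (rule power_mono[OF M]) (simp add: Lp_norm_def)
  then show ?thesis unfolding E_def by (intro cSUP_upper bdd_aboveI2[where M = "M\<^sup>2"]) auto
qed

text \<open>The energy inequality may fail to start at t - \<tau> itself, but it starts at some time
  in the margin of length \<sigma> before it. The energy there is at most \<open>E\<close>.\<close>

lemma integral_dissip_le:
  assumes "\<tau> > 0" "\<sigma> > 0"
  shows "\<nu> * (LINT s|lebesgue_on {t - \<tau>..t}. dissip s) \<le> E + F\<^sup>2 / \<nu> * (\<tau> + \<sigma>)"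
proof -
  \<comment> \<open>The solution is considered from t - \<tau> - 2\<sigma> on, so that the margin
    lies inside the open interval of admissible starting times.\<close>
  obtain s where s: "t - \<tau> - \<sigma> < s" "s < t - \<tau>"
    "s \<in> {t - \<tau> - 2 * \<sigma><..<t} \<longrightarrow> (\<forall>r\<in>{s..t}. energy r + \<nu> * (LINT \<tau>|lebesgue_on {s..r}. dissip \<tau>) \<le> energy s + F\<^sup>2 / \<nu> * (r - s))"
    using AE_lebesgue_ex[OF energy_ineq[of "t - \<tau> - 2 * \<sigma>" t], of "t - \<tau> - \<sigma>" "t - \<tau>"] assms by auto
  have "energy t + \<nu> * (LINT \<tau>|lebesgue_on {s..t}. dissip \<tau>) \<le> energy s + F\<^sup>2 / \<nu> * (t - s)"
    using s assms by auto
  moreover have "F\<^sup>2 / \<nu> * (t - s) \<le> F\<^sup>2 / \<nu> * (\<tau> + \<sigma>)"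
    using s \<nu> by (intro mult_left_mono) auto
  moreover have "(LINT s|lebesgue_on {t - \<tau>..t}. dissip s) \<le> (LINT \<tau>|lebesgue_on {s..t}. dissip \<tau>)"
  proof -
    have "(\<integral>\<^sup>+s. ennreal (dissip s) \<partial>lebesgue_on {t - \<tau>..t}) \<le> (\<integral>\<^sup>+s. ennreal (dissip s) \<partial>lebesgue_on {s..t})"
      using s by (simp add: nn_integral_restrict_space) (auto intro!: nn_integral_mono simp: indicator_def)
    then show ?thesis unfolding nn_dissip by (simp add: integral_nonneg_AE dissip_nonneg)
  qed
  then have "\<nu> * (LINT s|lebesgue_on {t - \<tau>..t}. dissip s) \<le> \<nu> * (LINT \<tau>|lebesgue_on {s..t}. dissip \<tau>)"
    using \<nu> by (intro mult_left_mono) auto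
  ultimately show ?thesis
    using energy_le_E[of s] energy_nonneg[of t] by linarith
qed

text \<open>On a time window of length \<open>2 / (\<nu> \<kappa>\<^sup>2)\<close> some instant has at most average dissipation, and
  by Poincare's inequality its energy is at most half of the supremum \<open>E\<close> plus a multiple of
  \<open>F\<^sup>2\<close>; the energy inequality carries this to the end of the window.\<close>

lemma E_le: "E \<le> 8 * F\<^sup>2 / (\<nu>\<^sup>2 * \<kappa>\<^sup>2)"
proof -
  \<comment> \<open>With this length the factor of \<open>E\<close> in m / \<kappa>^2 is 1 / (\<nu>
    \<tau> \<kappa>^2) = 1/2.\<close>
  define \<tau> where "\<tau> = 2 / (\<nu> * \<kappa>\<^sup>2)"
  have \<tau>: "\<tau> > 0" using \<nu> \<kappa>_pos by (simp add: \<tau>_def)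
  \<comment> \<open>The bound on the mean dissipation over the window that
    \<open>integral_dissip_le\<close> gives with a margin equal to the window.\<close>
  define m where "m = (E + F\<^sup>2 / \<nu> * (2 * \<tau>)) / (\<nu> * \<tau>)"
  have "energy t \<le> m / \<kappa>\<^sup>2 + F\<^sup>2 / \<nu> * \<tau>" for t
  proof (rule field_le_epsilon)
    fix e :: real assume e: "e > 0"
    \<comment> \<open>The excess over m makes the averaging argument a strict contradiction; after
      division by \<kappa>^2 in Poincare's inequality it becomes e.\<close>
    define m' where "m' = m + e * \<kappa>\<^sup>2"
    have mm': "m < m'" using e \<kappa>_pos by (simp add: m'_def)
    have good: "AE s in lebesgue. in_H1 L (u s) \<and> (s \<in> {t - \<tau><..<t} \<longrightarrow> (\<forall>r\<in>{s..t}. energy r + \<nu> * (LINT \<tau>|lebesgue_on {s..r}. dissip \<tau>) \<le> energy s + F\<^sup>2 / \<nu> * (r - s)))"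
      using AE_in_H1 energy_ineq[of "t - \<tau>" t] \<tau> by auto
    have "\<exists>s\<in>{t - \<tau><..<t}. in_H1 L (u s) \<and> dissip s \<le> m' \<and> energy t \<le> energy s + F\<^sup>2 / \<nu> * (t - s)"
    proof (rule ccontr)
      assume no: "\<not> ?thesis"
      have "AE s in lebesgue. s \<in> {t - \<tau><..<t} \<longrightarrow> m' \<le> dissip s"
        using good
      proof eventually_elim
        case (elim s)
        show ?case
        proof
          assume s: "s \<in> {t - \<tau><..<t}"
          then have "energy t + \<nu> * (LINT \<tau>|lebesgue_on {s..t}. dissip \<tau>) \<le> energy s + F\<^sup>2 / \<nu> * (t - s)"
            using elim by auto
          moreover have "0 \<le> \<nu> * (LINT \<tau>|lebesgue_on {s..t}. dissip \<tau>)"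
            using \<nu> by (intro mult_nonneg_nonneg integral_nonneg_AE) (auto simp: dissip_nonneg)
          ultimately have "energy t \<le> energy s + F\<^sup>2 / \<nu> * (t - s)" by linarith
          then have "\<not> dissip s \<le> m'" using no elim s by blast
          then show "m' \<le> dissip s" by simp
        qed
      qed
      moreover have "AE s in lebesgue. s \<noteq> t - \<tau> \<and> s \<noteq> t"
      proof -
        have "{t - \<tau>, t} \<in> null_sets lebesgue" by (simp add: negligible_iff_null_sets[symmetric])
        from AE_not_in[OF this] show ?thesis by (auto elim: eventually_mono)
      qed
      ultimately have "AE s in lebesgue. s \<in> {t - \<tau>..t} \<longrightarrow> m' \<le> dissip s"
        by eventually_elim auto
      then have "AE s in lebesgue_on {t - \<tau>..t}. m' \<le> dissip s" by (simp add: AE_lebesgue_on_iff)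
      then have "(LINT s|lebesgue_on {t - \<tau>..t}. m') \<le> (LINT s|lebesgue_on {t - \<tau>..t}. dissip s)"
        by (intro integral_mono_AE integrable_dissip integrable_const_Icc)
      also have "(LINT s|lebesgue_on {t - \<tau>..t}. m') = \<tau> * m'" using \<tau> by (subst integral_lebesgue_on_const) auto
      finally have "\<nu> * (\<tau> * m') \<le> \<nu> * (LINT s|lebesgue_on {t - \<tau>..t}. dissip s)" using \<nu> by simp
      also have "\<dots> \<le> E + F\<^sup>2 / \<nu> * (\<tau> + \<tau>)" by (rule integral_dissip_le[OF \<tau> \<tau>])
      also have "\<dots> = \<nu> * (\<tau> * m)" using \<nu> \<tau> by (simp add: m_def)
      finally show False using mm' \<nu> \<tau> by simp
    qed
    then obtain s where s: "t - \<tau> < s" "s < t" "in_H1 L (u s)" "dissip s \<le> m'" "energy t \<le> energy s + F\<^sup>2 / \<nu> * (t - s)"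
      by auto
    have "\<kappa>\<^sup>2 * energy s \<le> dissip s"
      unfolding energy_def dissip_def \<kappa>_def by (rule Poincare[OF L s(3) zero_mean])
    then have "\<kappa>\<^sup>2 * energy s \<le> m'" using s by simp
    then have "energy s \<le> m' / \<kappa>\<^sup>2" using \<kappa>_pos by (simp add: pos_le_divide_eq mult.commute)
    moreover have "F\<^sup>2 / \<nu> * (t - s) \<le> F\<^sup>2 / \<nu> * \<tau>" using s \<nu> by (intro mult_left_mono) auto
    moreover have "m' / \<kappa>\<^sup>2 = m / \<kappa>\<^sup>2 + e" using \<kappa>_pos by (simp add: m'_def add_divide_distrib)
    ultimately show "energy t \<le> m / \<kappa>\<^sup>2 + F\<^sup>2 / \<nu> * \<tau> + e" using s by linarith
  qed
  then have "E \<le> m / \<kappa>\<^sup>2 + F\<^sup>2 / \<nu> * \<tau>" unfolding E_def by (intro cSUP_least) auto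
  \<comment> \<open>Both force terms contribute 2 F^2 / (\<nu>^2 \<kappa>^2); moving E/2 to the left
    doubles the sum.\<close>
  also have "\<dots> = E / 2 + 4 * F\<^sup>2 / (\<nu>\<^sup>2 * \<kappa>\<^sup>2)"
    using \<nu> \<kappa>_pos unfolding m_def \<tau>_def by (simp add: field_simps power2_eq_square)
  finally show ?thesis by simp
qed

lemma nn_dissip_le:
  assumes "T > 0"
  shows "(\<integral>\<^sup>+\<tau>. ennreal (dissip \<tau>) \<partial>lebesgue_on {t0..t0 + T}) \<le> ennreal (8 * (F\<^sup>2 / (\<nu> ^ 3 * \<kappa>\<^sup>2) + F\<^sup>2 / \<nu>\<^sup>2 * T))"
proof -
  \<comment> \<open>The margin is taken as long as the window, which keeps the force contribution
    proportional to T.\<close>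
  have "\<nu> * (LINT s|lebesgue_on {t0..t0 + T}. dissip s) \<le> E + F\<^sup>2 / \<nu> * (T + T)"
    using integral_dissip_le[OF assms assms, of "t0 + T"] by simp
  also have "\<dots> \<le> 8 * F\<^sup>2 / (\<nu>\<^sup>2 * \<kappa>\<^sup>2) + F\<^sup>2 / \<nu> * (8 * T)"
    using E_le \<nu> assms by (intro add_mono mult_left_mono) auto
  also have "\<dots> = \<nu> * (8 * (F\<^sup>2 / (\<nu> ^ 3 * \<kappa>\<^sup>2) + F\<^sup>2 / \<nu>\<^sup>2 * T))"
    using \<nu> by (simp add: field_simps power2_eq_square power3_eq_cube)
  finally have "(LINT s|lebesgue_on {t0..t0 + T}. dissip s) \<le> 8 * (F\<^sup>2 / (\<nu> ^ 3 * \<kappa>\<^sup>2) + F\<^sup>2 / \<nu>\<^sup>2 * T)"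
    using \<nu> by simp
  then show ?thesis unfolding nn_dissip by (rule ennreal_leI)
qed

end

section \<open>The determining wavenumber and Littlewood-Paley shells\<close>

text \<open>Half-side of a cube of frequencies containing shell q. The shift q + 1 gives 1 for the
  lowest shell q = -1, as Bernstein's inequality requires.\<close>

definition lp_radius :: "int \<Rightarrow> nat" where
  "lp_radius q = 2 ^ nat (q + 1)"

lemma lp_radius: "q \<ge> -1 \<Longrightarrow> real (lp_radius q) = 2 * 2 powi q"
proof -
  assume "q \<ge> -1"
  then have "(2::real) ^ nat (q + 1) = 2 powi (q + 1)" by (simp add: power_int_def)
  also have "\<dots> = 2 * 2 powi q" by (simp add: power_int_add)
  finally show ?thesis by (simp add: lp_radius_def)
qed

text \<open>\<chi>(\<xi>/2) - \<chi>(\<xi>) vanishes for |\<xi>| <= 3/4, where both terms are 1, and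
  for |\<xi>| >= 2, where both are 0. The upper bound also fits q = -1, where it reads |\<xi>| <
  1.\<close>

lemma lp_mult_support:
  assumes "lp_cutoff X" "q \<ge> -1" "lp_mult X q \<xi> \<noteq> 0"
  shows "norm \<xi> < 2 * 2 powi q" "q \<ge> 0 \<Longrightarrow> 3 / 4 * 2 powi q < norm \<xi>"
proof -
  have X1: "\<And>\<xi>. norm \<xi> \<le> 3/4 \<Longrightarrow> X \<xi> = 1" and X0: "\<And>\<xi>. norm \<xi> \<ge> 1 \<Longrightarrow> X \<xi> = 0"
    using assms(1) unfolding lp_cutoff_def by blast+
  have pos: "(2::real) powi q > 0" by simp
  have n: "norm ((2 powi (- q)) *\<^sub>R \<xi>) = norm \<xi> / 2 powi q"
    by (simp add: power_int_minus divide_inverse mult.commute)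
  show "norm \<xi> < 2 * 2 powi q"
  proof (rule ccontr)
    assume big: "\<not> ?thesis"
    show False
    proof (cases "q = -1")
      case True
      then show False using big assms(3) X0[of \<xi>] by (simp add: lp_mult_def)
    next
      case False
      have "2 \<le> norm \<xi> / 2 powi q" using big pos by (simp add: pos_le_divide_eq)
      then have "X ((2 powi (- q)) *\<^sub>R \<xi>) = 0" "X ((1/2) *\<^sub>R ((2 powi (- q)) *\<^sub>R \<xi>)) = 0"
        by (intro X0; simp only: norm_scaleR[of "1/2"] n; simp)+
      then show False using assms(3) False by (simp add: lp_mult_def lp_phi_def)
    qed
  qed
  show "3 / 4 * 2 powi q < norm \<xi>" if "q \<ge> 0"
  proof (rule ccontr)
    assume small: "\<not> ?thesis"
    have "norm \<xi> / 2 powi q \<le> 3 / 4" using small pos by (simp add: pos_divide_le_eq)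
    then have "X ((2 powi (- q)) *\<^sub>R \<xi>) = 1" "X ((1/2) *\<^sub>R ((2 powi (- q)) *\<^sub>R \<xi>)) = 1"
      by (intro X1; simp only: norm_scaleR[of "1/2"] n; simp)+
    then show False using assms(3) that by (simp add: lp_mult_def lp_phi_def)
  qed
qed

lemma lp_mult_eq_0:
  assumes "lp_cutoff X" "q \<ge> -1" "k \<notin> fbox (lp_radius q)"
  shows "lp_mult X q (freq k) = 0"
proof (rule ccontr)
  assume "lp_mult X q (freq k) \<noteq> 0"
  then have "norm (freq k) < real (lp_radius q)"
    using lp_mult_support(1)[OF assms(1,2)] lp_radius[OF assms(2)] by simp
  then have "\<bar>freq k $ i\<bar> < real (lp_radius q)" for i
    using component_le_norm_cart[of "freq k" i] by linarith
  then have "real_of_int \<bar>k $ i\<bar> < real_of_int (int (lp_radius q))" for i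
    by (simp add: freq_def)
  then have "\<bar>k $ i\<bar> < int (lp_radius q)" for i
    unfolding of_int_less_iff .
  then have "\<bar>k $ i\<bar> \<le> int (lp_radius q)" for i
    by (rule less_imp_le)
  then show False using assms(3) by (simp add: fbox_def)
qed

lemma LP_nth:
  assumes "lp_cutoff X" "q \<ge> -1"
  shows "LP X L q g x $ i = (\<Sum>k\<in>fbox (lp_radius q). (fcoef L (\<lambda>x. g x $ i) k * of_real (lp_mult X q (freq k))) * tchar L k x)"
proof -
  have "LP X L q g x = (\<Sum>\<^sub>\<infinity>k\<in>fbox (lp_radius q). \<chi> i. fourier_coeff L g k $ i * of_real (lp_mult X q (freq k))
                  * cis ((2 * pi / L) * (freq k \<bullet> x)))"
    unfolding LP_def
    by (rule infsum_cong_neutral) (auto simp: lp_mult_eq_0[OF assms] vec_eq_iff)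
  then show ?thesis by (simp add: fourier_coeff_eq tchar_def)
qed

lemma continuous_on_LP:
  assumes "lp_cutoff X" "q \<ge> -1"
  shows "continuous_on S (LP X L q g)"
proof -
  have "LP X L q g = (\<lambda>x. \<chi> i. \<Sum>k\<in>fbox (lp_radius q). (fcoef L (\<lambda>x. g x $ i) k * of_real (lp_mult X q (freq k))) * tchar L k x)"
    by (simp add: fun_eq_iff vec_eq_iff LP_nth[OF assms])
  moreover have "continuous_on S \<dots>" by (intro continuous_intros)
  ultimately show ?thesis by (simp only:)
qed

lemma lam_pos: "L > 0 \<Longrightarrow> lam L q > 0"
  by (simp add: lam_def)

text \<open>Shell q has frequencies up to twice \<open>2 powi q\<close>. The resulting factor
  2^(3/r) is at most 4 because r > 2, and 1560 = 4 * 390.\<close>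

lemma Bernstein_LP:
  assumes "L > 0" "2 < r" "lp_cutoff X" "q \<ge> -1"
  shows "norm (LP X L q g x) \<le> 1560 * (lam L q powr (3 / r) * Lp_norm L r (LP X L q g))"
proof -
  have "norm (LP X L q g x) \<le> 390 * (real (lp_radius q) / L) powr (3 / r) * Lp_norm L r (LP X L q g)"
    using assms by (intro Bernstein[OF assms(1) _ _ LP_nth[OF assms(3,4)]]) (auto simp: lp_radius_def)
  also have "real (lp_radius q) / L = 2 * lam L q" by (simp add: lp_radius[OF assms(4)] lam_def)
  also have "(2 * lam L q) powr (3 / r) = 2 powr (3 / r) * lam L q powr (3 / r)"
    by (simp add: powr_mult)
  also have "390 * (2 powr (3 / r) * lam L q powr (3 / r)) * Lp_norm L r (LP X L q g)
      \<le> 390 * (4 * lam L q powr (3 / r)) * Lp_norm L r (LP X L q g)"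
  proof -
    have "(2::real) powr (3 / r) \<le> 2 powr 2" using assms(2) by (intro powr_mono) (auto simp: divide_le_eq)
    then have "(2::real) powr (3 / r) \<le> 4" by simp
    then show ?thesis by (intro mult_right_mono mult_left_mono) (auto simp: Lp_norm_def)
  qed
  finally show ?thesis by simp
qed

lemma Linf_norm_LP_upto:
  assumes "L > 0" "2 < r" "lp_cutoff X"
  shows "Linf_norm L (LP_upto X L q g) \<le> 1560 * (\<Sum>p\<in>{-1..q}. lam L p powr (3 / r) * Lp_norm L r (LP X L p g))"
    (is "_ \<le> ?B")
proof -
  have B0: "0 \<le> ?B" by (intro mult_nonneg_nonneg sum_nonneg) (auto simp: Lp_norm_def)
  have c: "continuous_on UNIV (\<lambda>x. LP_upto X L q g x)"
    unfolding LP_upto_def by (intro continuous_on_sum continuous_on_LP[OF assms(3)]) auto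
  have "norm (LP_upto X L q g x) \<le> ?B" for x
  proof -
    have "norm (LP_upto X L q g x) \<le> (\<Sum>p\<in>{-1..q}. norm (LP X L p g x))"
      unfolding LP_upto_def by (rule norm_sum)
    also have "\<dots> \<le> (\<Sum>p\<in>{-1..q}. 1560 * (lam L p powr (3 / r) * Lp_norm L r (LP X L p g)))"
      by (intro sum_mono Bernstein_LP assms) auto
    finally show ?thesis by (simp add: sum_distrib_left)
  qed
  moreover have "(\<lambda>x. ereal (norm (LP_upto X L q g x))) \<in> borel_measurable (torus L)"
    using borel_measurable_torus[OF continuous_on_norm[OF c], of L] by measurable
  ultimately have "esssup (torus L) (\<lambda>x. ereal (norm (LP_upto X L q g x))) \<le> ereal ?B"
    by (intro esssup_I AE_I2) auto
  \<comment> \<open>\<open>real_of_ereal\<close> sends -\<infinity> to 0; in that case of the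
    distinction the bound is the nonnegativity of its right-hand side.\<close>
  then show ?thesis unfolding Linf_norm_def using B0
    by (cases "esssup (torus L) (\<lambda>x. ereal (norm (LP_upto X L q g x)))") auto
qed

text \<open>Consecutive terms have ratio 2^(-e) <= 2^(-\<sigma>). The separate \<sigma> makes the
  constant independent of e, hence later of the dimension d.\<close>

lemma sum_lam_powr_le:
  assumes "L > 0" "0 < \<sigma>" "\<sigma> \<le> e"
  shows "(\<Sum>p\<in>{-1..int m}. lam L p powr e) \<le> (3 / (1 - 2 powr (- \<sigma>))) * lam L (int m) powr e"
proof -
  define K where "K = 1 / (1 - (2::real) powr (- \<sigma>))"
  have lt1: "(2::real) powr (- \<sigma>) < 1" using assms(2) powr_less_mono[of "- \<sigma>" 0 2] by simp
  have K: "K \<ge> 1" using lt1 by (simp add: K_def pos_le_divide_eq)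
  have step: "lam L p powr e \<le> 2 powr (- \<sigma>) * lam L (p + 1) powr e" for p
  proof -
    have "lam L (p + 1) = 2 * lam L p" by (simp add: lam_def power_int_add)
    then have "lam L p powr e = 2 powr (- e) * lam L (p + 1) powr e"
      using lam_pos[OF assms(1)] by (simp add: powr_mult powr_minus)
    also have "\<dots> \<le> 2 powr (- \<sigma>) * lam L (p + 1) powr e"
      using assms by (intro mult_right_mono powr_mono) auto
    finally show ?thesis .
  qed
  \<comment> \<open>The limit \<open>K\<close> of the geometric series is the fixed point of the
    induction step.\<close>
  have KK: "K * 2 powr (- \<sigma>) + 1 = K"
  proof -
    have "K * (1 - 2 powr (- \<sigma>)) = 1" using lt1 assms(2) by (simp add: K_def)
    then show ?thesis by (simp add: right_diff_distrib)
  qed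
  have "(\<Sum>p\<in>{-1..int m - 1}. lam L p powr e) + lam L (int m) powr e \<le> K * lam L (int m) powr e"
  proof (induction m)
    case 0
    have "lam L (- 1) powr e + lam L 0 powr e \<le> (2 powr (- \<sigma>) + 1) * lam L 0 powr e"
      using step[of "-1"] by (simp add: distrib_right)
    also have "\<dots> \<le> (K * 2 powr (- \<sigma>) + 1) * lam L 0 powr e"
      using K by (intro mult_right_mono add_right_mono) (auto simp: mult_le_cancel_right1)
    finally show ?case unfolding KK by simp
  next
    case (Suc m)
    have "{-1..int (Suc m) - 1} = insert (int m) {-1..int m - 1}" by auto
    then have "(\<Sum>p\<in>{-1..int (Suc m) - 1}. lam L p powr e) = (\<Sum>p\<in>{-1..int m - 1}. lam L p powr e) + lam L (int m) powr e"
      by (simp add: add.commute)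
    also have "\<dots> \<le> K * lam L (int m) powr e" by (rule Suc)
    also have "\<dots> \<le> K * (2 powr (- \<sigma>) * lam L (int m + 1) powr e)"
      using step[of "int m"] K by (intro mult_left_mono) auto
    finally have "(\<Sum>p\<in>{-1..int (Suc m) - 1}. lam L p powr e) + lam L (int (Suc m)) powr e
        \<le> (K * 2 powr (- \<sigma>) + 1) * lam L (int (Suc m)) powr e"
      by (simp add: distrib_right add.commute)
    then show ?case unfolding KK .
  qed
  moreover have "{-1..int m} = insert (int m) {-1..int m - 1}" by auto
  ultimately have "(\<Sum>p\<in>{-1..int m}. lam L p powr e) \<le> K * lam L (int m) powr e"
    by (simp add: add.commute)
  also have "\<dots> \<le> 3 * K * lam L (int m) powr e" using K by (intro mult_right_mono) auto
  finally show ?thesis by (simp add: K_def)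
qed

text \<open>The summand of the intermittency hypothesis, with s standing for d (1 - 2/r).\<close>

definition shell :: "(real^3 \<Rightarrow> real) \<Rightarrow> real \<Rightarrow> real \<Rightarrow> real \<Rightarrow> vfield \<Rightarrow> int \<Rightarrow> real" where
  "shell X L r s g q = lam L q powr (-1 + 6 / r + s) * (Lp_norm L r (LP X L q g))\<^sup>2"

lemma shell_nonneg: "shell X L r s g q \<ge> 0"
  by (simp add: shell_def)

lemma powr_half_sq: "(x powr (a / 2))\<^sup>2 = (x::real) powr a"
  by (simp add: power2_eq_square powr_add[symmetric])

text \<open>Squaring the failed shell condition and multiplying by \<lambda>_p^(1+s) produces the
  exponent (1 + s) + (-2 + 6/r) = -1 + 6/r + s.\<close>

lemma shell_ge:
  assumes "c > 0" "\<nu> > 0" "c * \<nu> \<le> lam L p powr (- 1 + 3 / r) * Lp_norm L r (LP X L p g)"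
  shows "lam L p powr (1 + s) * (c * \<nu>)\<^sup>2 \<le> shell X L r s g p"
proof -
  have "(c * \<nu>)\<^sup>2 \<le> (lam L p powr (- 1 + 3 / r) * Lp_norm L r (LP X L p g))\<^sup>2"
    using assms by (intro power_mono) auto
  also have "\<dots> = lam L p powr (- 2 + 6 / r) * (Lp_norm L r (LP X L p g))\<^sup>2"
  proof -
    have "(- 2 + 6 / r) / 2 = - 1 + 3 / r" by simp
    then show ?thesis using powr_half_sq[of "lam L p" "- 2 + 6 / r"] by (simp only: power_mult_distrib)
  qed
  finally have "lam L p powr (1 + s) * (c * \<nu>)\<^sup>2 \<le> lam L p powr (1 + s) * (lam L p powr (- 2 + 6 / r) * (Lp_norm L r (LP X L p g))\<^sup>2)"
    by (intro mult_left_mono) auto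
  also have "\<dots> = shell X L r s g p"
    unfolding shell_def mult.assoc[symmetric] powr_add[symmetric] by (simp add: algebra_simps)
  finally show ?thesis .
qed

lemma not_det_index:
  assumes L: "L > 0" and r: "2 < r" "r < 3" and X: "lp_cutoff X" and s: "s \<le> 3 - 6 / r"
    and c: "c > 0" "\<nu> > 0" and no: "\<not> det_index X L \<nu> r c g m"
  shows "(\<exists>p>int m. c * \<nu> \<le> lam L p powr (- 1 + 3 / r) * Lp_norm L r (LP X L p g)) \<or>
    lam L (int m) powr (1 + s) * (c * \<nu>)\<^sup>2 \<le> 1560\<^sup>2 * (3 / (1 - 2 powr (- (6 / r - 2)))) * (\<Sum>p\<in>{-1..int m}. shell X L r s g p)"
  using no unfolding det_index_def de_Morgan_conj
proof (elim disjE)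
  assume "\<not> (\<forall>p>int m. lam L p powr (- 1 + 3 / r) * Lp_norm L r (LP X L p g) < c * \<nu>)"
  then show ?thesis by (auto simp: not_less)
next
  let ?l = "lam L (int m)" and ?K = "3 / (1 - 2 powr (- (6 / r - 2)))"
  let ?S = "\<Sum>p\<in>{-1..int m}. shell X L r s g p"
  assume "\<not> lam L (int m) powr (- 1) * Linf_norm L (LP_upto X L (int m) g) < c * \<nu>"
  then have "c * \<nu> \<le> Linf_norm L (LP_upto X L (int m) g) / ?l"
    using lam_pos[OF L, of "int m"] by (simp add: powr_minus divide_inverse mult.commute)
  then have "c * \<nu> * ?l \<le> Linf_norm L (LP_upto X L (int m) g)"
    using lam_pos[OF L, of "int m"] by (simp add: pos_le_divide_eq)
  also have "\<dots> \<le> 1560 * (\<Sum>p\<in>{-1..int m}. lam L p powr (3 / r) * Lp_norm L r (LP X L p g))"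
    by (rule Linf_norm_LP_upto[OF L r(1) X])
  finally have "(c * \<nu> * ?l)\<^sup>2 \<le> (1560 * (\<Sum>p\<in>{-1..int m}. lam L p powr (3 / r) * Lp_norm L r (LP X L p g)))\<^sup>2"
    using c lam_pos[OF L, of "int m"] by (intro power_mono) auto
  also have "\<dots> = 1560\<^sup>2 * (\<Sum>p\<in>{-1..int m}. lam L p powr (3 / r) * Lp_norm L r (LP X L p g))\<^sup>2"
    by (rule power_mult_distrib)
  \<comment> \<open>The weight 3/r is split for Cauchy-Schwarz so that one factor squares to the
    shell terms and the other to \<lambda>_p^(1-s), a geometric sum.\<close>
  also have "(\<Sum>p\<in>{-1..int m}. lam L p powr (3 / r) * Lp_norm L r (LP X L p g))
      = (\<Sum>p\<in>{-1..int m}. lam L p powr ((1 - s) / 2) * (lam L p powr ((-1 + 6 / r + s) / 2) * Lp_norm L r (LP X L p g)))"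
  proof (intro sum.cong refl)
    fix p
    have "(1 - s) / 2 + (-1 + 6 / r + s) / 2 = 3 / r" by (simp add: field_simps)
    then have "lam L p powr (3 / r) = lam L p powr ((1 - s) / 2) * lam L p powr ((-1 + 6 / r + s) / 2)"
      by (metis powr_add)
    then show "lam L p powr (3 / r) * Lp_norm L r (LP X L p g) = lam L p powr ((1 - s) / 2) * (lam L p powr ((-1 + 6 / r + s) / 2) * Lp_norm L r (LP X L p g))"
      by simp
  qed
  also have "1560\<^sup>2 * (\<Sum>p\<in>{-1..int m}. lam L p powr ((1 - s) / 2) * (lam L p powr ((-1 + 6 / r + s) / 2) * Lp_norm L r (LP X L p g)))\<^sup>2
      \<le> 1560\<^sup>2 * ((\<Sum>p\<in>{-1..int m}. (lam L p powr ((1 - s) / 2))\<^sup>2) * (\<Sum>p\<in>{-1..int m}. (lam L p powr ((-1 + 6 / r + s) / 2) * Lp_norm L r (LP X L p g))\<^sup>2))"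
    by (intro mult_left_mono Cauchy_Schwarz_ineq_sum) auto
  also have "\<dots> = 1560\<^sup>2 * ((\<Sum>p\<in>{-1..int m}. lam L p powr (1 - s)) * ?S)"
    unfolding power_mult_distrib powr_half_sq shell_def by simp
  also have "\<dots> \<le> 1560\<^sup>2 * ((?K * ?l powr (1 - s)) * ?S)"
  proof (intro mult_left_mono mult_right_mono sum_lam_powr_le L sum_nonneg shell_nonneg)
    show "0 < 6 / r - 2" using r by (simp add: pos_less_divide_eq)
    show "6 / r - 2 \<le> 1 - s" using s by simp
  qed auto
  \<comment> \<open>The factor \<lambda>_m^(s-1) cancels the geometric sum on the right and turns
    \<lambda>_m^2 on the left into \<lambda>_m^(1+s).\<close>
  finally have "?l powr (s - 1) * (c * \<nu> * ?l)\<^sup>2 \<le> ?l powr (s - 1) * (1560\<^sup>2 * ((?K * ?l powr (1 - s)) * ?S))"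
    by (intro mult_left_mono) auto
  also have "\<dots> = 1560\<^sup>2 * ?K * ?S * (?l powr (s - 1) * ?l powr (1 - s))" by (simp only: mult_ac)
  also have "?l powr (s - 1) * ?l powr (1 - s) = 1"
    using lam_pos[OF L, of "int m"] by (simp add: powr_add[symmetric])
  also have "?l powr (s - 1) * (c * \<nu> * ?l)\<^sup>2 = ?l powr (s - 1) * ?l powr 2 * (c * \<nu>)\<^sup>2"
    using lam_pos[OF L, of "int m"] by (simp add: power_mult_distrib)
  also have "?l powr (s - 1) * ?l powr 2 = ?l powr (1 + s)"
    by (simp add: powr_add[symmetric] add.commute)
  finally show ?thesis by simp
qed

lemma sum_le_infsum_ennreal:
  fixes h :: "'a \<Rightarrow> ennreal"
  assumes "finite F" "F \<subseteq> A"
  shows "sum h F \<le> infsum h A"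
  by (subst nonneg_infsum_complete) (use assms in \<open>auto intro: SUP_upper2\<close>)

text \<open>The wavenumbers strictly increase. An index below n would push the infimum below
  \<lambda>_n, and if n were not an index itself the infimum would be at least
  \<lambda>_(n+1).\<close>

lemma det_wavenumber_finite:
  assumes L: "L > 0" and Q: "det_wavenumber X L \<nu> r c g = ennreal (lam L (int n))"
  shows "det_index X L \<nu> r c g n" "m < n \<Longrightarrow> \<not> det_index X L \<nu> r c g m"
proof -
  have mono: "ennreal (lam L (int i)) < ennreal (lam L (int j))" if "i < j" for i j :: nat
    using that L by (simp add: ennreal_less_iff lam_def divide_strict_right_mono)
  show nd: "\<not> det_index X L \<nu> r c g m" if "m < n" for m
  proof
    assume "det_index X L \<nu> r c g m"
    then have "det_wavenumber X L \<nu> r c g \<le> ennreal (lam L (int m))"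
      unfolding det_wavenumber_def by (intro INF_lower) simp
    then show False using mono[OF that] Q by simp
  qed
  show "det_index X L \<nu> r c g n"
  proof (rule ccontr)
    assume no: "\<not> ?thesis"
    have "ennreal (lam L (int (Suc n))) \<le> det_wavenumber X L \<nu> r c g"
      unfolding det_wavenumber_def
    proof (intro INF_greatest)
      fix q assume "q \<in> {q. det_index X L \<nu> r c g q}"
      then have "q > n" using nd[of q] no by (cases q n rule: linorder_cases) auto
      then have "Suc n = q \<or> Suc n < q" by linarith
      then show "ennreal (lam L (int (Suc n))) \<le> ennreal (lam L (int q))"
        using mono[of "Suc n" q] by auto
    qed
    then show False using mono[of n "Suc n"] Q by simp
  qed
qed

lemma powr_lam_Suc_le:
  assumes "L > 0" "s \<le> 1"
  shows "lam L (int (Suc m)) powr (1 + s) \<le> 4 * lam L (int m) powr (1 + s)"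
proof -
  have "lam L (int (Suc m)) = 2 * lam L (int m)" by (simp add: lam_def power_int_add)
  then have "lam L (int (Suc m)) powr (1 + s) = 2 powr (1 + s) * lam L (int m) powr (1 + s)"
    by (simp add: powr_mult)
  also have "\<dots> \<le> 2 powr 2 * lam L (int m) powr (1 + s)"
    using assms(2) by (intro mult_right_mono powr_mono) auto
  finally show ?thesis by simp
qed

text \<open>The bound is formulated for all n with 0 < n <= Q instead of n = Q. For finite Q this
  contains n = Q; for infinite Q it covers arbitrarily large n.\<close>

lemma lam_powr_le_sum_shell:
  assumes r: "2 < r" "r < 3" and c: "c > 0"
  obtains C where "C > 0"
    "\<And>X L s \<nu> g Q n. lp_cutoff X \<Longrightarrow> L > 0 \<Longrightarrow> 0 \<le> s \<Longrightarrow> s \<le> 3 - 6 / r \<Longrightarrow> \<nu> > 0 \<Longrightarrow>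
      det_wavenumber X L \<nu> r c g = lam_ext L Q \<Longrightarrow> 0 < n \<Longrightarrow> enat n \<le> Q \<Longrightarrow>
      ennreal (lam L (int n) powr (1 + s)) \<le> ennreal (C / \<nu>\<^sup>2) * (\<Sum>\<^sub>\<infinity>q\<in>upto_index Q. ennreal (shell X L r s g q))"
proof -
  define K where "K = 1560\<^sup>2 * (3 / (1 - (2::real) powr (- (6 / r - 2))))"
  have "0 < 6 / r - 2" using r by (simp add: pos_less_divide_eq)
  then have K: "K > 0" using powr_less_mono[of "- (6 / r - 2)" 0 "2::real"] by (simp add: K_def)
  \<comment> \<open>The factor 4 pays for passing from index n - 1 to n, and 1 + \<open>K\<close>
    covers both ways in which the condition at n - 1 can fail.\<close>
  define C where "C = 4 * (1 + K) / c\<^sup>2"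
  have C: "C > 0" using K c by (simp add: C_def)
  have main: "ennreal (lam L (int n) powr (1 + s)) \<le> ennreal (C / \<nu>\<^sup>2) * (\<Sum>\<^sub>\<infinity>q\<in>upto_index Q. ennreal (shell X L r s g q))"
    if X: "lp_cutoff X" and L: "L > 0" and s0: "0 \<le> s" and s: "s \<le> 3 - 6 / r" and \<nu>: "\<nu> > 0"
    and Q: "det_wavenumber X L \<nu> r c g = lam_ext L Q" and n: "0 < n" "enat n \<le> Q" for X L s \<nu> g Q n
  proof -
    have s1: "s \<le> 1"
    proof -
      have "2 \<le> 6 / r" using r by (simp add: pos_le_divide_eq)
      then show ?thesis using s by linarith
    qed
    have fin: "ennreal (lam L (int n) powr (1 + s)) \<le> ennreal (C / \<nu>\<^sup>2) * (\<Sum>\<^sub>\<infinity>q\<in>upto_index Q. ennreal (shell X L r s g q))"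
      if F: "finite F" "F \<subseteq> upto_index Q" and le: "lam L (int n) powr (1 + s) * (c * \<nu>)\<^sup>2 \<le> 4 * (1 + K) * (\<Sum>q\<in>F. shell X L r s g q)" for F
    proof -
      have "C / \<nu>\<^sup>2 * (\<Sum>q\<in>F. shell X L r s g q) = (4 * (1 + K) * (\<Sum>q\<in>F. shell X L r s g q)) / (c * \<nu>)\<^sup>2"
        by (simp add: C_def power_mult_distrib)
      also have "lam L (int n) powr (1 + s) \<le> \<dots>"
        using le c \<nu> by (subst pos_le_divide_eq) auto
      finally have "lam L (int n) powr (1 + s) \<le> C / \<nu>\<^sup>2 * (\<Sum>q\<in>F. shell X L r s g q)" .
      then have "ennreal (lam L (int n) powr (1 + s)) \<le> ennreal (C / \<nu>\<^sup>2 * (\<Sum>q\<in>F. shell X L r s g q))"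
        by (rule ennreal_leI)
      also have "\<dots> = ennreal (C / \<nu>\<^sup>2) * (\<Sum>q\<in>F. ennreal (shell X L r s g q))"
        using C by (subst ennreal_mult) (auto simp: sum_ennreal shell_nonneg sum_nonneg)
      also have "\<dots> \<le> ennreal (C / \<nu>\<^sup>2) * (\<Sum>\<^sub>\<infinity>q\<in>upto_index Q. ennreal (shell X L r s g q))"
        by (intro mult_left_mono sum_le_infsum_ennreal F) auto
      finally show ?thesis .
    qed
    obtain m where m: "n = Suc m" using n(1) by (cases n) auto
    have lm: "lam L (int n) powr (1 + s) * (c * \<nu>)\<^sup>2 \<le> 4 * (lam L (int m) powr (1 + s) * (c * \<nu>)\<^sup>2)"
      using powr_lam_Suc_le[OF L s1, of m] mult_right_mono[of _ _ "(c * \<nu>)\<^sup>2"] unfolding m by (simp add: mult.assoc[symmetric])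
    have nd: "\<not> det_index X L \<nu> r c g m"
    proof (cases Q)
      case (enat N)
      then show ?thesis using det_wavenumber_finite(2)[OF L, of X \<nu> r c g N m] Q n(2) m by (simp add: lam_ext_def)
    next
      case infinity
      show ?thesis
      proof
        assume "det_index X L \<nu> r c g m"
        then have "det_wavenumber X L \<nu> r c g \<le> ennreal (lam L (int m))"
          unfolding det_wavenumber_def by (intro INF_lower) simp
        then show False using Q infinity by (simp add: lam_ext_def top_unique)
      qed
    qed
    from not_det_index[OF L r X s c \<nu> nd] show ?thesis
    proof (elim disjE exE conjE)
      fix p assume p: "p > int m" "c * \<nu> \<le> lam L p powr (- 1 + 3 / r) * Lp_norm L r (LP X L p g)"
      \<comment> \<open>A violating shell p cannot lie beyond a finite Q, because the condition at Q
        bounds all shells above it.\<close>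
      have pQ: "p \<in> upto_index Q"
      proof (cases Q)
        case (enat N)
        then have "det_index X L \<nu> r c g N"
          using det_wavenumber_finite(1)[OF L, of X \<nu> r c g N] Q by (simp add: lam_ext_def)
        then have "\<not> p > int N" using p(2) unfolding det_index_def by (auto simp: not_less)
        then show ?thesis using p(1) enat by (simp add: upto_index_def)
      qed (use p(1) in \<open>simp add: upto_index_def\<close>)
      have "lam L (int n) \<le> lam L p"
        using p(1) m L unfolding lam_def by (intro divide_right_mono power_int_increasing) auto
      then have "lam L (int n) powr (1 + s) \<le> lam L p powr (1 + s)"
        using lam_pos[OF L, of "int n"] s0 by (intro powr_mono2) auto
      then have "lam L (int n) powr (1 + s) * (c * \<nu>)\<^sup>2 \<le> lam L p powr (1 + s) * (c * \<nu>)\<^sup>2"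
        by (rule mult_right_mono) simp
      also have "\<dots> \<le> shell X L r s g p" by (rule shell_ge[OF c \<nu> p(2)])
      also have "\<dots> \<le> 4 * (1 + K) * shell X L r s g p"
        using K shell_nonneg[of X L r s g p] by (simp add: mult_le_cancel_right1)
      finally show ?thesis using pQ by (intro fin[of "{p}"]) auto
    next
      assume "lam L (int m) powr (1 + s) * (c * \<nu>)\<^sup>2 \<le> 1560\<^sup>2 * (3 / (1 - 2 powr (- (6 / r - 2)))) * (\<Sum>p\<in>{-1..int m}. shell X L r s g p)"
      then have "lam L (int m) powr (1 + s) * (c * \<nu>)\<^sup>2 \<le> K * (\<Sum>p\<in>{-1..int m}. shell X L r s g p)"
        by (simp only: K_def)
      also have "\<dots> \<le> (1 + K) * (\<Sum>p\<in>{-1..int m}. shell X L r s g p)"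
        by (intro mult_right_mono sum_nonneg shell_nonneg) auto
      finally have "4 * (lam L (int m) powr (1 + s) * (c * \<nu>)\<^sup>2) \<le> 4 * ((1 + K) * (\<Sum>p\<in>{-1..int m}. shell X L r s g p))"
        by (rule mult_left_mono) simp
      then have "lam L (int n) powr (1 + s) * (c * \<nu>)\<^sup>2 \<le> 4 * (1 + K) * (\<Sum>p\<in>{-1..int m}. shell X L r s g p)"
        using order_trans[OF lm] by (simp only: mult.assoc)
      moreover have "{-1..int m} \<subseteq> upto_index Q"
        using n(2) m by (cases Q) (auto simp: upto_index_def)
      ultimately show ?thesis by (intro fin) auto
    qed
  qed
  show thesis by (rule that[OF C main])
qed

section \<open>Shell energies bounded by the dissipation\<close>

lemma Lp_norm_2_LP:
  assumes "L > 0" "lp_cutoff X" "q \<ge> -1" "lp_radius q \<le> N"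
  shows "(Lp_norm L 2 (LP X L q g))\<^sup>2 = L ^ 3 * (\<Sum>k\<in>fbox N. (lp_mult X q (freq k))\<^sup>2 * coef_sq L g k)"
proof -
  have n2: "(norm v)\<^sup>2 = (\<Sum>i\<in>UNIV. (norm (v $ i))\<^sup>2)" for v :: "complex^3"
    by (simp add: norm_vec_def L2_set_def sum_nonneg)
  have c: "continuous_on UNIV (\<lambda>x. LP X L q g x $ i)" for i
    by (intro continuous_on_component continuous_on_LP assms)
  have "(Lp_norm L 2 (LP X L q g))\<^sup>2 = (\<Sum>i\<in>UNIV. LINT x|torus L. (norm (LP X L q g x $ i))\<^sup>2)"
    unfolding Lp_norm_2 n2
    by (intro Bochner_Integration.integral_sum integrable_torus_continuous continuous_on_power continuous_on_norm c)
  also have "\<dots> = (\<Sum>i\<in>UNIV. L ^ 3 * (\<Sum>k\<in>fbox (lp_radius q). (norm (fcoef L (\<lambda>x. g x $ i) k * of_real (lp_mult X q (freq k))))\<^sup>2))"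
    unfolding LP_nth[OF assms(2,3)] by (intro sum.cong refl integral_norm_trig assms) simp
  also have "\<dots> = L ^ 3 * (\<Sum>k\<in>fbox (lp_radius q). (lp_mult X q (freq k))\<^sup>2 * coef_sq L g k)"
    unfolding sum_distrib_left coef_sq_def
    by (subst sum.swap) (simp add: norm_mult power_mult_distrib mult_ac)
  also have "(\<Sum>k\<in>fbox (lp_radius q). (lp_mult X q (freq k))\<^sup>2 * coef_sq L g k) = (\<Sum>k\<in>fbox N. (lp_mult X q (freq k))\<^sup>2 * coef_sq L g k)"
    using fbox_mono[OF assms(4)] lp_mult_eq_0[OF assms(2,3)] by (intro sum.mono_neutral_left) auto
  finally show ?thesis .
qed

text \<open>The cutoff is continuous and supported in the unit ball, so it has some upper bound,
  which depends on the fixed cutoff alone.\<close>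

lemma lp_cutoff_bounded:
  assumes "lp_cutoff X"
  obtains M where "M > 0" "\<And>q \<xi>. \<bar>lp_mult X q \<xi>\<bar> \<le> M"
proof -
  have "Ck_on 0 UNIV X" using assms unfolding lp_cutoff_def smooth_on_def by blast
  then have "continuous_on (cball 0 1) X" by (auto intro: continuous_on_subset)
  then have "bounded (X ` cball 0 1)" by (intro compact_imp_bounded compact_continuous_image compact_cball)
  then obtain B where "\<forall>y\<in>X ` cball 0 1. norm y \<le> B" unfolding bounded_iff by blast
  then have B: "\<And>\<xi>. \<xi> \<in> cball 0 1 \<Longrightarrow> \<bar>X \<xi>\<bar> \<le> B" by (metis imageI real_norm_def)
  have X0: "\<And>\<xi>. norm \<xi> \<ge> 1 \<Longrightarrow> X \<xi> = 0" and Xp: "\<And>\<xi>. 0 \<le> X \<xi>" using assms unfolding lp_cutoff_def by blast+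
  have B': "X \<xi> \<le> \<bar>B\<bar> + 1" for \<xi>
  proof (cases "norm \<xi> \<le> 1")
    case True
    then show ?thesis using B[of \<xi>] by (simp add: mem_cball)
  qed (simp add: X0)
  have "\<bar>lp_mult X q \<xi>\<bar> \<le> \<bar>B\<bar> + 1" for q \<xi>
    unfolding lp_mult_def lp_phi_def using B' Xp by (smt (verit))
  then show thesis by (intro that[of "\<bar>B\<bar> + 1"]) auto
qed

lemma sum_power4_le: "(\<Sum>j\<le>n. (4::real) ^ j) \<le> 4 / 3 * 4 ^ n"
  by (induction n) auto

text \<open>The exponents are distinct, so the sum is part of a geometric series of ratio 4 ending
  at the largest exponent; the series is at most 4/3 of its last term.\<close>

lemma sum_powi_le:
  fixes B :: real
  assumes "finite F" "\<And>q. q \<in> F \<Longrightarrow> 0 \<le> q \<and> 2 powi q \<le> B"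
  shows "(\<Sum>q\<in>F. (2 powi q)\<^sup>2) \<le> 4 / 3 * B\<^sup>2"
proof (cases "F = {}")
  case False
  define n where "n = nat (Max F)"
  have MF: "Max F \<in> F" using assms(1) False by (rule Max_in)
  then have M0: "0 \<le> Max F" and MB: "2 powi (Max F) \<le> B" using assms(2) by auto
  have "F \<subseteq> int ` {..n}"
  proof
    fix q assume q: "q \<in> F"
    then have "0 \<le> q" "q \<le> Max F" using assms by auto
    then show "q \<in> int ` {..n}" unfolding n_def by (intro image_eqI[of _ _ "nat q"]) auto
  qed
  then have "(\<Sum>q\<in>F. ((2::real) powi q)\<^sup>2) \<le> (\<Sum>q\<in>int ` {..n}. (2 powi q)\<^sup>2)"
    by (intro sum_mono2) auto
  also have "\<dots> = (\<Sum>j\<le>n. 4 ^ j)"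
    by (subst sum.reindex) (auto simp: power_mult_distrib[symmetric] power_even_eq[symmetric] power_mult[symmetric] mult.commute power2_eq_square intro!: sum.cong)
  also have "\<dots> \<le> 4 / 3 * 4 ^ n" by (rule sum_power4_le)
  also have "(4::real) ^ n = (2 powi (Max F))\<^sup>2"
    using M0 by (simp add: n_def power_int_def power2_eq_square power_mult_distrib[symmetric])
  also have "4 / 3 * (2 powi (Max F))\<^sup>2 \<le> 4 / 3 * B\<^sup>2"
    using MB by (intro mult_left_mono power_mono) auto
  finally show ?thesis .
qed simp

text \<open>The sums over shells and frequencies are exchanged. A frequency k \<noteq> 0 meets only
  shells with q >= 0 and 2^q <= (4/3)|k|; the shell q = -1 sees only k = 0, which zero mean
  removes.\<close>

lemma sum_LP_le_grad:
  assumes "lp_cutoff X"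
  obtains C where "C > 0"
    "\<And>L g F. L > 0 \<Longrightarrow> in_H1 L g \<Longrightarrow> zero_mean L g \<Longrightarrow> finite F \<Longrightarrow> F \<subseteq> {-1..} \<Longrightarrow>
      (\<Sum>q\<in>F. (lam L q)\<^sup>2 * (Lp_norm L 2 (LP X L q g))\<^sup>2) \<le> C * (grad_norm L g)\<^sup>2"
proof -
  obtain M where M: "M > 0" "\<And>q \<xi>. \<bar>lp_mult X q \<xi>\<bar> \<le> M" using lp_cutoff_bounded[OF assms] by blast
  \<comment> \<open>M^2 bounds the squared multipliers, 4/3 is the geometric series, and (4/3)^2
    comes from the inner edge 3/4 of the shells.\<close>
  define C where "C = M\<^sup>2 * (4 / 3) * (4 / 3)\<^sup>2"
  have C: "C > 0" using M by (simp add: C_def)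
  have main: "(\<Sum>q\<in>F. (lam L q)\<^sup>2 * (Lp_norm L 2 (LP X L q g))\<^sup>2) \<le> C * (grad_norm L g)\<^sup>2"
    if L: "L > 0" and g: "in_H1 L g" "zero_mean L g" and F: "finite F" "F \<subseteq> {-1..}" for L g F
  proof -
    have g2: "in_L2 L g" using g(1) by (simp add: in_H1_def)
    obtain N where N: "\<And>q. q \<in> F \<Longrightarrow> lp_radius q \<le> N"
      using F(1) by (metis Max_ge finite_imageI imageI)
    have point: "(\<Sum>q\<in>F. (2 powi q)\<^sup>2 * (lp_mult X q (freq k))\<^sup>2) \<le> C * (norm (freq k))\<^sup>2" if "k \<noteq> 0" for k
    proof -
      define F' where "F' = {q \<in> F. lp_mult X q (freq k) \<noteq> 0}"
      have F': "0 \<le> q \<and> 2 powi q \<le> 4 / 3 * norm (freq k)" if "q \<in> F'" for q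
      proof -
        have q: "-1 \<le> q" "lp_mult X q (freq k) \<noteq> 0" using that F by (auto simp: F'_def)
        have "q \<noteq> -1"
        proof
          assume "q = -1"
          then have "norm (freq k) < 1" using lp_mult_support(1)[OF assms q] by (simp add: power_int_minus)
          then show False using freq_norm_ge_1[OF \<open>k \<noteq> 0\<close>] by simp
        qed
        then have "0 \<le> q" using q by simp
        then show ?thesis using lp_mult_support(2)[OF assms q] by simp
      qed
      have "(\<Sum>q\<in>F. (2 powi q)\<^sup>2 * (lp_mult X q (freq k))\<^sup>2) = (\<Sum>q\<in>F'. (2 powi q)\<^sup>2 * (lp_mult X q (freq k))\<^sup>2)"
        unfolding F'_def using F(1) by (intro sum.mono_neutral_right) auto
      also have "\<dots> \<le> (\<Sum>q\<in>F'. (2 powi q)\<^sup>2 * M\<^sup>2)"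
        using M by (intro sum_mono mult_left_mono) (auto simp: abs_le_square_iff[symmetric])
      also have "\<dots> = M\<^sup>2 * (\<Sum>q\<in>F'. (2 powi q)\<^sup>2)" by (simp add: sum_distrib_left mult.commute)
      also have "\<dots> \<le> M\<^sup>2 * (4 / 3 * (4 / 3 * norm (freq k))\<^sup>2)"
        by (intro mult_left_mono sum_powi_le F') (auto simp: F'_def F)
      also have "\<dots> = C * (norm (freq k))\<^sup>2" by (simp add: C_def power2_eq_square)
      finally show ?thesis .
    qed
    have lamq: "(lam L q)\<^sup>2 = (2 powi q)\<^sup>2 / L\<^sup>2" for q by (simp add: lam_def power_divide)
    have "(\<Sum>q\<in>F. (lam L q)\<^sup>2 * (Lp_norm L 2 (LP X L q g))\<^sup>2)
      = (\<Sum>q\<in>F. (lam L q)\<^sup>2 * (L ^ 3 * (\<Sum>k\<in>fbox N. (lp_mult X q (freq k))\<^sup>2 * coef_sq L g k)))"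
      using F(2) N by (intro sum.cong refl arg_cong2[where f = "(*)"] Lp_norm_2_LP L assms) auto
    also have "\<dots> = L ^ 3 * (\<Sum>k\<in>fbox N. (\<Sum>q\<in>F. (2 powi q)\<^sup>2 * (lp_mult X q (freq k))\<^sup>2) / L\<^sup>2 * coef_sq L g k)"
      unfolding lamq sum_distrib_left sum_distrib_right sum_divide_distrib
      by (subst sum.swap) (simp add: mult_ac)
    also have "\<dots> \<le> L ^ 3 * (\<Sum>k\<in>fbox N. C * ((norm (kvec L k))\<^sup>2 * coef_sq L g k))"
    proof (intro mult_left_mono sum_mono)
      fix k
      show "(\<Sum>q\<in>F. (2 powi q)\<^sup>2 * (lp_mult X q (freq k))\<^sup>2) / L\<^sup>2 * coef_sq L g k \<le> C * ((norm (kvec L k))\<^sup>2 * coef_sq L g k)"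
      proof (cases "k = 0")
        case True
        then have "coef_sq L g k = 0" using g zero_mean_iff[OF L g2] by (simp add: coef_sq_def)
        then show ?thesis by simp
      next
        case False
        have "(\<Sum>q\<in>F. (2 powi q)\<^sup>2 * (lp_mult X q (freq k))\<^sup>2) / L\<^sup>2 \<le> C * (norm (freq k))\<^sup>2 / L\<^sup>2"
          by (intro divide_right_mono point False) simp
        also have "\<dots> \<le> (2 * pi)\<^sup>2 * (C * (norm (freq k))\<^sup>2 / L\<^sup>2)"
        proof -
          have "1 \<le> (2 * pi)\<^sup>2" using pi_ge_two by (intro one_le_power) linarith
          moreover have "0 \<le> C * (norm (freq k))\<^sup>2 / L\<^sup>2" using C by simp
          ultimately show ?thesis using mult_right_mono[of 1 "(2 * pi)\<^sup>2" "C * (norm (freq k))\<^sup>2 / L\<^sup>2"]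
            by (simp only: mult_1_left)
        qed
        also have "\<dots> = C * (norm (kvec L k))\<^sup>2"
          using L by (simp add: power_mult_distrib power_divide)
        finally show ?thesis
          unfolding mult.assoc[symmetric] by (rule mult_right_mono[OF _ coef_sq_nonneg])
      qed
    qed (use L in auto)
    also have "\<dots> = C * grad_trunc L g N"
      by (simp add: grad_trunc_def sum_distrib_left mult_ac)
    also have "\<dots> \<le> C * (grad_norm L g)\<^sup>2"
      using C by (intro mult_left_mono grad_trunc_le L g) auto
    finally show ?thesis .
  qed
  show thesis by (rule that[OF C main])
qed

text \<open>The integrals of the theorem are taken of functions whose measurability is not known;
  for those \<open>nn_integral\<close> is a lower integral, which is in general not subadditive. Splitting off
  a constant is harmless.\<close>

lemma nn_integral_affine_le:
  fixes S h :: "'a \<Rightarrow> ennreal"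
  assumes k: "0 < k" and h: "\<And>x. x \<in> space M \<Longrightarrow> h x \<le> ennreal a + ennreal k * S x"
  shows "(\<integral>\<^sup>+x. h x \<partial>M) \<le> ennreal a * emeasure M (space M) + ennreal k * (\<integral>\<^sup>+x. S x \<partial>M)"
  unfolding nn_integral_def[of M h]
proof (rule SUP_least)
  fix \<phi> assume "\<phi> \<in> {g. simple_function M g \<and> g \<le> h}"
  then have \<phi>: "simple_function M \<phi>" "\<And>x. \<phi> x \<le> h x" by (auto simp: le_fun_def)
  have [measurable]: "\<phi> \<in> borel_measurable M" using \<phi>(1) by (rule borel_measurable_simple_function)
  \<comment> \<open>Unlike \<open>S\<close>, this function is known to be measurable. It lies below
    \<open>S\<close>, and additivity of the integral is applied to it alone.\<close>
  define \<psi> where "\<psi> x = (\<phi> x - ennreal a) / ennreal k" for x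
  have [measurable]: "\<psi> \<in> borel_measurable M" unfolding \<psi>_def [abs_def] by measurable
  have k': "ennreal k \<noteq> 0" "ennreal k \<noteq> top" using k by auto
  have kp: "ennreal k * \<psi> x = \<phi> x - ennreal a" for x
    unfolding \<psi>_def using k' by (simp add: ennreal_times_divide mult.commute[of "ennreal k"] mult_divide_eq_ennreal)
  have "integral\<^sup>S M \<phi> = (\<integral>\<^sup>+x. \<phi> x \<partial>M)" using \<phi>(1) by (rule nn_integral_eq_simple_integral[symmetric])
  also have "\<dots> \<le> (\<integral>\<^sup>+x. ennreal a + ennreal k * \<psi> x \<partial>M)"
    unfolding kp by (intro nn_integral_mono ennreal_minus_le_iff[THEN iffD1, THEN conjunct1] order_refl)
  also have "\<dots> = ennreal a * emeasure M (space M) + ennreal k * (\<integral>\<^sup>+x. \<psi> x \<partial>M)"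
    by (subst nn_integral_add) (auto simp: nn_integral_cmult)
  also have "\<dots> \<le> ennreal a * emeasure M (space M) + ennreal k * (\<integral>\<^sup>+x. S x \<partial>M)"
  proof (intro add_left_mono mult_left_mono nn_integral_mono)
    fix x assume x: "x \<in> space M"
    have "\<phi> x \<le> ennreal a + ennreal k * S x" using \<phi>(2)[of x] h[OF x] by (rule order_trans)
    then have "\<phi> x - ennreal a \<le> ennreal k * S x" by (simp add: ennreal_minus_le_iff)
    then have "\<psi> x \<le> (ennreal k * S x) / ennreal k" unfolding \<psi>_def by (rule divide_right_mono_ennreal)
    then show "\<psi> x \<le> S x" using k' by (simp add: mult.commute[of "ennreal k"] mult_divide_eq_ennreal)
  qed simp
  finally show "integral\<^sup>S M \<phi> \<le> ennreal a * emeasure M (space M) + ennreal k * (\<integral>\<^sup>+x. S x \<partial>M)" .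
qed

lemma lam_ext_le:
  assumes L: "L > 0" and s: "0 \<le> s" and A: "A > 0" and C: "C > 0"
    and le: "\<And>n. 0 < n \<Longrightarrow> enat n \<le> Q \<Longrightarrow> ennreal (lam L (int n) powr (1 + s)) \<le> ennreal C * S"
  shows "lam_ext L Q \<le> ennreal (lam L 0 + A) + ennreal (A powr (- s) * C) * S"
proof -
  have 1: "ennreal (lam L (int n)) \<le> ennreal A + ennreal (A powr (- s) * C) * S" if n: "0 < n" "enat n \<le> Q" for n
  proof -
    let ?l = "lam L (int n)"
    have lp: "?l > 0" by (rule lam_pos[OF L])
    have "?l \<le> A + A powr (1 - (1 + s)) * ?l powr (1 + s)"
      using s lp by (intro le_cutoff_powr A) auto
    then have "ennreal ?l \<le> ennreal (A + A powr (- s) * ?l powr (1 + s))" by (intro ennreal_leI) simp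
    also have "\<dots> = ennreal A + ennreal (A powr (- s)) * ennreal (?l powr (1 + s))"
      using A by (simp add: ennreal_plus ennreal_mult)
    also have "\<dots> \<le> ennreal A + ennreal (A powr (- s)) * (ennreal C * S)"
      by (intro add_left_mono mult_left_mono le n) auto
    also have "\<dots> = ennreal A + ennreal (A powr (- s) * C) * S"
      using C by (simp add: ennreal_mult mult.assoc)
    finally show ?thesis .
  qed
  have l0: "ennreal (lam L 0 + A) = ennreal (lam L 0) + ennreal A"
    using lam_pos[OF L, of 0] A by (intro ennreal_plus) auto
  show ?thesis
  proof (cases Q)
    case (enat n)
    show ?thesis
    \<comment> \<open>For Q = 0 nothing is known about the shells, and the summand \<lambda>_0 is
      the whole bound.\<close>
    proof (cases "n = 0")
      case True
      then show ?thesis unfolding l0 enat lam_ext_def by (simp add: add.assoc)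
    next
      case False
      then have "ennreal (lam L (int n)) \<le> ennreal A + ennreal (A powr (- s) * C) * S" using 1[of n] enat by simp
      also have "\<dots> \<le> ennreal (lam L 0 + A) + ennreal (A powr (- s) * C) * S"
        unfolding l0 by (simp add: add.assoc add_increasing)
      finally show ?thesis by (simp add: enat lam_ext_def)
    qed
  next
    case infinity
    \<comment> \<open>For infinite Q the estimate holds for every positive n, so its right-hand side
      exceeds every real number.\<close>
    have "ennreal A + ennreal (A powr (- s) * C) * S = top"
    proof (rule ccontr)
      assume "\<not> ?thesis"
      then obtain y where y: "ennreal A + ennreal (A powr (- s) * C) * S = ennreal y" "y \<ge> 0"
        by (cases "ennreal A + ennreal (A powr (- s) * C) * S") auto
      obtain n where n: "y * L + 1 < real n" using reals_Archimedean2 by blast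
      have "y * L + 1 < 2 ^ n" using n of_nat_less_two_power[of n] by (simp add: less_trans)
      then have "y < lam L (int n)" using L by (simp add: lam_def pos_less_divide_eq)
      moreover have "0 < n"
      proof (rule Nat.gr0I)
        assume "n = 0"
        moreover have "0 \<le> y * L" using y(2) L by simp
        ultimately show False using n by simp
      qed
      ultimately show False using 1[of n] y by (simp add: infinity ennreal_le_iff)
    qed
    then have "ennreal (lam L 0 + A) + ennreal (A powr (- s) * C) * S = top"
      unfolding l0 by (simp add: add.assoc)
    then show ?thesis by simp
  qed
qed

section \<open>The averaged determining wavenumber\<close>

text \<open>At almost every time the field is in \<open>in_H1\<close> and its shell sum is at most a
  multiple of the dissipation. The constant is pulled out of the integral of the dissipation only,
  which is measurable.\<close>

lemma (in attractor_trajectory) time_avg_LP_le: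
  assumes C: "C > 0" and T: "T > 0"
    and le: "\<And>g J. in_H1 L g \<Longrightarrow> zero_mean L g \<Longrightarrow> finite J \<Longrightarrow> J \<subseteq> {-1..} \<Longrightarrow>
      (\<Sum>q\<in>J. (lam L q)\<^sup>2 * (Lp_norm L 2 (LP X L q g))\<^sup>2) \<le> C * (grad_norm L g)\<^sup>2"
  shows "time_avg t0 T (\<lambda>\<tau>. \<Sum>\<^sub>\<infinity>q\<in>upto_index (Q \<tau>). ennreal ((lam L q)\<^sup>2 * (Lp_norm L 2 (LP X L q (u \<tau>)))\<^sup>2))
    \<le> ennreal (8 * C * \<nu>\<^sup>2 * \<kappa> * ((Grashof L \<nu> f)\<^sup>2 / (\<nu> * T * \<kappa>\<^sup>2) + (Grashof L \<nu> f)\<^sup>2))"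
proof -
  let ?S = "\<lambda>\<tau>. \<Sum>\<^sub>\<infinity>q\<in>upto_index (Q \<tau>). ennreal ((lam L q)\<^sup>2 * (Lp_norm L 2 (LP X L q (u \<tau>)))\<^sup>2)"
  have "AE \<tau> in lebesgue_on {t0..t0 + T}. ?S \<tau> \<le> ennreal C * ennreal (dissip \<tau>)"
  proof (rule AE_lebesgue_onI[OF eventually_mono[OF AE_in_H1]])
    fix \<tau> assume H: "in_H1 L (u \<tau>)"
    show "?S \<tau> \<le> ennreal C * ennreal (dissip \<tau>)"
      unfolding ennreal_mult[OF less_imp_le[OF C] dissip_nonneg, symmetric]
    proof (rule infsum_le_finite_sums)
      fix J assume J: "finite J" "J \<subseteq> upto_index (Q \<tau>)"
      have "J \<subseteq> {-1..}" using J(2) by (cases "Q \<tau>") (auto simp: upto_index_def)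
      from le[OF H zero_mean J(1) this]
      show "(\<Sum>q\<in>J. ennreal ((lam L q)\<^sup>2 * (Lp_norm L 2 (LP X L q (u \<tau>)))\<^sup>2)) \<le> ennreal (C * dissip \<tau>)"
        by (subst sum_ennreal) (auto simp: dissip_def intro: ennreal_leI)
    qed (rule nonneg_summable_on_complete, simp)
  qed simp
  then have "(\<integral>\<^sup>+\<tau>. ?S \<tau> \<partial>lebesgue_on {t0..t0 + T}) \<le> (\<integral>\<^sup>+\<tau>. ennreal C * ennreal (dissip \<tau>) \<partial>lebesgue_on {t0..t0 + T})"
    by (rule nn_integral_mono_AE)
  also have "\<dots> = ennreal C * (\<integral>\<^sup>+\<tau>. ennreal (dissip \<tau>) \<partial>lebesgue_on {t0..t0 + T})"
    by (intro nn_integral_cmult measurable_compose[OF measurable_on_dissip measurable_ennreal]) simp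
  also have "\<dots> \<le> ennreal C * ennreal (8 * (F\<^sup>2 / (\<nu> ^ 3 * \<kappa>\<^sup>2) + F\<^sup>2 / \<nu>\<^sup>2 * T))"
    by (intro mult_left_mono nn_dissip_le T) simp
  also have "\<dots> = ennreal (C * (8 * (F\<^sup>2 / (\<nu> ^ 3 * \<kappa>\<^sup>2) + F\<^sup>2 / \<nu>\<^sup>2 * T)))"
    using C \<nu> T by (intro ennreal_mult[symmetric]) auto
  finally have "time_avg t0 T ?S \<le> ennreal (C * (8 * (F\<^sup>2 / (\<nu> ^ 3 * \<kappa>\<^sup>2) + F\<^sup>2 / \<nu>\<^sup>2 * T))) / ennreal T"
    unfolding time_avg_def by (rule divide_right_mono_ennreal)
  also have "\<dots> = ennreal (C * (8 * (F\<^sup>2 / (\<nu> ^ 3 * \<kappa>\<^sup>2) + F\<^sup>2 / \<nu>\<^sup>2 * T)) / T)"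
    using C \<nu> T by (intro divide_ennreal) auto
  also have "C * (8 * (F\<^sup>2 / (\<nu> ^ 3 * \<kappa>\<^sup>2) + F\<^sup>2 / \<nu>\<^sup>2 * T)) / T
    = 8 * C * \<nu>\<^sup>2 * \<kappa> * ((Grashof L \<nu> f)\<^sup>2 / (\<nu> * T * \<kappa>\<^sup>2) + (Grashof L \<nu> f)\<^sup>2)"
  proof -
    \<comment> \<open>The exponent 1/2 of \<kappa> in the Grashof number becomes 1 on squaring,
      which leaves the common factor \<nu>^2 \<kappa>.\<close>
    have "(Grashof L \<nu> f)\<^sup>2 = F\<^sup>2 / (\<nu> ^ 4 * \<kappa>)"
      using \<kappa>_pos by (simp add: Grashof_def F_def \<kappa>_def[symmetric] power_divide power_mult_distrib powr_half_sqrt)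
    then show ?thesis using T \<nu> \<kappa>_pos
      by (simp add: field_simps) (simp add: eval_nat_numeral field_simps)
  qed
  finally show ?thesis .
qed

text \<open>At A = k H^(1/(1+s)) the two terms are A and C A. If H = 0 this height is not
  admissible, and A tends to zero instead.\<close>

lemma minimize_powr:
  fixes a :: ennreal
  assumes s: "0 \<le> s" and H: "0 \<le> H" and k: "k > 0" and C: "C > 0"
    and le: "\<And>A. A > 0 \<Longrightarrow> a \<le> ennreal (A + A powr (- s) * (C * k powr (1 + s) * H))"
  shows "a \<le> ennreal ((1 + C) * k * H powr (1 / (1 + s)))"
proof (cases "H = 0")
  case True
  have "a \<le> 0"
  proof (rule ennreal_le_epsilon)
    show "a \<le> 0 + ennreal e" if "e > 0" for e using le[OF that] True by simp
  qed
  then show ?thesis by simp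
next
  case False
  then have H: "H > 0" using assms(2) by simp
  define A where "A = k * H powr (1 / (1 + s))"
  have A: "A > 0" using H k by (simp add: A_def)
  have "A powr (1 + s) = k powr (1 + s) * H"
    using H k s by (simp add: A_def powr_mult powr_powr)
  then have "A powr (- s) * (C * k powr (1 + s) * H) = C * (A powr (- s) * A powr (1 + s))" by simp
  also have "A powr (- s) * A powr (1 + s) = A" using A by (simp add: powr_add[symmetric])
  finally have "A + A powr (- s) * (C * k powr (1 + s) * H) = (1 + C) * k * H powr (1 / (1 + s))"
    by (simp add: A_def distrib_right mult.assoc)
  then show ?thesis using le[OF A] by simp
qed

lemma time_avg_affine_le:
  assumes T: "T > 0" and a: "a \<ge> 0" and k: "k > 0"
    and h: "\<And>\<tau>. h \<tau> \<le> ennreal a + ennreal k * S \<tau>"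
  shows "time_avg t0 T h \<le> ennreal a + ennreal k * time_avg t0 T S"
proof -
  have "emeasure (lebesgue_on {t0..t0 + T}) (space (lebesgue_on {t0..t0 + T})) = ennreal T"
    using T by (simp add: emeasure_restrict_space)
  then have "(\<integral>\<^sup>+\<tau>. h \<tau> \<partial>lebesgue_on {t0..t0 + T}) \<le> ennreal a * ennreal T + ennreal k * (\<integral>\<^sup>+\<tau>. S \<tau> \<partial>lebesgue_on {t0..t0 + T})"
    using nn_integral_affine_le[OF k, of "lebesgue_on {t0..t0 + T}" h a S] h by simp
  then have "time_avg t0 T h \<le> (ennreal a * ennreal T + ennreal k * (\<integral>\<^sup>+\<tau>. S \<tau> \<partial>lebesgue_on {t0..t0 + T})) / ennreal T"
    unfolding time_avg_def by (rule divide_right_mono_ennreal)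
  also have "\<dots> = ennreal a + ennreal k * time_avg t0 T S"
    using T unfolding time_avg_def
    by (simp add: add_divide_distrib_ennreal ennreal_times_divide mult_divide_eq_ennreal)
  finally show ?thesis .
qed

text \<open>The averages take values in \<open>ennreal\<close> because the wavenumber may be
  infinite. Subtracting \<lambda>_0 from an infinite average gives \<infinity>, so the finite bounds
  also assert that the average is finite.\<close>

theorem mainTheorem6:
  fixes r c C0 :: real and X :: "real^3 \<Rightarrow> real"
  assumes "2 < r" "r < 3" "c > 0" "C0 > 0" and "lp_cutoff X"
  shows "\<exists>C>0. \<forall>(L::real) (\<nu>::real) (T::real) f u (t0::real) (Q :: real \<Rightarrow> enat) (d::real).
    L > 0 \<longrightarrow> \<nu> > 0 \<longrightarrow> T > 0 \<longrightarrow>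
    Hm1_zero_mean L f \<longrightarrow>
    complete_bounded_Leray_Hopf L \<nu> f u \<longrightarrow>
    (\<forall>\<tau>. det_wavenumber X L \<nu> r c (u \<tau>) = lam_ext L (Q \<tau>)) \<longrightarrow>
    0 \<le> d \<longrightarrow> d \<le> 3 \<longrightarrow>
    time_avg t0 T (\<lambda>\<tau>. \<Sum>\<^sub>\<infinity>q\<in>upto_index (Q \<tau>).
        ennreal (lam L q powr (-1 + 6 / r + d * (1 - 2 / r)) * (Lp_norm L r (LP X L q (u \<tau>)))\<^sup>2))
      \<le> ennreal (C0 * lam L 0 powr (d * (1 - 2 / r))) *
        time_avg t0 T (\<lambda>\<tau>. \<Sum>\<^sub>\<infinity>q\<in>upto_index (Q \<tau>).
          ennreal ((lam L q)\<^sup>2 * (Lp_norm L 2 (LP X L q (u \<tau>)))\<^sup>2)) \<longrightarrow>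
    (let G = Grashof L \<nu> f; \<kappa> = 2 * pi / L;
         lhs = time_avg t0 T (\<lambda>\<tau>. det_wavenumber X L \<nu> r c (u \<tau>)) - ennreal (lam L 0)
     in lhs \<le> ennreal (C * \<kappa> * (G\<^sup>2 / (\<nu> * T * \<kappa>\<^sup>2) + G\<^sup>2) powr (1 / (1 + d * (1 - 2 / r)))) \<and>
        (d = 0 \<longrightarrow> lhs \<le> ennreal (C * (G\<^sup>2 / (\<nu> * T * \<kappa>) + \<kappa> * G\<^sup>2))) \<and>
        (d = 3 \<longrightarrow> lhs \<le> ennreal (C * \<kappa> *
            (G\<^sup>2 / (\<nu> * T * \<kappa>\<^sup>2) + G\<^sup>2) powr (1 / 2 + (3 - r) / (4 * r - 6)))))"
proof -
  obtain C1 where C1: "C1 > 0"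
    "\<And>X L s \<nu> g Q n. lp_cutoff X \<Longrightarrow> L > 0 \<Longrightarrow> 0 \<le> s \<Longrightarrow> s \<le> 3 - 6 / r \<Longrightarrow> \<nu> > 0 \<Longrightarrow>
      det_wavenumber X L \<nu> r c g = lam_ext L Q \<Longrightarrow> 0 < n \<Longrightarrow> enat n \<le> Q \<Longrightarrow>
      ennreal (lam L (int n) powr (1 + s)) \<le> ennreal (C1 / \<nu>\<^sup>2) * (\<Sum>\<^sub>\<infinity>q\<in>upto_index Q. ennreal (shell X L r s g q))"
    using lam_powr_le_sum_shell[OF assms(1-3)] by blast
  obtain C2 where C2: "C2 > 0"
    "\<And>L g F. L > 0 \<Longrightarrow> in_H1 L g \<Longrightarrow> zero_mean L g \<Longrightarrow> finite F \<Longrightarrow> F \<subseteq> {-1..} \<Longrightarrow>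
      (\<Sum>q\<in>F. (lam L q)\<^sup>2 * (Lp_norm L 2 (LP X L q g))\<^sup>2) \<le> C2 * (grad_norm L g)\<^sup>2"
    using sum_LP_le_grad[OF assms(5)] by blast
  define C3 where "C3 = C1 * C0 * (8 * C2)"
  have C3: "C3 > 0" using C1 C2 assms(4) by (simp add: C3_def)
  show ?thesis
  proof (intro exI[of _ "1 + C3"] conjI allI impI)
    fix L \<nu> T :: real and f u t0 and Q :: "real \<Rightarrow> enat" and d :: real
    assume L: "L > 0" and \<nu>: "\<nu> > 0" and T: "T > 0" and f: "Hm1_zero_mean L f"
      and u: "complete_bounded_Leray_Hopf L \<nu> f u"
      and Q: "\<forall>\<tau>. det_wavenumber X L \<nu> r c (u \<tau>) = lam_ext L (Q \<tau>)"
      and d: "0 \<le> d" "d \<le> 3"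
    define s where "s = d * (1 - 2 / r)"
    define \<kappa> where "\<kappa> = 2 * pi / L"
    define G where "G = Grashof L \<nu> f"
    define H where "H = G\<^sup>2 / (\<nu> * T * \<kappa>\<^sup>2) + G\<^sup>2"
    define lhs where "lhs = time_avg t0 T (\<lambda>\<tau>. det_wavenumber X L \<nu> r c (u \<tau>)) - ennreal (lam L 0)"
    let ?S = "\<lambda>\<tau>. \<Sum>\<^sub>\<infinity>q\<in>upto_index (Q \<tau>). ennreal (shell X L r s (u \<tau>) q)"
    let ?S2 = "\<lambda>\<tau>. \<Sum>\<^sub>\<infinity>q\<in>upto_index (Q \<tau>). ennreal ((lam L q)\<^sup>2 * (Lp_norm L 2 (LP X L q (u \<tau>)))\<^sup>2)"
    assume "time_avg t0 T (\<lambda>\<tau>. \<Sum>\<^sub>\<infinity>q\<in>upto_index (Q \<tau>).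
        ennreal (lam L q powr (-1 + 6 / r + d * (1 - 2 / r)) * (Lp_norm L r (LP X L q (u \<tau>)))\<^sup>2))
      \<le> ennreal (C0 * lam L 0 powr (d * (1 - 2 / r))) * time_avg t0 T ?S2"
    then have hyp: "time_avg t0 T ?S \<le> ennreal (C0 * lam L 0 powr s) * time_avg t0 T ?S2"
      unfolding shell_def s_def .
    interpret tr: attractor_trajectory L \<nu> f u by unfold_locales (fact L \<nu> f u)+
    have \<kappa>: "\<kappa> > 0" using L by (simp add: \<kappa>_def)
    have H0: "H \<ge> 0" unfolding H_def using \<nu> T by simp
    have r2: "0 \<le> 1 - 2 / r" using assms(1) by simp
    have s: "0 \<le> s" "s \<le> 3 - 6 / r"
      using mult_nonneg_nonneg[OF d(1) r2] mult_right_mono[OF d(2) r2] by (simp_all add: s_def right_diff_distrib)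
    have S2: "time_avg t0 T ?S2 \<le> ennreal (8 * C2 * \<nu>\<^sup>2 * \<kappa> * H)"
      unfolding H_def G_def \<kappa>_def by (rule tr.time_avg_LP_le[OF C2(1) T C2(2)[OF L], unfolded tr.\<kappa>_def])
    \<comment> \<open>The \<nu>^2 in the dissipation bound cancels the one in the shell estimate, so
      that only H, \<kappa> and constants remain.\<close>
    have bound: "lhs \<le> ennreal (A + A powr (- s) * (C3 * \<kappa> powr (1 + s) * H))" if A: "A > 0" for A
    proof -
      have k: "0 < A powr (- s) * (C1 / \<nu>\<^sup>2)" using A C1(1) \<nu> by simp
      have "det_wavenumber X L \<nu> r c (u \<tau>) \<le> ennreal (lam L 0 + A) + ennreal (A powr (- s) * (C1 / \<nu>\<^sup>2)) * ?S \<tau>" for \<tau>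
      proof -
        have Qt: "det_wavenumber X L \<nu> r c (u \<tau>) = lam_ext L (Q \<tau>)" using Q by blast
        show ?thesis unfolding Qt
          by (rule lam_ext_le[OF L s(1) A]) (use C1(1) \<nu> in simp, rule C1(2)[OF assms(5) L s \<nu> Qt])
      qed
      then have "time_avg t0 T (\<lambda>\<tau>. det_wavenumber X L \<nu> r c (u \<tau>))
          \<le> ennreal (lam L 0 + A) + ennreal (A powr (- s) * (C1 / \<nu>\<^sup>2)) * time_avg t0 T ?S"
        using lam_pos[OF L, of 0] A by (intro time_avg_affine_le T k) auto
      also have "\<dots> \<le> ennreal (lam L 0 + A) + ennreal (A powr (- s) * (C1 / \<nu>\<^sup>2)) * (ennreal (C0 * lam L 0 powr s) * ennreal (8 * C2 * \<nu>\<^sup>2 * \<kappa> * H))"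
        by (intro add_left_mono mult_left_mono order_trans[OF hyp] S2) auto
      also have "\<dots> = ennreal (lam L 0 + A + A powr (- s) * (C1 / \<nu>\<^sup>2) * ((C0 * lam L 0 powr s) * (8 * C2 * \<nu>\<^sup>2 * \<kappa> * H)))"
        using lam_pos[OF L, of 0] A C1(1) C2(1) assms(4) \<kappa> H0
        by (simp add: ennreal_plus[symmetric] ennreal_mult[symmetric] del: ennreal_plus)
      also have "\<dots> \<le> ennreal (lam L 0 + (A + A powr (- s) * (C3 * \<kappa> powr (1 + s) * H)))"
      proof (rule ennreal_leI)
        \<comment> \<open>Since 1/L <= 2\<pi>/L and s >= 0, the factor \<lambda>_0^s of the
          hypothesis can be exchanged for \<kappa>^s at no cost in the constant.\<close>
        have "lam L 0 powr s \<le> \<kappa> powr s"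
        proof (rule powr_mono2[OF s(1)])
          have "1 / L \<le> 2 * pi / L" using L pi_ge_two by (intro divide_right_mono) auto
          then show "lam L 0 \<le> \<kappa>" by (simp add: lam_def \<kappa>_def)
        qed (use lam_pos[OF L, of 0] in simp)
        then have "A powr (- s) * (C3 * \<kappa> * H) * lam L 0 powr s \<le> A powr (- s) * (C3 * \<kappa> * H) * \<kappa> powr s"
          using C3 \<kappa> H0 by (intro mult_left_mono) auto
        moreover have "A powr (- s) * (C1 / \<nu>\<^sup>2) * ((C0 * lam L 0 powr s) * (8 * C2 * \<nu>\<^sup>2 * \<kappa> * H)) = A powr (- s) * (C3 * \<kappa> * H) * lam L 0 powr s"
          using \<nu> by (simp add: C3_def)
        moreover have "A powr (- s) * (C3 * \<kappa> * H) * \<kappa> powr s = A powr (- s) * (C3 * \<kappa> powr (1 + s) * H)"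
          using \<kappa> by (simp add: powr_add)
        ultimately show "lam L 0 + A + A powr (- s) * (C1 / \<nu>\<^sup>2) * ((C0 * lam L 0 powr s) * (8 * C2 * \<nu>\<^sup>2 * \<kappa> * H))
          \<le> lam L 0 + (A + A powr (- s) * (C3 * \<kappa> powr (1 + s) * H))" by linarith
      qed
      also have "\<dots> = ennreal (lam L 0) + ennreal (A + A powr (- s) * (C3 * \<kappa> powr (1 + s) * H))"
        using lam_pos[OF L, of 0] A C3 H0 by (intro ennreal_plus) auto
      finally show ?thesis unfolding lhs_def by (simp add: ennreal_minus_le_iff)
    qed
    have main: "lhs \<le> ennreal ((1 + C3) * \<kappa> * H powr (1 / (1 + s)))"
      by (rule minimize_powr[OF s(1) H0 \<kappa> C3 bound])
    have "lhs \<le> ennreal ((1 + C3) * (G\<^sup>2 / (\<nu> * T * \<kappa>) + \<kappa> * G\<^sup>2))" if "d = 0"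
    proof -
      have "\<kappa> * H = G\<^sup>2 / (\<nu> * T * \<kappa>) + \<kappa> * G\<^sup>2"
        using \<kappa> by (simp add: H_def distrib_left power2_eq_square)
      moreover have "H powr (1 / (1 + s)) = H" using that H0 by (simp add: s_def)
      ultimately show ?thesis using main by (simp add: mult.assoc)
    qed
    moreover have "lhs \<le> ennreal ((1 + C3) * \<kappa> * H powr (1 / 2 + (3 - r) / (4 * r - 6)))" if "d = 3"
    proof -
      \<comment> \<open>For d = 3, 1 + s = 4 - 6/r, so the exponent is r / (4r - 6).\<close>
      have "1 / (1 + s) = 1 / 2 + (3 - r) / (4 * r - 6)"
        using assms(1) that by (simp add: s_def field_simps)
      then show ?thesis using main by simp
    qed
    ultimately show "let G = Grashof L \<nu> f; \<kappa> = 2 * pi / L;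
         lhs = time_avg t0 T (\<lambda>\<tau>. det_wavenumber X L \<nu> r c (u \<tau>)) - ennreal (lam L 0)
     in lhs \<le> ennreal ((1 + C3) * \<kappa> * (G\<^sup>2 / (\<nu> * T * \<kappa>\<^sup>2) + G\<^sup>2) powr (1 / (1 + d * (1 - 2 / r)))) \<and>
        (d = 0 \<longrightarrow> lhs \<le> ennreal ((1 + C3) * (G\<^sup>2 / (\<nu> * T * \<kappa>) + \<kappa> * G\<^sup>2))) \<and>
        (d = 3 \<longrightarrow> lhs \<le> ennreal ((1 + C3) * \<kappa> *
            (G\<^sup>2 / (\<nu> * T * \<kappa>\<^sup>2) + G\<^sup>2) powr (1 / 2 + (3 - r) / (4 * r - 6))))"
      using main unfolding Let_def lhs_def G_def H_def \<kappa>_def s_def by blast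
  qed (use C3 in simp)
qed

end
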